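(* Let $C: f=0$ be a reduced curve of degree $d$ in $\mathbb{P}^2=\mathbb{P}^2_{\mathbb{C}}$ with $mdr(f)>0$, and let $S_1,\dots,S_r$ be the list of the analytic isomorphism classes of all its singularities, so that $C\in V_d^{ea}(S_1,\dots,S_r)$. Then the Zariski tangent space $T_C\mathcal{V}_d^{ea}(S_1,\dots,S_r)$ of the analytic space $\mathcal{V}_d^{ea}(S_1,\dots,S_r)$ at the point $C$ sits in an exact sequence of complex vector spaces $$0 \to T_C (G \cdot C) \to T_C \mathcal{V}_d^{ea}(S_1,\dots,S_r) \to N(f)_d \to 0,$$ where the first map is the natural inclusion. In particular, $$\dim T_C \mathcal{V}_d^{ea}(S_1,\dots,S_r)=8-ar(f)_1+n(f)_d.$$
   Context: Let $S=\mathbb{C}[x,y,z]$ with its standard grading, $f\in S_d$ a reduced homogeneous polynomial of degree $d$, and $f_x,f_y,f_z$ its partial derivatives. Syzygies and Jacobian module. $J_f=(f_x,f_y,f_z)\subset S$ is the Jacobian ideal, $I_f$ is its saturation with respect to $(x,y,z)$, and $N(f)=I_f/J_f$ is the (graded) Jacobian module, with $n(f)_m=\dim_{\mathbb{C}} N(f)_m$. Set $AR(f)_m=\{(a,b,c)\in S_m^3 : af_x+bf_y+cf_z=0\}$, $ar(f)_m=\dim_{\mathbb{C}} AR(f)_m$, and $mdr(f)=\min\{m\ge 0: ar(f)_m>0\}$. (One has $mdr(f)=0$ iff $C$ consists of $d$ concurrent lines.) Group action. $G=PGL(3,\mathbb{C})$ acts on $\mathbb{P}^N=\mathbb{P}(S_d)$,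 $N=d(d+3)/2$, the space of degree $d$ plane curves, by linear changes of coordinates; $G\cdot C$ is the orbit of $C$. Equianalytic strata. $V_d^{ea}(S_1,\dots,S_r)\subset\mathbb{P}^N$ is the set of reduced degree $d$ curves having precisely $r$ singular points, which are analytically isomorphic to the isolated plane curve singularities $S_1,\dots,S_r$. It carries a natural, possibly non-reduced, complex analytic subspace structure $\mathcal{V}_d^{ea}(S_1,\dots,S_r)\subset \mathbb{P}^N$, characterized by the property that it parametrizes equianalytic families of such curves. Locally at a curve $C$ with singular points $p_1,\dots,p_r$: the universal family of degree $d$ curves induces a map germ $(\mathbb{P}^N,C)\to\prod_{j}(B_j,0)$, where $(B_j,0)$ is the (smooth) base of the miniversal deformation of the singularity $(C,p_j)$, and the germ of $\mathcal{V}_d^{ea}(S_1,\dots,S_r)$ at $C$ is the (scheme-theoretic) fibre of this map over the reduced point $0$. *)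

theory Defs
  imports
    "HOL-Analysis.Analysis"
    "HOL-Algebra.AbelCoset"
    "HOL-Library.Poly_Mapping"
    "HOL-Computational_Algebra.Squarefree"
    "Jordan_Normal_Form.Missing_VectorSpace"
begin

section \<open>Complex vector spaces, quotients, exact sequences\<close>

definition complex_field :: "complex ring" where
  "complex_field = \<lparr>carrier = UNIV, mult = (*), one = 1, zero = 0, add = (+)\<rparr>"

text \<open>The subset \<open>A\<close> of an ambient type, as a module record over \<open>\<complex>\<close> with the scalar
  multiplication \<open>sc\<close>; the ring components of the record play no role.\<close>

definition vspace :: "(complex \<Rightarrow> 'a \<Rightarrow> 'a) \<Rightarrow> ('a::ab_group_add) set \<Rightarrow> (complex, 'a) module" where
  "vspace sc A = \<lparr>carrier = A, mult = undefined, one = undefined, zero = 0, add = (+), smult = sc\<rparr>"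

definition quotient_space :: "(complex, 'a) module \<Rightarrow> 'a set \<Rightarrow> (complex, 'a set) module" where
  "quotient_space V W = \<lparr>carrier = a_rcosets\<^bsub>V\<^esub> W, mult = undefined, one = undefined,
     zero = W, add = set_add V, smult = (\<lambda>c X. \<Union>x\<in>X. W +>\<^bsub>V\<^esub> (c \<odot>\<^bsub>V\<^esub> x))\<rparr>"

definition short_exact ::
    "(complex, 'a) module \<Rightarrow> (complex, 'b) module \<Rightarrow> (complex, 'c) module \<Rightarrow> ('a \<Rightarrow> 'b) \<Rightarrow> ('b \<Rightarrow> 'c) \<Rightarrow> bool" where
  "short_exact A B C i p \<longleftrightarrow>
     linear_map complex_field A B i \<and> linear_map complex_field B C p \<and>
     inj_on i (carrier A) \<and>
     i ` carrier A = {v \<in> carrier B. p v = \<zero>\<^bsub>C\<^esub>} \<and>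
     p ` carrier B = carrier C"

section \<open>The polynomial ring \<open>S = \<complex>[x,y,z]\<close>\<close>

text \<open>The three variables are indexed by the three-element type \<open>3\<close>, so that points of \<open>\<complex>\<^sup>3\<close> are
  of type \<open>complex ^ 3\<close>.\<close>

type_synonym poly3 = "(3 \<Rightarrow>\<^sub>0 nat) \<Rightarrow>\<^sub>0 complex"

definition smul :: "complex \<Rightarrow> poly3 \<Rightarrow> poly3" where
  "smul c f = Poly_Mapping.single 0 c * f"

definition mdeg :: "(3 \<Rightarrow>\<^sub>0 nat) \<Rightarrow> nat" where
  "mdeg m = (\<Sum>i\<in>UNIV. Poly_Mapping.lookup m i)"

definition homog :: "nat \<Rightarrow> poly3 set" where
  "homog d = {f. \<forall>m\<in>Poly_Mapping.keys f. mdeg m = d}"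

definition eval :: "poly3 \<Rightarrow> complex ^ 3 \<Rightarrow> complex" where
  "eval f v = (\<Sum>m\<in>Poly_Mapping.keys f.
     Poly_Mapping.lookup f m * (\<Prod>i\<in>UNIV. v $ i ^ Poly_Mapping.lookup m i))"

definition pd :: "3 \<Rightarrow> poly3 \<Rightarrow> poly3" where
  "pd i f = (\<Sum>m\<in>Poly_Mapping.keys f. Poly_Mapping.single (m - Poly_Mapping.single i 1)
                              (of_nat (Poly_Mapping.lookup m i) * Poly_Mapping.lookup f m))"

definition lin_subst :: "complex ^ 3 ^ 3 \<Rightarrow> poly3 \<Rightarrow> poly3" where
  "lin_subst A f = (\<Sum>m\<in>Poly_Mapping.keys f. smul (Poly_Mapping.lookup f m)
     (\<Prod>i\<in>UNIV. (\<Sum>j\<in>UNIV. Poly_Mapping.single (Poly_Mapping.single j 1) (A $ i $ j)) ^ Poly_Mapping.lookup m i))"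

section \<open>Jacobian module and syzygies\<close>

definition jacobian_ideal :: "poly3 \<Rightarrow> poly3 set" where
  "jacobian_ideal f = {\<Sum>i\<in>UNIV. a i * pd i f | a. True}"

text \<open>\<open>\<Union>k. (J : (x,y,z)\<^sup>k)\<close>; the ideal \<open>(x,y,z)\<^sup>k\<close> is generated by the monomials of degree \<open>k\<close>.\<close>

definition saturation :: "poly3 set \<Rightarrow> poly3 set" where
  "saturation J = {h. \<exists>k. \<forall>m. mdeg m = k \<longrightarrow> Poly_Mapping.single m 1 * h \<in> J}"

definition jacobian_module :: "poly3 \<Rightarrow> nat \<Rightarrow> (complex, poly3 set) module" where
  "jacobian_module f m =
     quotient_space (vspace smul (saturation (jacobian_ideal f) \<inter> homog m)) (jacobian_ideal f \<inter> homog m)"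

definition n_jac :: "poly3 \<Rightarrow> nat \<Rightarrow> nat" where
  "n_jac f m = vectorspace.dim complex_field (jacobian_module f m)"

definition AR :: "poly3 \<Rightarrow> nat \<Rightarrow> (poly3 ^ 3) set" where
  "AR f m = {a. (\<forall>i. a $ i \<in> homog m) \<and> (\<Sum>i\<in>UNIV. a $ i * pd i f) = 0}"

definition ar :: "poly3 \<Rightarrow> nat \<Rightarrow> nat" where
  "ar f m = vectorspace.dim complex_field (vspace (\<lambda>c a. \<chi> i. smul c (a $ i)) (AR f m))"

definition mdr :: "poly3 \<Rightarrow> nat" where
  "mdr f = (LEAST m. ar f m > 0)"

section \<open>The space of plane curves and the orbit of a curve\<close>

text \<open>A point \<open>C\<close> of \<open>\<P>(S\<^sub>d)\<close> is represented by an equation \<open>f\<close>, and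
  \<open>T\<^sub>C \<P>(S\<^sub>d)\<close> is \<open>S\<^sub>d / \<complex>f\<close>: the class of \<open>h\<close> is the velocity at \<open>0\<close> of \<open>t \<mapsto> [f + t h]\<close>.\<close>

definition tangent_class :: "nat \<Rightarrow> poly3 \<Rightarrow> poly3 \<Rightarrow> poly3 set" where
  "tangent_class d f h = range (\<lambda>c. smul c f) +>\<^bsub>vspace smul (homog d)\<^esub> h"

definition T_PN :: "nat \<Rightarrow> poly3 \<Rightarrow> (complex, poly3 set) module" where
  "T_PN d f = quotient_space (vspace smul (homog d)) (range (\<lambda>c. smul c f))"

text \<open>The tangent space at \<open>C\<close> of the orbit \<open>G \<cdot> C = G / G\<^sub>C\<close> is the image of the differential at the
  identity of the orbit map \<open>A \<mapsto> [f \<circ> A]\<close>. This map is considered on \<open>GL(3)\<close>, whose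
  tangent space at the identity consists of all matrices \<open>B\<close>; \<open>GL(3) \<rightarrow> PGL(3)\<close> being a submersion,
  the image is the same. The choice of \<open>f \<circ> A\<close> or \<open>f \<circ> A\<^sup>-\<^sup>1\<close> only changes its sign.\<close>

definition T_orbit :: "nat \<Rightarrow> poly3 \<Rightarrow> (complex, poly3 set) module" where
  "T_orbit d f = (T_PN d f)\<lparr>carrier := {tangent_class d f h | h B. h \<in> homog d \<and>
     (\<forall>m. ((\<lambda>t. Poly_Mapping.lookup (lin_subst (\<chi> i j. (if i = j then 1 else 0) + t * B $ i $ j) f) m)
             has_field_derivative Poly_Mapping.lookup h m) (at 0))}\<rparr>"

section \<open>Germs of holomorphic functions\<close>

text \<open>A point of \<open>\<complex>\<^sup>n\<close> is given by the first \<open>n\<close> terms of a sequence, so that \<open>n\<close> can be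
  quantified over. A germ at \<open>0\<close> is represented by a function, whose values matter only near \<open>0\<close>;
  \<open>holo n\<close> forces it to depend, near \<open>0\<close>, on the first \<open>n\<close> coordinates only.\<close>

type_synonym cvec = "nat \<Rightarrow> complex"

definition near0 :: "nat \<Rightarrow> (cvec \<Rightarrow> bool) \<Rightarrow> bool" where
  "near0 n P \<longleftrightarrow> (\<exists>r>0. \<forall>z. (\<forall>i<n. norm (z i) < r) \<longrightarrow> P z)"

definition holo :: "nat \<Rightarrow> (cvec \<Rightarrow> complex) \<Rightarrow> bool" where
  "holo n F \<longleftrightarrow> (\<exists>c. near0 n (\<lambda>z.
     ((\<lambda>\<alpha>. c \<alpha> * (\<Prod>i<n. z i ^ Poly_Mapping.lookup \<alpha> i)) has_sum F z)
       {\<alpha> :: nat \<Rightarrow>\<^sub>0 nat. Poly_Mapping.keys \<alpha> \<subseteq> {..<n}}))"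

definition partial0 :: "nat \<Rightarrow> (cvec \<Rightarrow> complex) \<Rightarrow> complex" where
  "partial0 i F = deriv (\<lambda>t. F ((\<lambda>_. 0)(i := t))) 0"

definition germ_ideal :: "nat \<Rightarrow> (cvec \<Rightarrow> complex) set \<Rightarrow> (cvec \<Rightarrow> complex) set" where
  "germ_ideal n Gs = {h. holo n h \<and> (\<exists>(k::nat) a g. (\<forall>l<k. holo n (a l) \<and> g l \<in> Gs) \<and>
                           near0 n (\<lambda>s. h s = (\<Sum>l<k. a l s * g l s)))}"

text \<open>Zariski tangent space at \<open>0\<close> of the closed analytic subspace germ of \<open>(\<complex>\<^sup>n, 0)\<close> with ideal \<open>I\<close>.\<close>

definition zariski_tangent :: "nat \<Rightarrow> (cvec \<Rightarrow> complex) set \<Rightarrow> cvec set" where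
  "zariski_tangent n I = {v. (\<forall>i\<ge>n. v i = 0) \<and> (\<forall>h\<in>I. (\<Sum>i<n. partial0 i h * v i) = 0)}"

section \<open>Plane curve singularities and their miniversal deformations\<close>

text \<open>\<open>join x t\<close> is the point \<open>(x, t)\<close> of \<open>\<complex>\<^sup>2 \<times> \<complex>\<^sup>k\<close>, and \<open>param\<close> the projection to \<open>\<complex>\<^sup>k\<close>.\<close>

definition join :: "cvec \<Rightarrow> cvec \<Rightarrow> cvec" where
  "join x t = (\<lambda>i. if i < 2 then x i else t (i - 2))"

definition param :: "cvec \<Rightarrow> cvec" where
  "param z = (\<lambda>i. z (i + 2))"

text \<open>Plane curve germs \<open>(g = 0)\<close> and \<open>(h = 0)\<close> are isomorphic iff \<open>g = u \<cdot> (h \<circ> \<psi>)\<close> for a unit \<open>u\<close>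
  and an automorphism \<open>\<psi>\<close> of \<open>(\<complex>\<^sup>2, 0)\<close>.\<close>

definition analytically_isomorphic :: "(cvec \<Rightarrow> complex) \<Rightarrow> (cvec \<Rightarrow> complex) \<Rightarrow> bool" where
  "analytically_isomorphic g h \<longleftrightarrow> (\<exists>\<psi> u.
     (\<forall>i<2. holo 2 (\<lambda>x. \<psi> x i) \<and> \<psi> (\<lambda>_. 0) i = 0) \<and>
     partial0 0 (\<lambda>x. \<psi> x 0) * partial0 1 (\<lambda>x. \<psi> x 1)
       - partial0 1 (\<lambda>x. \<psi> x 0) * partial0 0 (\<lambda>x. \<psi> x 1) \<noteq> 0 \<and>
     holo 2 u \<and> u (\<lambda>_. 0) \<noteq> 0 \<and>
     near0 2 (\<lambda>x. g x = u x * h (\<psi> x)))"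

text \<open>Deformations of the germ \<open>(g = 0) \<subseteq> (\<complex>\<^sup>2, 0)\<close> over \<open>(\<complex>\<^sup>k, 0)\<close>: every such deformation is
  isomorphic to the hypersurface \<open>(G = 0)\<close> for some \<open>G(x, t)\<close> with \<open>G(x, 0) = g(x)\<close>.\<close>

definition deformation :: "(cvec \<Rightarrow> complex) \<Rightarrow> nat \<Rightarrow> (cvec \<Rightarrow> complex) \<Rightarrow> bool" where
  "deformation g k G \<longleftrightarrow> holo (2 + k) G \<and> near0 2 (\<lambda>x. G (join x (\<lambda>_. 0)) = g x)"

text \<open>The map germ \<open>\<phi> : (\<complex>\<^sup>k, 0) \<rightarrow> (\<complex>\<^sup>\<tau>, 0)\<close> induces the deformation \<open>G\<close> from the deformation \<open>F\<close>:
  \<open>G\<close> is isomorphic to the pull-back of \<open>F\<close> under \<open>\<phi>\<close>, by an isomorphism over \<open>(\<complex>\<^sup>k, 0)\<close> which is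
  the identity on the special fibre.\<close>

definition induced_by ::
    "nat \<Rightarrow> (cvec \<Rightarrow> complex) \<Rightarrow> nat \<Rightarrow> (cvec \<Rightarrow> complex) \<Rightarrow> (cvec \<Rightarrow> cvec) \<Rightarrow> bool" where
  "induced_by k G \<tau> F \<phi> \<longleftrightarrow>
     (\<forall>i<\<tau>. holo k (\<lambda>t. \<phi> t i) \<and> \<phi> (\<lambda>_. 0) i = 0) \<and>
     (\<exists>\<Psi> u. (\<forall>i<2. holo (2 + k) (\<lambda>z. \<Psi> z i)) \<and> holo (2 + k) u \<and>
        near0 2 (\<lambda>x. u (join x (\<lambda>_. 0)) = 1 \<and> (\<forall>i<2. \<Psi> (join x (\<lambda>_. 0)) i = x i)) \<and>
        near0 (2 + k) (\<lambda>z. G z = u z * F (join (\<Psi> z) (\<phi> (param z)))))"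

text \<open>Miniversal (semiuniversal) deformation with smooth base \<open>(\<complex>\<^sup>\<tau>, 0)\<close>: every deformation is
  induced from it, by a map germ whose differential at \<open>0\<close> is unique. It is enough to test
  this on smooth bases, since deformations of a hypersurface germ over a subgerm of
  \<open>(\<complex>\<^sup>k, 0)\<close> extend to \<open>(\<complex>\<^sup>k, 0)\<close>.\<close>

definition miniversal :: "(cvec \<Rightarrow> complex) \<Rightarrow> nat \<Rightarrow> (cvec \<Rightarrow> complex) \<Rightarrow> bool" where
  "miniversal g \<tau> F \<longleftrightarrow> deformation g \<tau> F \<and>
     (\<forall>k G. deformation g k G \<longrightarrow> (\<exists>\<phi>. induced_by k G \<tau> F \<phi>)) \<and>
     (\<forall>k G \<phi> \<phi>'. deformation g k G \<and> induced_by k G \<tau> F \<phi> \<and> induced_by k G \<tau> F \<phi>' \<longrightarrow>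
        (\<forall>i<\<tau>. \<forall>l<k. partial0 l (\<lambda>t. \<phi> t i) = partial0 l (\<lambda>t. \<phi>' t i)))"

section \<open>Equianalytic strata\<close>

text \<open>A frame \<open>q\<close> (a basis of \<open>\<complex>\<^sup>3\<close>, given by the rows of an invertible matrix) provides the affine
  coordinates \<open>(x\<^sub>0, x\<^sub>1) \<mapsto> [q\<^sub>1 + x\<^sub>0 q\<^sub>2 + x\<^sub>1 q\<^sub>3]\<close> of \<open>\<P>\<^sup>2\<close> centred at \<open>[q\<^sub>1]\<close>.\<close>

definition local_eq :: "complex ^ 3 ^ 3 \<Rightarrow> poly3 \<Rightarrow> cvec \<Rightarrow> complex" where
  "local_eq q f x = eval f (q $ 1 + x 0 *s q $ 2 + x 1 *s q $ 3)"

definition singular_at :: "poly3 \<Rightarrow> complex ^ 3 \<Rightarrow> bool" where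
  "singular_at f p \<longleftrightarrow> p \<noteq> 0 \<and> eval f p = 0 \<and> (\<forall>i. eval (pd i f) p = 0)"

text \<open>Frames centred at the singular points of \<open>f = 0\<close> in \<open>\<P>\<^sup>2\<close>, one for each singular point.\<close>

definition singular_frames :: "poly3 \<Rightarrow> (complex ^ 3 ^ 3) list \<Rightarrow> bool" where
  "singular_frames f qs \<longleftrightarrow>
     (\<forall>q\<in>set qs. invertible q \<and> singular_at f (q $ 1)) \<and>
     (\<forall>p. singular_at f p \<longrightarrow> (\<exists>!j. j < length qs \<and> (\<exists>c. p = c *s qs ! j $ 1)))"

text \<open>\<open>f \<in> V_ea d S\<close> says that the curve \<open>f = 0\<close> lies in the stratum of the singularities in the list
  \<open>S\<close>, which are represented by equations of plane curve germs.\<close>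

definition V_ea :: "nat \<Rightarrow> (cvec \<Rightarrow> complex) list \<Rightarrow> poly3 set" where
  "V_ea d S = {f. f \<in> homog d \<and> f \<noteq> 0 \<and> squarefree f \<and> (\<forall>s\<in>set S. holo 2 s) \<and>
     (\<exists>qs. singular_frames f qs \<and> length qs = length S \<and>
        (\<forall>j<length S. analytically_isomorphic (local_eq (qs ! j) f) (S ! j)))}"

text \<open>The affine chart \<open>s \<mapsto> [f + \<Sum>i. s\<^sub>i b\<^sub>i]\<close> of \<open>\<P>\<^sup>N = \<P>(S\<^sub>d)\<close>, \<open>N = d(d + 3)/2\<close>, centred at
  the curve \<open>f = 0\<close>, and the equation of the universal family in it.\<close>

definition dim_PN :: "nat \<Rightarrow> nat" where
  "dim_PN d = d * (d + 3) div 2"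

definition PN_chart :: "nat \<Rightarrow> poly3 \<Rightarrow> (nat \<Rightarrow> poly3) \<Rightarrow> bool" where
  "PN_chart d f b \<longleftrightarrow> inj_on b {..<dim_PN d} \<and> f \<notin> b ` {..<dim_PN d} \<and>
     vectorspace.basis complex_field (vspace smul (homog d)) (insert f (b ` {..<dim_PN d}))"

definition universal_family :: "nat \<Rightarrow> poly3 \<Rightarrow> (nat \<Rightarrow> poly3) \<Rightarrow> cvec \<Rightarrow> poly3" where
  "universal_family d f b s = f + (\<Sum>i<dim_PN d. smul (s i) (b i))"

text \<open>\<open>I\<close> is the ideal, in the chart \<open>b\<close>, of the germ at \<open>f\<close> of the analytic space
  \<open>\<V>\<^sub>d\<^sup>e\<^sup>a(S)\<close>, that is, of the fibre over \<open>0\<close> of the map germ \<open>(\<phi>\<^sub>j)\<^sub>j\<close> from \<open>(\<P>\<^sup>N, C)\<close> to the product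
  of the bases \<open>(\<complex>\<^sup>\<tau>\<^sup>j, 0)\<close> of miniversal deformations \<open>F\<^sub>j\<close> of the singularities of \<open>f = 0\<close>,
  where \<open>\<phi>\<^sub>j\<close> induces from \<open>F\<^sub>j\<close> the deformation given by the universal family.\<close>

definition V_ea_germ ::
    "nat \<Rightarrow> (cvec \<Rightarrow> complex) list \<Rightarrow> poly3 \<Rightarrow> (nat \<Rightarrow> poly3) \<Rightarrow> (cvec \<Rightarrow> complex) set \<Rightarrow> bool" where
  "V_ea_germ d S f b I \<longleftrightarrow> f \<in> V_ea d S \<and> PN_chart d f b \<and>
     (\<exists>qs \<tau> F \<phi>. singular_frames f qs \<and>
        (\<forall>j<length qs. miniversal (local_eq (qs ! j) f) (\<tau> j) (F j) \<and>
           induced_by (dim_PN d) (\<lambda>z. local_eq (qs ! j) (universal_family d f b (param z)) z)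
             (\<tau> j) (F j) (\<phi> j)) \<and>
        I = germ_ideal (dim_PN d) {\<lambda>s. \<phi> j s i | j i. j < length qs \<and> i < \<tau> j})"

text \<open>The Zariski tangent space of that germ, as a subspace of \<open>T\<^sub>C \<P>\<^sup>N\<close>; the differential of the chart
  at \<open>0\<close> is \<open>v \<mapsto> [\<Sum>i. v\<^sub>i b\<^sub>i]\<close>.\<close>

definition T_V_ea :: "nat \<Rightarrow> poly3 \<Rightarrow> (nat \<Rightarrow> poly3) \<Rightarrow> (cvec \<Rightarrow> complex) set \<Rightarrow> (complex, poly3 set) module" where
  "T_V_ea d f b I = (T_PN d f)\<lparr>carrier :=
     {tangent_class d f (\<Sum>i<dim_PN d. smul (v i) (b i)) | v. v \<in> zariski_tangent (dim_PN d) I}\<rparr>"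

end

theory Submission
  imports Defs "HOL-Computational_Algebra.Fundamental_Theorem_Algebra"
begin

text \<open>Let \<open>J\<close> be the Jacobian ideal of \<open>f\<close> and \<open>I\<close> its saturation. In \<open>T\<^sub>C \<P>(S\<^sub>d) = S\<^sub>d / \<complex>f\<close>,
  the tangent space of the orbit is \<open>J\<^sub>d / \<complex>f\<close>, because the derivative of \<open>f \<circ> (1 + tB)\<close> at \<open>t = 0\<close> is
  \<open>\<Sum> B\<^sub>i\<^sub>j x\<^sub>j f\<^sub>i\<close>, and the tangent space of the stratum is \<open>I\<^sub>d / \<complex>f\<close>. The second claim has two parts.
  The differential at \<open>C\<close> of the map to the base of the miniversal deformation of \<open>(C, p)\<close> kills \<open>h\<close> iff
  the germ of \<open>h\<close> at \<open>p\<close> lies in the Tjurina ideal \<open>(g, g\<^sub>x, g\<^sub>y)\<close> of a local equation \<open>g\<close> of \<open>C\<close>; and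
  \<open>h\<close> satisfies this at all singular points iff it lies in the saturation of \<open>J\<close>. The dimension formula
  then follows from rank and nullity, since \<open>J\<^sub>d\<close> is the image of the space of triples of linear forms, of
  dimension 9, under a map with kernel \<open>AR(f)\<^sub>1\<close>. The hypothesis \<open>mdr f > 0\<close> serves to exclude \<open>d = 0\<close>,
  where \<open>f \<notin> J\<close>.\<close>

subsection \<open>Polynomials\<close>

text \<open>Two obstacles shape the work. Miniversality is available only as a universal property
  with a unique differential; no basis of the Tjurina algebra is given. Modulo the Tjurina ideal,
  \<open>h\<close> is congruent to a combination of the derivatives of the miniversal family along
  its base, whose coefficients are the differential applied to \<open>h\<close>. That membership of
  \<open>h\<close> forces these coefficients to vanish requires independence of the derivatives,
  which has to be extracted from uniqueness alone. Secondly, the Tjurina ideal has convergent power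
  series as coefficients, while saturation concerns polynomials. Truncating the coefficients leaves
  a polynomial relation with an error of high order at the singular point, and the Nullstellensatz
  absorbs this error into \<open>J\<close> after multiplication by a polynomial nonzero at that
  point. Germs are controlled by a weighted sum of the absolute values of their coefficients, for
  which products, composition and division by a coordinate have explicit bounds. The constant 8 is 9
  - 1, since the line spanned by \<open>f\<close> is divided out.\<close>

abbreviation lk where "lk \<equiv> Poly_Mapping.lookup"
abbreviation sg where "sg \<equiv> Poly_Mapping.single"

lemma sum_singles: "(\<Sum>m\<in>Poly_Mapping.keys f. sg m (lk f m)) = f"
  by (intro poly_mapping_eqI) (simp add: lookup_sum lookup_single when_def in_keys_iff)

text \<open>Zero needs no case of its own, being a single term with coefficient 0. Identities
  additive in \<open>f\<close> then have to be checked on terms only.\<close>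

lemma poly_mapping_add_induct [case_names single add]:
  assumes "\<And>m c. P (sg m c)" and "\<And>f g. P f \<Longrightarrow> P g \<Longrightarrow> P (f + g)"
  shows "P (f :: 'a \<Rightarrow>\<^sub>0 'b::comm_monoid_add)"
proof -
  have "P (\<Sum>m\<in>A. sg m (lk f m))" if "finite A" for A
    using that
  proof (induction A)
    case empty
    then show ?case using assms(1)[of undefined 0] by simp
  qed (use assms in auto)
  then show ?thesis using sum_singles[of f] by (metis finite_keys)
qed

subsection \<open>Evaluation\<close>

definition monom_eval :: "(3 \<Rightarrow>\<^sub>0 nat) \<Rightarrow> complex ^ 3 \<Rightarrow> complex" where
  "monom_eval m v = (\<Prod>i\<in>UNIV. v $ i ^ lk m i)"

lemma monom_eval_add: "monom_eval (m + k) v = monom_eval m v * monom_eval k v"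
  by (simp add: monom_eval_def lookup_add power_add prod.distrib)

lemma monom_eval_0 [simp]: "monom_eval 0 v = 1"
  by (simp add: monom_eval_def)

lemma eval_eq_sum:
  assumes "finite A" and "Poly_Mapping.keys f \<subseteq> A"
  shows "eval f v = (\<Sum>m\<in>A. lk f m * monom_eval m v)"
  unfolding eval_def monom_eval_def[symmetric]
  by (intro sum.mono_neutral_left) (use assms in \<open>auto simp: in_keys_iff\<close>)

lemma eval_single [simp]: "eval (sg m c) v = c * monom_eval m v"
  by (subst eval_eq_sum[of "{m}"]) auto

lemma eval_0 [simp]: "eval 0 v = 0"
  by (simp add: eval_def)

lemma eval_1 [simp]: "eval 1 v = 1"
  using eval_single[of 0 1 v] by simp

lemma eval_add [simp]: "eval (f + g) v = eval f v + eval g v"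
proof -
  let ?A = "Poly_Mapping.keys f \<union> Poly_Mapping.keys g"
  have "Poly_Mapping.keys (f + g) \<subseteq> ?A" by (rule keys_add)
  then show ?thesis
    by (simp add: eval_eq_sum[of ?A] lookup_add algebra_simps sum.distrib)
qed

lemma eval_mult [simp]: "eval (f * g) v = eval f v * eval g v"
proof (induction f rule: poly_mapping_add_induct)
  case (single m c)
  show ?case
    by (induction g rule: poly_mapping_add_induct)
       (simp_all add: mult_single monom_eval_add algebra_simps)
qed (simp add: algebra_simps)

lemma eval_uminus [simp]: "eval (- f) v = - eval f v"
  using eval_add[of f "- f" v] by (simp add: eq_neg_iff_add_eq_0 add.commute)

lemma eval_diff [simp]: "eval (f - g) v = eval f v - eval g v"
  using eval_add[of f "- g" v] by simp

lemma eval_sum [simp]: "eval (sum h A) v = (\<Sum>a\<in>A. eval (h a) v)"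
  by (induction A rule: infinite_finite_induct) auto

lemma eval_prod [simp]: "eval (prod h A) v = (\<Prod>a\<in>A. eval (h a) v)"
  by (induction A rule: infinite_finite_induct) auto

lemma eval_power [simp]: "eval (f ^ n) v = eval f v ^ n"
  by (induction n) auto

lemma eval_smul [simp]: "eval (smul c f) v = c * eval f v"
  by (simp add: smul_def)

definition X :: "3 \<Rightarrow> poly3" where "X i = sg (sg i 1) 1"

lemma eval_X [simp]: "eval (X i) v = v $ i"
proof -
  have "monom_eval (sg i 1) v = (\<Prod>j\<in>UNIV. if j = i then v $ i else 1)"
    unfolding monom_eval_def by (intro prod.cong) (auto simp: lookup_single when_def)
  then show ?thesis by (simp add: X_def)
qed

lemma monom_eval_smult: "monom_eval m (c *s v) = c ^ mdeg m * monom_eval m v"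
  by (simp add: monom_eval_def mdeg_def power_mult_distrib prod.distrib power_sum)

lemma eval_homog: "f \<in> homog d \<Longrightarrow> eval f (c *s v) = c ^ d * eval f v"
  unfolding eval_def monom_eval_def[symmetric] sum_distrib_left
  by (intro sum.cong) (auto simp: homog_def monom_eval_smult)

subsection \<open>Scalar multiplication\<close>

lemma lookup_smul [simp]: "lk (smul c f) m = c * lk f m"
proof (induction f rule: poly_mapping_add_induct)
  case (single k b)
  then show ?case by (simp add: smul_def mult_single lookup_single when_def)
qed (simp add: smul_def lookup_add algebra_simps)

lemma smul_mult_left: "smul c (f * g) = smul c f * g"
  and smul_mult_right: "smul c (f * g) = f * smul c g"
  by (simp_all add: smul_def mult_ac)

interpretation poly3: vector_space smul
  by unfold_locales (auto simp: smul_def algebra_simps single_add mult_single)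

subsection \<open>Homogeneous polynomials\<close>

lemma homogI: "(\<And>m. lk f m \<noteq> 0 \<Longrightarrow> mdeg m = d) \<Longrightarrow> f \<in> homog d"
  by (auto simp: homog_def in_keys_iff)

lemma homogD: "f \<in> homog d \<Longrightarrow> lk f m \<noteq> 0 \<Longrightarrow> mdeg m = d"
  by (auto simp: homog_def in_keys_iff)

lemma mdeg_add [simp]: "mdeg (m + k) = mdeg m + mdeg k"
  by (simp add: mdeg_def lookup_add sum.distrib)

lemma mdeg_0 [simp]: "mdeg 0 = 0"
  by (simp add: mdeg_def)

lemma mdeg_single [simp]: "mdeg (sg i n) = n"
  by (simp add: mdeg_def lookup_single when_def)

lemma homog_0 [simp]: "0 \<in> homog d"
  by (simp add: homog_def)

lemma homog_add: "f \<in> homog d \<Longrightarrow> g \<in> homog d \<Longrightarrow> f + g \<in> homog d"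
  by (rule homogI) (auto simp: lookup_add dest: homogD, metis add.right_neutral homogD)

lemma homog_smul: "f \<in> homog d \<Longrightarrow> smul c f \<in> homog d"
  by (rule homogI) (auto dest: homogD)

lemma homog_uminus: "f \<in> homog d \<Longrightarrow> - f \<in> homog d"
  by (rule homogI) (auto dest: homogD)

lemma homog_diff: "f \<in> homog d \<Longrightarrow> g \<in> homog d \<Longrightarrow> f - g \<in> homog d"
  using homog_add[of f d "- g"] homog_uminus[of g d] by simp

lemma homog_sum: "(\<And>a. a \<in> A \<Longrightarrow> h a \<in> homog d) \<Longrightarrow> sum h A \<in> homog d"
  by (induction A rule: infinite_finite_induct) (auto intro: homog_add)

lemma homog_single: "mdeg m = d \<Longrightarrow> sg m c \<in> homog d"
  by (rule homogI) (auto simp: lookup_single when_def split: if_splits)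

lemma homog_X [simp]: "X i \<in> homog 1"
  unfolding X_def by (rule homog_single) simp

lemma homog_mult: "f \<in> homog d \<Longrightarrow> g \<in> homog e \<Longrightarrow> f * g \<in> homog (d + e)"
  using keys_mult[of f g] by (fastforce simp: homog_def)

lemma homog_1 [simp]: "1 \<in> homog 0"
  using homog_single[of 0 0 1] by simp

lemma homog_power: "f \<in> homog d \<Longrightarrow> f ^ n \<in> homog (n * d)"
  by (induction n) (auto intro: homog_mult)

lemma subspace_homog: "poly3.subspace (homog d)"
  by (rule poly3.subspaceI) (auto intro: homog_add homog_smul)

definition hcomp :: "nat \<Rightarrow> poly3 \<Rightarrow> poly3" where
  "hcomp e f = (\<Sum>m\<in>Poly_Mapping.keys f. if mdeg m = e then sg m (lk f m) else 0)"

lemma lookup_hcomp: "lk (hcomp e f) m = (if mdeg m = e then lk f m else 0)"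
proof -
  have "lk (hcomp e f) m = (\<Sum>k\<in>Poly_Mapping.keys f. if k = m then (if mdeg m = e then lk f m else 0) else 0)"
    unfolding hcomp_def lookup_sum by (intro sum.cong) (auto simp: lookup_single when_def)
  then show ?thesis by (simp add: in_keys_iff)
qed

lemma homog_hcomp [simp]: "hcomp e f \<in> homog e"
  by (rule homogI) (auto simp: lookup_hcomp split: if_splits)

lemma hcomp_add: "hcomp e (f + g) = hcomp e f + hcomp e g"
  by (rule poly_mapping_eqI) (auto simp: lookup_hcomp lookup_add)

lemma hcomp_sum: "hcomp e (sum h A) = (\<Sum>a\<in>A. hcomp e (h a))"
  by (intro poly_mapping_eqI) (simp add: lookup_hcomp lookup_sum)

lemma hcomp_homog: "f \<in> homog d \<Longrightarrow> hcomp e f = (if e = d then f else 0)"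
  by (rule poly_mapping_eqI) (use homogD in \<open>auto simp: lookup_hcomp\<close>)

text \<open>Multiplication by a form shifts components; this allows the coefficients of an element
  of \<open>J\<close> of degree \<open>d\<close> to be cut down to linear forms.\<close>

lemma hcomp_mult:
  assumes "g \<in> homog e"
  shows "hcomp (k + e) (f * g) = hcomp k f * g"
proof (induction f rule: poly_mapping_add_induct)
  case (single m c)
  have "sg m c * g \<in> homog (mdeg m + e)" "sg m c \<in> homog (mdeg m)"
    using assms by (auto intro: homog_mult homog_single)
  then show ?case by (simp add: hcomp_homog)
qed (simp add: hcomp_add algebra_simps)

subsection \<open>Partial derivatives\<close>

lemma lookup_pd: "lk (pd i f) m = of_nat (lk m i + 1) * lk f (m + sg i 1)"
proof -
  \<comment> \<open>Subtraction of exponents is truncated: if \<open>lk k i = 0\<close>, the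
    exponent \<open>k - sg i 1\<close> is \<open>k\<close> itself, and only the factor
    \<open>lk k i\<close> removes that term.\<close>
  have *: "lk (sg (k - sg i 1) (of_nat (lk k i) * lk f k)) m =
      (if k = m + sg i 1 then of_nat (lk m i + 1) * lk f (m + sg i 1) else 0)" for k
  proof (cases "lk k i = 0")
    case True
    then have "k \<noteq> m + sg i 1" by (auto simp: lookup_add)
    then show ?thesis using True by simp
  next
    case False
    then have "k = (k - sg i 1) + sg i 1"
      by (intro poly_mapping_eqI) (auto simp: lookup_add lookup_minus lookup_single when_def)
    then have "k - sg i 1 = m \<longleftrightarrow> k = m + sg i 1" by (metis add_diff_cancel_right')
    then show ?thesis by (auto simp: lookup_single when_def lookup_add)
  qed
  show ?thesis
    unfolding pd_def lookup_sum * by (simp add: in_keys_iff)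
qed

lemma pd_add: "pd i (f + g) = pd i f + pd i g"
  by (rule poly_mapping_eqI) (simp add: lookup_pd lookup_add algebra_simps)

lemma pd_single: "pd i (sg m c) = sg (m - sg i 1) (of_nat (lk m i) * c)"
  by (simp add: pd_def)

lemma homog_pd:
  assumes "f \<in> homog (Suc d)" shows "pd i f \<in> homog d"
proof (rule homogI)
  fix m assume "lk (pd i f) m \<noteq> 0"
  then have "mdeg (m + sg i 1) = Suc d" using assms by (intro homogD) (auto simp: lookup_pd)
  then show "mdeg m = d" by simp
qed

text \<open>Terms are eigenvectors of \<open>X i * pd i\<close>; the eigenvalues add up over
  \<open>i\<close> to the degree, which is the source of Euler's identity.\<close>

lemma X_mult_pd_single: "X i * pd i (sg m c) = smul (of_nat (lk m i)) (sg m c)"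
proof (cases "lk m i = 0")
  case False
  then have "m = sg i 1 + (m - sg i 1)"
    by (intro poly_mapping_eqI) (auto simp: lookup_add lookup_minus lookup_single when_def)
  then have "X i * pd i (sg m c) = sg m (of_nat (lk m i) * c)"
    by (simp add: pd_single X_def mult_single)
  then show ?thesis unfolding smul_def mult_single by simp
qed (simp add: pd_single)

lemma euler: "f \<in> homog d \<Longrightarrow> (\<Sum>i\<in>UNIV. X i * pd i f) = smul (of_nat d) f"
proof -
  assume f: "f \<in> homog d"
  have gen: "(\<Sum>i\<in>UNIV. X i * pd i g) = (\<Sum>m\<in>Poly_Mapping.keys g. smul (of_nat (mdeg m)) (sg m (lk g m)))"
    for g
  proof -
    have pdg: "pd i g = (\<Sum>m\<in>Poly_Mapping.keys g. pd i (sg m (lk g m)))" for i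
      by (simp add: pd_single pd_def[of i g])
    have "(\<Sum>i\<in>UNIV. X i * pd i g)
        = (\<Sum>i\<in>UNIV. \<Sum>m\<in>Poly_Mapping.keys g. smul (of_nat (lk m i)) (sg m (lk g m)))"
      unfolding pdg sum_distrib_left X_mult_pd_single ..
    also have "\<dots> = (\<Sum>m\<in>Poly_Mapping.keys g. \<Sum>i\<in>UNIV. smul (of_nat (lk m i)) (sg m (lk g m)))"
      by (rule sum.swap)
    finally show ?thesis by (simp add: mdeg_def poly3.scale_sum_left)
  qed
  have "(\<Sum>i\<in>UNIV. X i * pd i f) = (\<Sum>m\<in>Poly_Mapping.keys f. smul (of_nat d) (sg m (lk f m)))"
    unfolding gen using f by (intro sum.cong) (auto simp: homog_def)
  then show ?thesis by (simp only: poly3.scale_sum_right[symmetric] sum_singles)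
qed

text \<open>The chain rule along a line serves twice: with \<open>e\<close> a row of a frame it
  relates \<open>local_pd\<close> to the local equation, with \<open>e = B *v v\<close> it computes
  the derivative of the group action.\<close>

lemma has_derivative_eval:
  "((\<lambda>s. eval f (p + s *s e)) has_field_derivative (\<Sum>i\<in>UNIV. e $ i * eval (pd i f) p)) (at 0)"
proof (induction f rule: poly_mapping_add_induct)
  case (single m c)
  let ?m = "lk m"
  have me: "monom_eval k v = v $ 1 ^ lk k 1 * (v $ 2 ^ lk k 2 * v $ 3 ^ lk k 3)" for k v
    unfolding monom_eval_def UNIV_3 by (simp add: mult.assoc)
  show ?case
    unfolding eval_single me pd_single sum_3
    by (auto intro!: derivative_eq_intros simp: lookup_minus lookup_single when_def algebra_simps)
next
  case (add f g)
  from DERIV_add[OF add] show ?case by (simp add: pd_add algebra_simps sum.distrib)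
qed

subsection \<open>Polynomials as functions\<close>

text \<open>Kronecker's substitution: on the curve \<open>(t, t^B, t^(B*B))\<close>, with
  \<open>B\<close> larger than all exponents, distinct monomials become distinct powers of
  \<open>t\<close>, because the exponents are the digits of \<open>e\<close> in base
  \<open>B\<close>.\<close>

lemma eval_eq_0_imp:
  assumes "\<And>v. eval f v = 0" shows "f = 0"
proof (rule ccontr)
  assume "f \<noteq> 0"
  then obtain m where m: "m \<in> Poly_Mapping.keys f"
    by (metis poly_mapping_eqI in_keys_iff lookup_zero)
  define K where "K = Poly_Mapping.keys f"
  define B where "B = Suc (\<Sum>k\<in>K. mdeg k)"
  define e where "e k = lk k 1 + B * (lk k 2 + B * lk k 3)" for k :: "3 \<Rightarrow>\<^sub>0 nat"
  have finK: "finite K" by (simp add: K_def)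
  have lt: "lk k i < B" if "k \<in> K" for k i
  proof -
    have "lk k i \<le> mdeg k" unfolding mdeg_def by (rule member_le_sum) auto
    also have "\<dots> \<le> (\<Sum>k\<in>K. mdeg k)" using that finK by (intro member_le_sum) auto
    finally show ?thesis by (simp add: B_def)
  qed
  have inj: "k = l" if "k \<in> K" "l \<in> K" "e k = e l" for k l
  proof -
    have "e k mod B = e l mod B" "e k div B = e l div B" using that by auto
    then have 1: "lk k 1 = lk l 1" and 2: "lk k 2 + B * lk k 3 = lk l 2 + B * lk l 3"
      using lt that by (auto simp: e_def)
    from 2 have "(lk k 2 + B * lk k 3) mod B = (lk l 2 + B * lk l 3) mod B" by simp
    then have 3: "lk k 2 = lk l 2"
      using lt[OF that(1), of 2] lt[OF that(2), of 2] by (simp only: mod_mult_self2 mod_less)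
    have "B * lk k 3 = B * lk l 3" using 2 unfolding 3 by (rule add_left_imp_eq)
    moreover have "0 < B" by (simp add: B_def)
    ultimately have "lk k 3 = lk l 3" by (simp only: nat_mult_eq_cancel1)
    with 1 3 show ?thesis by (intro poly_mapping_eqI) (smt (verit) exhaust_3)
  qed
  define P where "P = (\<Sum>k\<in>K. Polynomial.monom (lk f k) (e k))"
  have "poly P t = 0" for t
  proof -
    let ?v = "vector [t, t ^ B, t ^ (B * B)] :: complex ^ 3"
    have "monom_eval k ?v = t ^ lk k 1 * ((t ^ B) ^ lk k 2 * (t ^ (B * B)) ^ lk k 3)" for k
      unfolding monom_eval_def UNIV_3 by (simp add: vector_3 mult.assoc)
    also have "\<dots> k = t ^ e k" for k
      unfolding e_def power_add power_mult[symmetric] distrib_left mult.assoc ..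
    finally have mt: "monom_eval k ?v = t ^ e k" for k .
    have "eval f ?v = (\<Sum>k\<in>K. lk f k * monom_eval k ?v)"
      by (rule eval_eq_sum) (simp_all add: K_def)
    then have "poly P t = eval f ?v"
      unfolding P_def poly_sum poly_monom mt by simp
    then show ?thesis using assms by simp
  qed
  then have "P = 0" using poly_all_0_iff_0 by blast
  moreover have "coeff P (e m) = (\<Sum>k\<in>K. if k = m then lk f m else 0)"
    unfolding P_def coeff_sum
  proof (rule sum.cong)
    fix k assume "k \<in> K"
    then show "coeff (Polynomial.monom (lk f k) (e k)) (e m) = (if k = m then lk f m else 0)"
      using inj[of k m] m by (auto simp: K_def)
  qed simp
  ultimately show False using m finK by (simp add: K_def in_keys_iff)
qed

lemma eval_inject: "(\<And>v. eval f v = eval g v) \<Longrightarrow> f = g"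
  using eval_eq_0_imp[of "f - g"] by simp

subsection \<open>Linear substitutions\<close>

lemma eval_lin_subst: "eval (lin_subst A f) v = eval f (A *v v)"
proof -
  have *: "monom_eval (sg j 1) v = v $ j" for j
    using eval_X[of j v] by (simp add: X_def)
  show ?thesis
    unfolding lin_subst_def eval_sum eval_smul eval_prod eval_power eval_single *
    by (simp add: eval_def[of f] matrix_vector_mult_def)
qed

text \<open>As a functional equation, homogeneity passes to linear substitutions through evaluation
  alone.\<close>

lemma homog_iff: "f \<in> homog d \<longleftrightarrow> (\<forall>c v. eval f (c *s v) = c ^ d * eval f v)"
proof
  assume *: "\<forall>c v. eval f (c *s v) = c ^ d * eval f v"
  show "f \<in> homog d"
  proof (rule homogI)
    fix m assume m: "lk f m \<noteq> 0"
    have "poly (Polynomial.monom (lk f m) (mdeg m)) c = poly (Polynomial.monom (lk f m) d) c" for c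
    proof -
      \<comment> \<open>This is \<open>f(c x) - c^d f(x)\<close>, zero as a function. Its
        coefficient at \<open>m\<close> gives an identity valid for all \<open>c\<close>, from which
        the degree of \<open>m\<close> is read off.\<close>
      define g where "g = (\<Sum>k\<in>Poly_Mapping.keys f. sg k (c ^ mdeg k * lk f k)) - smul (c ^ d) f"
      have "eval g v = eval f (c *s v) - c ^ d * eval f v" for v
        unfolding g_def eval_diff eval_sum eval_smul eval_single
        by (simp add: eval_eq_sum[of "Poly_Mapping.keys f" f] monom_eval_smult mult_ac)
      then have "g = 0" using * by (intro eval_eq_0_imp) auto
      then have "lk g m = 0" by simp
      then show ?thesis
        using m by (simp add: g_def lookup_minus lookup_sum lookup_single when_def poly_monom in_keys_iff
             mult.commute)
    qed
    then have "Polynomial.monom (lk f m) (mdeg m) = Polynomial.monom (lk f m) d"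
      using poly_eq_poly_eq_iff by blast
    then show "mdeg m = d" using m by (metis coeff_monom)
  qed
qed (use eval_homog in auto)

lemma homog_lin_subst: "f \<in> homog d \<Longrightarrow> lin_subst A f \<in> homog d"
  by (simp add: homog_iff eval_lin_subst vector_scalar_commute)

subsection \<open>The Nullstellensatz\<close>

definition poly_ideal :: "poly3 set \<Rightarrow> bool" where
  "poly_ideal K \<longleftrightarrow> 0 \<in> K \<and> (\<forall>a\<in>K. \<forall>b\<in>K. a + b \<in> K) \<and> (\<forall>r. \<forall>a\<in>K. r * a \<in> K)"

lemma poly_ideal_diff: "poly_ideal K \<Longrightarrow> a \<in> K \<Longrightarrow> b \<in> K \<Longrightarrow> a - b \<in> K"
  unfolding poly_ideal_def by (metis mult_minus1 uminus_add_conv_diff add.commute)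

lemma poly_ideal_sum:
  "poly_ideal K \<Longrightarrow> (\<And>a. a \<in> A \<Longrightarrow> h a \<in> K) \<Longrightarrow> sum h A \<in> K"
  by (induction A rule: infinite_finite_induct) (auto simp: poly_ideal_def)

lemma prod_3: "prod g (UNIV :: 3 set) = g 1 * (g 2 * g 3)"
  unfolding UNIV_3 by (simp add: mult.assoc)

lemma finite_mdeg_le: "finite {m. mdeg m \<le> e}"
proof (rule finite_imageD)
  have "lk m i \<le> mdeg m" for m and i :: 3
    unfolding mdeg_def by (rule member_le_sum) auto
  then have "lk ` {m. mdeg m \<le> e} \<subseteq> PiE UNIV (\<lambda>_. {..e})"
    by (auto intro: order_trans)
  moreover have "finite (PiE UNIV (\<lambda>_::3. {..e}))"
    by (rule finite_PiE) auto
  ultimately show "finite (lk ` {m. mdeg m \<le> e})" by (rule finite_subset)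
  show "inj_on lk {m :: 3 \<Rightarrow>\<^sub>0 nat. mdeg m \<le> e}"
    by (auto intro!: inj_onI poly_mapping_eqI)
qed

text \<open>As \<open>\<complex>\<close> is uncountable and \<open>\<complex>[x, y, z]\<close> has countable dimension, infinitely many of the
  \<open>g a\<close> lie in a finite-dimensional space.\<close>

lemma dependent_uncountable_family:
  fixes g :: "complex \<Rightarrow> poly3" and n :: "complex \<Rightarrow> nat"
  assumes inj: "\<And>a b. n a = n b \<Longrightarrow> g a = g b \<Longrightarrow> a = b"
  obtains B N c a where "finite B" "\<And>b. b \<in> B \<Longrightarrow> n b = N" "(\<Sum>b\<in>B. smul (c b) (g b)) = 0"
    "a \<in> B" "c a \<noteq> (0 :: complex)"
proof -
  \<comment> \<open>The exponent \<open>n a\<close> and a degree bound for \<open>g a\<close> take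
    only countably many values together, so some class with both fixed is uncountable.\<close>
  define A where "A = (\<lambda>(N, e). {a. n a = N \<and> Poly_Mapping.keys (g a) \<subseteq> {m. mdeg m \<le> e}})"
  have "a \<in> (\<Union>p. A p)" for a
  proof -
    have "Poly_Mapping.keys (g a) \<subseteq> {m. mdeg m \<le> (\<Sum>m\<in>Poly_Mapping.keys (g a). mdeg m)}"
      by (auto intro!: member_le_sum)
    then have "a \<in> A (n a, \<Sum>m\<in>Poly_Mapping.keys (g a). mdeg m)" by (simp add: A_def)
    then show ?thesis by blast
  qed
  then have "(\<Union>p. A p) = UNIV" by blast
  then have "\<not> (\<forall>p. countable (A p))"
    using uncountable_UNIV_complex by (metis countable_UN countableI_type)
  then obtain p where "\<not> countable (A p)" by blast
  then obtain N e where inf: "infinite (A (N, e))"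
    using countable_finite by (cases p) auto
  define T where "T = (\<lambda>m. sg m (1::complex)) ` {m. mdeg m \<le> e}"
  have finT: "finite T" by (simp add: T_def finite_mdeg_le)
  \<comment> \<open>One element more than the spanning set \<open>T\<close> has forces a linear
    relation.\<close>
  obtain B where B: "finite B" "card B = Suc (card T)" "B \<subseteq> A (N, e)"
    using infinite_arbitrarily_large[OF inf] by blast
  have nB: "n b = N" if "b \<in> B" for b using that B(3) by (auto simp: A_def)
  have inj_g: "inj_on g B" by (rule inj_onI) (use inj nB in auto)
  have "g b \<in> poly3.span T" if "b \<in> B" for b
  proof -
    have "Poly_Mapping.keys (g b) \<subseteq> {m. mdeg m \<le> e}" using that B(3) by (auto simp: A_def)
    then have "(\<Sum>m\<in>Poly_Mapping.keys (g b). smul (lk (g b) m) (sg m 1)) \<in> poly3.span T"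
      by (intro poly3.span_sum poly3.span_scale poly3.span_base) (auto simp: T_def)
    then show ?thesis by (simp add: smul_def mult_single sum_singles)
  qed
  then have "poly3.dependent (g ` B)"
    using poly3.independent_span_bound[of T "g ` B"] finT B(2) card_image[OF inj_g] by fastforce
  then obtain u v where u: "v \<in> g ` B" "u v \<noteq> 0" "(\<Sum>v\<in>g ` B. smul (u v) v) = 0"
    using B(1) by (subst (asm) poly3.dependent_finite) auto
  then obtain a where "a \<in> B" "v = g a" by blast
  with u that[of B N "u \<circ> g" a] B(1) nB show thesis
    by (simp add: sum.reindex[OF inj_g])
qed

text \<open>An ideal \<open>M\<close> maximal among those that contain \<open>K\<close> and no power
  of \<open>w\<close> is prime. As the complex field is uncountable, each variable is constant
  modulo \<open>M\<close>, so \<open>M\<close> is the ideal of a point; all of \<open>K\<close>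
  vanishes there, hence so does \<open>w\<close>, which puts \<open>w\<close> into
  \<open>M\<close>.\<close>

theorem nullstellensatz:
  assumes K: "poly_ideal K" and van: "\<And>v. (\<forall>k\<in>K. eval k v = 0) \<Longrightarrow> eval w v = 0"
  shows "\<exists>n. w ^ n \<in> K"
proof (rule ccontr)
  assume "\<not> (\<exists>n. w ^ n \<in> K)"
  then have no: "w ^ n \<notin> K" for n by blast
  define \<A> where "\<A> = {M. poly_ideal M \<and> K \<subseteq> M \<and> (\<forall>n. w ^ n \<notin> M)}"
  have "\<exists>M\<in>\<A>. \<forall>Y\<in>\<A>. M \<subseteq> Y \<longrightarrow> Y = M"
  proof (rule subset_Zorn_nonempty)
    show "\<A> \<noteq> {}" using K no by (auto simp: \<A>_def)
    fix C assume C: "C \<noteq> {}" "subset.chain \<A> C"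
    have "poly_ideal (\<Union>C)"
      unfolding poly_ideal_def
    proof (intro conjI ballI allI)
      show "0 \<in> \<Union>C" using C by (auto simp: subset_chain_def \<A>_def poly_ideal_def)
      fix a assume a: "a \<in> \<Union>C"
      then obtain M where M: "M \<in> C" "a \<in> M" by blast
      then have "poly_ideal M" using C(2) by (auto simp: subset_chain_def \<A>_def)
      then show "r * a \<in> \<Union>C" for r using M unfolding poly_ideal_def by blast
      fix b assume "b \<in> \<Union>C"
      then obtain L where L: "L \<in> C" "b \<in> L" by blast
      then have "poly_ideal L" using C(2) by (auto simp: subset_chain_def \<A>_def)
      moreover have "M \<subseteq> L \<or> L \<subseteq> M" using C(2) M L by (auto simp: subset_chain_def)
      ultimately show "a + b \<in> \<Union>C"
        using M L \<open>poly_ideal M\<close> unfolding poly_ideal_def by blast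
    qed
    then show "\<Union>C \<in> \<A>" using C by (auto simp: subset_chain_def \<A>_def)
  qed
  then obtain M where M: "poly_ideal M" "K \<subseteq> M" "\<And>n. w ^ n \<notin> M"
    and max: "\<And>Y. poly_ideal Y \<Longrightarrow> M \<subseteq> Y \<Longrightarrow> (\<forall>n. w ^ n \<notin> Y) \<Longrightarrow> Y = M"
    unfolding \<A>_def by fastforce
  note M0 = M(1)[unfolded poly_ideal_def]
  have absorb: "r * a \<in> M" "a * r \<in> M" if "a \<in> M" for r a
    using M0 that by (metis mult.commute)+
  \<comment> \<open>Maximality applied to the ideal generated by \<open>M\<close> and
    \<open>p\<close>: it must contain a power of \<open>w\<close>.\<close>
  have unit: "\<exists>n g. w ^ n - p * g \<in> M" if "p \<notin> M" for p
  proof -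
    define Y where "Y = {a + p * g | a g. a \<in> M}"
    have "poly_ideal Y"
      unfolding poly_ideal_def
    proof (intro conjI ballI allI)
      show "0 \<in> Y"
        unfolding Y_def using M0 by (intro CollectI exI[of _ 0]) simp
      fix y assume "y \<in> Y"
      then obtain a g where y: "y = a + p * g" "a \<in> M" by (auto simp: Y_def)
      have "r * y = r * a + p * (r * g)" for r by (simp add: y algebra_simps)
      then show "r * y \<in> Y" for r using y absorb unfolding Y_def by blast
      fix z assume "z \<in> Y"
      then obtain b h where z: "z = b + p * h" "b \<in> M" by (auto simp: Y_def)
      have "y + z = (a + b) + p * (g + h)" by (simp add: y z algebra_simps)
      then show "y + z \<in> Y" using y z M0 unfolding Y_def by blast
    qed
    moreover have "M \<subseteq> Y"
    proof
      show "a \<in> Y" if "a \<in> M" for a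
        unfolding Y_def using that by (intro CollectI exI[of _ a] exI[of _ 0]) simp
    qed
    moreover have "p \<in> Y"
      unfolding Y_def using M0 by (intro CollectI exI[of _ 0] exI[of _ 1]) simp
    then have "Y \<noteq> M" using that by blast
    ultimately obtain n where "w ^ n \<in> Y" using max[of Y] by auto
    then obtain a g where "w ^ n = a + p * g" "a \<in> M" by (auto simp: Y_def)
    then have "w ^ n - p * g \<in> M" by simp
    then show ?thesis by blast
  qed
  have prime: "p * q \<notin> M" if pq: "p \<notin> M" "q \<notin> M" for p q
  proof
    assume "p * q \<in> M"
    obtain n g where 1: "w ^ n - p * g \<in> M" using unit[OF pq(1)] by blast
    obtain m h where 2: "w ^ m - q * h \<in> M" using unit[OF pq(2)] by blast
    have "w ^ (n + m) = (w ^ n - p * g) * w ^ m + p * g * (w ^ m - q * h) + (p * q) * (g * h)"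
      by (simp add: algebra_simps power_add)
    then show False using M(3)[of "n + m"] M0 absorb 1 2 \<open>p * q \<in> M\<close> by auto
  qed
  have const: "sg 0 c \<notin> M" if "c \<noteq> 0" for c
  proof
    assume "sg 0 c \<in> M"
    then have "sg 0 (1 / c) * sg 0 c \<in> M" by (rule absorb)
    then show False using that M(3)[of 0] by (simp add: mult_single)
  qed
  \<comment> \<open>Otherwise each \<open>X i - sg 0 a\<close> has an inverse \<open>g a\<close> up
    to a power of \<open>w\<close>. A linear relation among these uncountably many fractions, with
    denominators cleared, puts a nonzero polynomial in \<open>X i\<close> alone into
    \<open>M\<close>.\<close>
  have linear: "\<exists>a. X i - sg 0 a \<in> M" for i
  proof (rule ccontr)
    assume "\<nexists>a. X i - sg 0 a \<in> M"
    then have nl: "X i - sg 0 a \<notin> M" for a by blast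
    \<comment> \<open>By the fundamental theorem of algebra such an \<open>f\<close> is a nonzero
      constant times linear factors, all outside the prime ideal \<open>M\<close>.\<close>
    have univ: "f \<notin> M" if "p \<noteq> 0" "\<And>v. eval f v = poly p (v $ i)" for p f
      using that
    proof (induction "Polynomial.degree p" arbitrary: p f)
      case 0
      then obtain c where p: "p = [:c:]" by (metis degree_eq_zeroE)
      then have "f = sg 0 c" using 0 by (intro eval_inject) simp
      then show ?case using const[of c] 0 p by auto
    next
      case (Suc d)
      then have "\<not> constant (poly p)" by (simp add: constant_degree)
      then obtain r where "poly p r = 0" using fundamental_theorem_of_algebra by blast
      then obtain q where q: "p = [:- r, 1:] * q" using poly_eq_0_iff_dvd by (metis dvdE)
      then have q0: "q \<noteq> 0" using Suc by auto
      define f' where "f' = (\<Sum>k\<le>Polynomial.degree q. smul (coeff q k) (X i ^ k))"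
      have f': "eval f' v = poly q (v $ i)" for v by (simp add: f'_def poly_altdef)
      have "Suc (Polynomial.degree q) = Polynomial.degree p"
        unfolding q by (subst degree_mult_eq) (use q0 in auto)
      then have "f' \<notin> M" using Suc q0 f' by (metis Suc_inject)
      moreover have "f = (X i - sg 0 r) * f'"
        by (rule eval_inject) (simp add: Suc q f' algebra_simps)
      ultimately show ?case using prime nl by simp
    qed
    obtain n g where ng: "\<And>a. w ^ n a - (X i - sg 0 a) * g a \<in> M"
      using unit[OF nl] by metis
    have inj: "a = b" if "n a = n b" "g a = g b" for a b
    proof (rule ccontr)
      assume "a \<noteq> b"
      have "(w ^ n b - (X i - sg 0 b) * g b) - (w ^ n a - (X i - sg 0 a) * g a) \<in> M"
        using poly_ideal_diff[OF M(1)] ng by blast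
      also have "(w ^ n b - (X i - sg 0 b) * g b) - (w ^ n a - (X i - sg 0 a) * g a)
         = sg 0 (b - a) * g a"
        by (simp add: that algebra_simps single_diff)
      finally have "g a \<in> M" using prime const \<open>a \<noteq> b\<close> by (metis right_minus_eq)
      then have "(w ^ n a - (X i - sg 0 a) * g a) + (X i - sg 0 a) * g a \<in> M"
        using ng absorb M0 by blast
      then show False using M(3) by simp
    qed
    obtain B N c a where B: "finite B" "\<And>b. b \<in> B \<Longrightarrow> n b = N"
      "(\<Sum>b\<in>B. smul (c b) (g b)) = 0" "a \<in> B" "c a \<noteq> 0"
      using dependent_uncountable_family[of n g, OF inj] by metis
    \<comment> \<open>\<open>Q b\<close> is the common denominator without the factor of
      \<open>b\<close>, and \<open>P\<close> is the numerator of the relation. At the value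
      \<open>a\<close> only the summand of \<open>a\<close> survives, so \<open>P\<close> is not
      zero.\<close>
    define Q where "Q b = (\<Prod>b'\<in>B - {b}. X i - sg 0 b')" for b
    define P where "P = (\<Sum>b\<in>B. smul (c b) (Q b))"
    have "w ^ N * smul (c b) (Q b) - smul (c b) (g b) * (\<Prod>b'\<in>B. X i - sg 0 b') \<in> M"
      if "b \<in> B" for b
    proof -
      have eq: "(\<Prod>b'\<in>B. X i - sg 0 b') = (X i - sg 0 b) * Q b"
        unfolding Q_def using B(1) that by (rule prod.remove)
      have "w ^ N * smul (c b) (Q b) - smul (c b) (g b) * (\<Prod>b'\<in>B. X i - sg 0 b')
         = smul (c b) (Q b) * (w ^ n b - (X i - sg 0 b) * g b)"
        unfolding eq by (simp add: B(2)[OF that] smul_def algebra_simps)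
      then show ?thesis using absorb ng by simp
    qed
    then have "(\<Sum>b\<in>B. w ^ N * smul (c b) (Q b) - smul (c b) (g b) * (\<Prod>b'\<in>B. X i - sg 0 b')) \<in> M"
      by (intro poly_ideal_sum[OF M(1)])
    then have "w ^ N * P - (\<Sum>b\<in>B. smul (c b) (g b)) * (\<Prod>b'\<in>B. X i - sg 0 b') \<in> M"
      by (simp only: sum_subtractf P_def sum_distrib_left sum_distrib_right)
    then have "w ^ N * P \<in> M" using B(3) by simp
    moreover have "P \<notin> M"
    proof (rule univ)
      let ?p = "\<Sum>b\<in>B. Polynomial.smult (c b) (\<Prod>b'\<in>B - {b}. [:- b', 1:])"
      show "eval P v = poly ?p (v $ i)" for v
        by (simp add: P_def Q_def poly_sum poly_prod)
      have "poly ?p a = (\<Sum>b\<in>B. if b = a then c a * (\<Prod>b'\<in>B - {a}. a - b') else 0)"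
        unfolding poly_sum poly_smult poly_prod
        by (intro sum.cong) (use B in auto)
      then have "poly ?p a \<noteq> 0" using B by simp
      then show "?p \<noteq> 0" by (metis poly_0)
    qed
    ultimately show False using prime M(3) by blast
  qed
  then obtain a where a: "\<And>i. X i - sg 0 (a i) \<in> M" by metis
  define v where "v = (\<chi> i. a i)"
  \<comment> \<open>The polynomials congruent modulo \<open>M\<close> to their value at
    \<open>v\<close> form a subring with all constants and variables, hence everything.\<close>
  define R where "R = {f. f - sg 0 (eval f v) \<in> M}"
  have R_const: "sg 0 c \<in> R" for c using M0 by (simp add: R_def)
  have R_X: "X i \<in> R" for i using a by (simp add: R_def v_def)
  have R_add: "f + g \<in> R" if "f \<in> R" "g \<in> R" for f g
  proof -
    have "(f - sg 0 (eval f v)) + (g - sg 0 (eval g v)) \<in> M" using that M0 by (auto simp: R_def)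
    then show ?thesis by (simp add: R_def single_add algebra_simps)
  qed
  have R_mult: "f * g \<in> R" if "f \<in> R" "g \<in> R" for f g
  proof -
    have "(f - sg 0 (eval f v)) * g + sg 0 (eval f v) * (g - sg 0 (eval g v)) \<in> M"
      using that M0 absorb by (auto simp: R_def)
    then show ?thesis by (simp add: R_def mult_single algebra_simps)
  qed
  have R_power: "f ^ n \<in> R" if "f \<in> R" for f n
    using R_const[of 1] R_mult that by (induction n) auto
  have "f \<in> R" for f
  proof (induction f rule: poly_mapping_add_induct)
    case (single m c)
    have *: "sg m c = sg 0 c * (X 1 ^ lk m 1 * (X 2 ^ lk m 2 * X 3 ^ lk m 3))"
      by (rule eval_inject) (simp add: monom_eval_def prod_3)
    show ?case unfolding * by (intro R_mult R_const R_power R_X)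
  qed (rule R_add)
  then have R: "f - sg 0 (eval f v) \<in> M" for f by (simp add: R_def)
  have "eval k v = 0" if "k \<in> K" for k
  proof (rule ccontr)
    assume "eval k v \<noteq> 0"
    have "k - (k - sg 0 (eval k v)) \<in> M" using poly_ideal_diff[OF M(1)] R that M(2) by blast
    then show False using const[OF \<open>eval k v \<noteq> 0\<close>] by simp
  qed
  then have "w ^ 1 \<in> M" using R[of w] van by auto
  then show False using M(3) by blast
qed

subsection \<open>Power series on polydiscs\<close>

definition Exps :: "nat \<Rightarrow> (nat \<Rightarrow>\<^sub>0 nat) set" where
  "Exps n = {\<alpha>. Poly_Mapping.keys \<alpha> \<subseteq> {..<n}}"

definition tdeg :: "nat \<Rightarrow> (nat \<Rightarrow>\<^sub>0 nat) \<Rightarrow> nat" where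
  "tdeg n \<alpha> = (\<Sum>i<n. lk \<alpha> i)"

definition pw :: "nat \<Rightarrow> cvec \<Rightarrow> (nat \<Rightarrow>\<^sub>0 nat) \<Rightarrow> complex" where
  "pw n z \<alpha> = (\<Prod>i<n. z i ^ lk \<alpha> i)"

definition polydisc :: "nat \<Rightarrow> real \<Rightarrow> cvec set" where
  "polydisc n r = {z. \<forall>i<n. norm (z i) \<le> r}"

text \<open>\<open>B\<close> bounds a weighted l1 norm of a coefficient family of \<open>F\<close>
  at radius \<open>r\<close>. This norm dominates the sup norm on the closed polydisc, is
  submultiplicative and complete, so products and composites come from rearranging absolutely
  convergent sums.\<close>

definition series_bound :: "nat \<Rightarrow> real \<Rightarrow> (cvec \<Rightarrow> complex) \<Rightarrow> real \<Rightarrow> bool" where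
  "series_bound n r F B \<longleftrightarrow> r > 0 \<and> (\<exists>c. (\<lambda>\<alpha>. norm (c \<alpha>) * r ^ tdeg n \<alpha>) summable_on Exps n \<and>
     infsum (\<lambda>\<alpha>. norm (c \<alpha>) * r ^ tdeg n \<alpha>) (Exps n) \<le> B \<and>
     (\<forall>z\<in>polydisc n r. ((\<lambda>\<alpha>. c \<alpha> * pw n z \<alpha>) has_sum F z) (Exps n)))"

lemma Exps_0 [simp]: "0 \<in> Exps n"
  by (simp add: Exps_def)

lemma Exps_add: "\<alpha> \<in> Exps n \<Longrightarrow> \<beta> \<in> Exps n \<Longrightarrow> \<alpha> + \<beta> \<in> Exps n"
  using keys_add[of \<alpha> \<beta>] by (auto simp: Exps_def)

lemma tdeg_add: "tdeg n (\<alpha> + \<beta>) = tdeg n \<alpha> + tdeg n \<beta>"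
  by (simp add: tdeg_def lookup_add sum.distrib)

lemma pw_add: "pw n z (\<alpha> + \<beta>) = pw n z \<alpha> * pw n z \<beta>"
  by (simp add: pw_def lookup_add power_add prod.distrib)

lemma tdeg_0 [simp]: "tdeg n 0 = 0"
  by (simp add: tdeg_def)

lemma pw_0 [simp]: "pw n z 0 = 1"
  by (simp add: pw_def)

lemma norm_pw_le: "z \<in> polydisc n r \<Longrightarrow> norm (pw n z \<alpha>) \<le> r ^ tdeg n \<alpha>"
  unfolding pw_def tdeg_def power_sum prod_norm[symmetric] norm_power
  by (rule prod_mono) (auto simp: polydisc_def intro: power_mono)

lemma tdeg_single: "i < n \<Longrightarrow> tdeg n (sg i 1) = 1"
  and pw_single: "i < n \<Longrightarrow> pw n z (sg i 1) = z i"
proof -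
  have "tdeg n (sg i 1) = (\<Sum>j<n. if j = i then 1 else 0)"
    unfolding tdeg_def by (intro sum.cong) (auto simp: lookup_single when_def)
  then show "i < n \<Longrightarrow> tdeg n (sg i 1) = 1" by simp
  have "pw n z (sg i 1) = (\<Prod>j<n. if j = i then z i else 1)"
    unfolding pw_def by (intro prod.cong) (auto simp: lookup_single when_def)
  then show "i < n \<Longrightarrow> pw n z (sg i 1) = z i" by simp
qed

lemma tdeg_eq_0: "\<alpha> \<in> Exps n \<Longrightarrow> tdeg n \<alpha> = 0 \<longleftrightarrow> \<alpha> = 0"
proof
  assume a: "\<alpha> \<in> Exps n" "tdeg n \<alpha> = 0"
  show "\<alpha> = 0"
  proof (rule poly_mapping_eqI)
    fix i show "lk \<alpha> i = lk 0 i"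
      using a by (cases "i < n") (auto simp: tdeg_def Exps_def in_keys_iff)
  qed
qed simp

lemma pw_at_0: "\<alpha> \<in> Exps n \<Longrightarrow> pw n (\<lambda>_. 0) \<alpha> = (if \<alpha> = 0 then 1 else 0)"
  using tdeg_eq_0[of \<alpha> n]
  by (auto simp: pw_def tdeg_def prod_zero_iff power_0_left)

text \<open>The index set may produce an exponent many times: coefficients are regrouped along the
  fibres of \<phi>, and the triangle inequality keeps the norm from growing.\<close>

lemma series_boundI:
  fixes a :: "'i \<Rightarrow> complex" and \<phi> :: "'i \<Rightarrow> nat \<Rightarrow>\<^sub>0 nat"
  assumes r: "r > 0" and \<phi>: "\<And>i. i \<in> I \<Longrightarrow> \<phi> i \<in> Exps n"
    and norm: "((\<lambda>i. norm (a i) * r ^ tdeg n (\<phi> i)) has_sum H) I" and H: "H \<le> B"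
    and val: "\<And>z. z \<in> polydisc n r \<Longrightarrow> ((\<lambda>i. a i * pw n z (\<phi> i)) has_sum F z) I"
  shows "series_bound n r F B"
proof -
  define fib where "fib \<gamma> = {i \<in> I. \<phi> i = \<gamma>}" for \<gamma>
  have bij: "bij_betw snd (Sigma (Exps n) fib) I"
    by (rule bij_betw_byWitness[of _ "\<lambda>i. (\<phi> i, i)"]) (auto simp: fib_def \<phi>)
  have sub: "fib \<gamma> \<subseteq> I" for \<gamma> by (auto simp: fib_def)
  define h where "h i = norm (a i) * r ^ tdeg n (\<phi> i)" for i
  have h: "(h has_sum H) I" using norm by (simp add: h_def[abs_def])
  have hfib: "h summable_on fib \<gamma>" for \<gamma>
    using summable_on_subset_banach[OF has_sum_imp_summable[OF h] sub] .
  define S where "S \<gamma> = infsum h (fib \<gamma>)" for \<gamma>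
  have S: "(S has_sum H) (Exps n)"
  proof (rule has_sum_SigmaD[where f = "\<lambda>p. h (snd p)" and B = fib])
    show "((\<lambda>p. h (snd p)) has_sum H) (Sigma (Exps n) fib)"
      using h has_sum_reindex_bij_betw[OF bij, of h H] by simp
    show "((\<lambda>y. h (snd (\<gamma>, y))) has_sum S \<gamma>) (fib \<gamma>)" for \<gamma>
      using hfib by (simp add: S_def)
  qed
  have afib: "a summable_on fib \<gamma>" if "\<gamma> \<in> Exps n" for \<gamma>
  proof -
    have "(\<lambda>i. h i * (1 / r ^ tdeg n \<gamma>)) summable_on fib \<gamma>"
      using hfib by (rule summable_on_cmult_left)
    moreover have "h i * (1 / r ^ tdeg n \<gamma>) = norm (a i)" if "i \<in> fib \<gamma>" for i
      using that r by (simp add: h_def fib_def)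
    ultimately have "(\<lambda>i. norm (a i)) summable_on fib \<gamma>"
      by (simp cong: summable_on_cong)
    then show ?thesis by (simp add: summable_on_iff_abs_summable_on_complex)
  qed
  define c where "c \<gamma> = infsum a (fib \<gamma>)" for \<gamma>
  have c: "(a has_sum c \<gamma>) (fib \<gamma>)" if "\<gamma> \<in> Exps n" for \<gamma>
    using afib[OF that] by (simp add: c_def)
  have cS: "norm (c \<gamma>) * r ^ tdeg n \<gamma> \<le> S \<gamma>" if "\<gamma> \<in> Exps n" for \<gamma>
  proof -
    have "((\<lambda>i. a i * of_real (r ^ tdeg n \<gamma>)) has_sum c \<gamma> * of_real (r ^ tdeg n \<gamma>)) (fib \<gamma>)"
      using c[OF that] by (rule has_sum_cmult_left)
    moreover have "(h has_sum S \<gamma>) (fib \<gamma>)" using hfib by (simp add: S_def)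
    ultimately have "norm (c \<gamma> * of_real (r ^ tdeg n \<gamma>)) \<le> S \<gamma>"
      by (rule norm_infsum_le) (use r in \<open>auto simp: h_def fib_def norm_mult norm_power\<close>)
    then show ?thesis using r by (simp add: norm_mult norm_power)
  qed
  have sumc: "(\<lambda>\<gamma>. norm (c \<gamma>) * r ^ tdeg n \<gamma>) summable_on Exps n"
    by (rule summable_on_comparison_test[OF has_sum_imp_summable[OF S]]) (use cS r in auto)
  moreover have "infsum (\<lambda>\<gamma>. norm (c \<gamma>) * r ^ tdeg n \<gamma>) (Exps n) \<le> H"
    by (rule has_sum_mono[OF has_sum_infsum[OF sumc] S]) (use cS in auto)
  moreover have "((\<lambda>\<gamma>. c \<gamma> * pw n z \<gamma>) has_sum F z) (Exps n)" if z: "z \<in> polydisc n r" for z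
  proof (rule has_sum_SigmaD[where f = "\<lambda>p. a (snd p) * pw n z (\<phi> (snd p))" and B = fib])
    show "((\<lambda>p. a (snd p) * pw n z (\<phi> (snd p))) has_sum F z) (Sigma (Exps n) fib)"
      using val[OF z] has_sum_reindex_bij_betw[OF bij, of "\<lambda>i. a i * pw n z (\<phi> i)" "F z"] by simp
    show "((\<lambda>y. a (snd (\<gamma>, y)) * pw n z (\<phi> (snd (\<gamma>, y)))) has_sum c \<gamma> * pw n z \<gamma>) (fib \<gamma>)"
      if "\<gamma> \<in> Exps n" for \<gamma>
    proof -
      have "((\<lambda>y. a y * pw n z \<gamma>) has_sum c \<gamma> * pw n z \<gamma>) (fib \<gamma>)"
        using c[OF that] by (rule has_sum_cmult_left)
      then show ?thesis by (rule has_sum_cong[THEN iffD1, rotated]) (simp add: fib_def)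
    qed
  qed
  ultimately show ?thesis unfolding series_bound_def using r H by (meson order_trans)
qed

lemma series_boundE:
  assumes "series_bound n r F B"
  obtains c H where "r > 0" "((\<lambda>\<alpha>. norm (c \<alpha>) * r ^ tdeg n \<alpha>) has_sum H) (Exps n)" "H \<le> B" "0 \<le> H"
    "\<And>z. z \<in> polydisc n r \<Longrightarrow> ((\<lambda>\<alpha>. c \<alpha> * pw n z \<alpha>) has_sum F z) (Exps n)"
proof -
  obtain c where c: "r > 0" "(\<lambda>\<alpha>. norm (c \<alpha>) * r ^ tdeg n \<alpha>) summable_on Exps n"
    "infsum (\<lambda>\<alpha>. norm (c \<alpha>) * r ^ tdeg n \<alpha>) (Exps n) \<le> B"
    "\<And>z. z \<in> polydisc n r \<Longrightarrow> ((\<lambda>\<alpha>. c \<alpha> * pw n z \<alpha>) has_sum F z) (Exps n)"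
    using assms unfolding series_bound_def by blast
  have "0 \<le> infsum (\<lambda>\<alpha>. norm (c \<alpha>) * r ^ tdeg n \<alpha>) (Exps n)"
    using c(1) by (intro infsum_nonneg) auto
  then show thesis by (rule that[OF c(1) has_sum_infsum[OF c(2)] c(3) _ c(4)])
qed

lemma series_bound_norm_le:
  assumes "series_bound n r F B" "z \<in> polydisc n r" shows "norm (F z) \<le> B"
proof -
  obtain c H where c: "r > 0" "((\<lambda>\<alpha>. norm (c \<alpha>) * r ^ tdeg n \<alpha>) has_sum H) (Exps n)" "H \<le> B" "0 \<le> H"
    "\<And>z. z \<in> polydisc n r \<Longrightarrow> ((\<lambda>\<alpha>. c \<alpha> * pw n z \<alpha>) has_sum F z) (Exps n)"
    by (rule series_boundE[OF assms(1)], rule that)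
  have "norm (F z) \<le> H"
    using c(5)[OF assms(2)] c(2)
    by (rule norm_infsum_le) (auto simp: norm_mult intro!: mult_left_mono norm_pw_le[OF assms(2)])
  then show ?thesis using c(3) by simp
qed

lemma series_bound_mono: "series_bound n r F B \<Longrightarrow> B \<le> C \<Longrightarrow> series_bound n r F C"
  unfolding series_bound_def by (meson order_trans)

lemma series_bound_nonneg: "series_bound n r F B \<Longrightarrow> 0 \<le> B"
  by (erule series_boundE) linarith

lemma series_bound_const: "r > 0 \<Longrightarrow> series_bound n r (\<lambda>_. k) (norm k)"
  by (rule series_boundI[where I = "{()}" and \<phi> = "\<lambda>_. 0" and a = "\<lambda>_. k"])
     (auto intro: has_sum_finiteI)

lemma series_bound_coord:
  assumes "r > 0" "i < n" shows "series_bound n r (\<lambda>z. z i) r"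
  by (rule series_boundI[where I = "{()}" and \<phi> = "\<lambda>_. sg i 1" and a = "\<lambda>_. 1"])
     (use assms in \<open>auto simp: tdeg_single[OF assms(2), unfolded One_nat_def]
       pw_single[OF assms(2), unfolded One_nat_def] Exps_def intro: has_sum_finiteI\<close>)

text \<open>Completeness of the norm. Sums, products and composites become instances of it for
  suitable index sets.\<close>

lemma series_bound_infsum:
  assumes r: "r > 0" and F: "\<And>i. i \<in> I \<Longrightarrow> series_bound n r (F i) (B i)" and B: "B summable_on I"
    and G: "\<And>z. z \<in> polydisc n r \<Longrightarrow> ((\<lambda>i. F i z) has_sum G z) I"
  shows "series_bound n r G (infsum B I)"
proof -
  define P where "P i c H \<longleftrightarrow> ((\<lambda>\<alpha>. norm (c \<alpha>) * r ^ tdeg n \<alpha>) has_sum H) (Exps n) \<and> H \<le> B i \<and> 0 \<le> H \<and>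
      (\<forall>z\<in>polydisc n r. ((\<lambda>\<alpha>. c \<alpha> * pw n z \<alpha>) has_sum F i z) (Exps n))" for i c H
  have "\<exists>c H. P i c H" if "i \<in> I" for i
    unfolding P_def by (rule series_boundE[OF F[OF that]]) fast
  then have "\<forall>i\<in>I. \<exists>c H. P i c H" ..
  from bchoice[OF this] obtain c where "\<forall>i\<in>I. \<exists>H. P i (c i) H" ..
  from bchoice[OF this] obtain H where "\<forall>i\<in>I. P i (c i) (H i)" ..
  then have cH: "\<And>i. i \<in> I \<Longrightarrow> ((\<lambda>\<alpha>. norm (c i \<alpha>) * r ^ tdeg n \<alpha>) has_sum H i) (Exps n)"
      "\<And>i. i \<in> I \<Longrightarrow> H i \<le> B i" "\<And>i. i \<in> I \<Longrightarrow> 0 \<le> H i"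
      "\<And>i z. i \<in> I \<Longrightarrow> z \<in> polydisc n r \<Longrightarrow> ((\<lambda>\<alpha>. c i \<alpha> * pw n z \<alpha>) has_sum F i z) (Exps n)"
    by (simp_all add: P_def)
  have H: "H summable_on I"
    by (rule summable_on_comparison_test[OF B]) (use cH in auto)
  let ?h = "\<lambda>(i, \<alpha>). norm (c i \<alpha>) * r ^ tdeg n \<alpha>"
  have sum: "?h summable_on I \<times> Exps n"
    by (rule summable_on_SigmaI[where g = H]) (use cH H r in auto)
  have hs: "(?h has_sum infsum H I) (I \<times> Exps n)"
    by (rule has_sum_SigmaI[where g = H]) (use cH H sum in auto)
  show ?thesis
  proof (rule series_boundI[where I = "I \<times> Exps n" and \<phi> = snd and a = "\<lambda>(i, \<alpha>). c i \<alpha>"])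
    show "((\<lambda>i. norm (case i of (i, \<alpha>) \<Rightarrow> c i \<alpha>) * r ^ tdeg n (snd i)) has_sum infsum H I) (I \<times> Exps n)"
      using hs by (simp add: case_prod_unfold)
    show "infsum H I \<le> infsum B I" by (rule infsum_mono) (use H B cH in auto)
    fix z assume z: "z \<in> polydisc n r"
    show "((\<lambda>i. (case i of (i, \<alpha>) \<Rightarrow> c i \<alpha>) * pw n z (snd i)) has_sum G z) (I \<times> Exps n)"
    proof (rule has_sum_SigmaI[where g = "\<lambda>i. F i z"])
      have "(\<lambda>p. norm ((case p of (i, \<alpha>) \<Rightarrow> c i \<alpha>) * pw n z (snd p))) summable_on I \<times> Exps n"
        by (rule Infinite_Sum.abs_summable_on_comparison_test'[OF sum])
           (auto simp: norm_mult intro!: mult_left_mono norm_pw_le[OF z])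
      then show "(\<lambda>i. (case i of (i, \<alpha>) \<Rightarrow> c i \<alpha>) * pw n z (snd i)) summable_on I \<times> Exps n"
        by (simp add: summable_on_iff_abs_summable_on_complex)
    qed (use cH(4)[OF _ z] G[OF z] in auto)
  qed (use r in auto)
qed

lemma series_bound_add:
  assumes "series_bound n r F B" "series_bound n r G C"
  shows "series_bound n r (\<lambda>z. F z + G z) (B + C)"
proof -
  have r: "r > 0" using assms by (auto simp: series_bound_def)
  have "series_bound n r (\<lambda>z. F z + G z) (infsum (\<lambda>b. if b then B else C) UNIV)"
  proof (rule series_bound_infsum[where F = "\<lambda>b. if b then F else G"])
    show "((\<lambda>b. (if b then F else G) z) has_sum F z + G z) UNIV" for z
      by (rule has_sum_finiteI) (auto simp: UNIV_bool)
  qed (use r assms in auto)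
  then show ?thesis by (simp add: UNIV_bool add.commute)
qed

lemma series_bound_mult:
  assumes "series_bound n r F B" "series_bound n r G C"
  shows "series_bound n r (\<lambda>z. F z * G z) (B * C)"
proof -
  obtain c H where c: "r > 0" "((\<lambda>\<alpha>. norm (c \<alpha>) * r ^ tdeg n \<alpha>) has_sum H) (Exps n)" "H \<le> B" "0 \<le> H"
    "\<And>z. z \<in> polydisc n r \<Longrightarrow> ((\<lambda>\<alpha>. c \<alpha> * pw n z \<alpha>) has_sum F z) (Exps n)"
    by (rule series_boundE[OF assms(1)], rule that)
  \<comment> \<open>Multiplying by one monomial shifts the exponents of \<open>G\<close> and scales
    the norm; the product is the sum of these over the terms of \<open>F\<close>.\<close>
  have G: "series_bound n r (\<lambda>z. c \<alpha> * pw n z \<alpha> * G z) (norm (c \<alpha>) * r ^ tdeg n \<alpha> * C)"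
    if "\<alpha> \<in> Exps n" for \<alpha>
  proof -
    obtain d L where d: "((\<lambda>\<beta>. norm (d \<beta>) * r ^ tdeg n \<beta>) has_sum L) (Exps n)" "L \<le> C" "0 \<le> L"
      "\<And>z. z \<in> polydisc n r \<Longrightarrow> ((\<lambda>\<beta>. d \<beta> * pw n z \<beta>) has_sum G z) (Exps n)"
      by (rule series_boundE[OF assms(2)], rule that)
    show ?thesis
    proof (rule series_boundI[where I = "Exps n" and \<phi> = "\<lambda>\<beta>. \<alpha> + \<beta>" and a = "\<lambda>\<beta>. c \<alpha> * d \<beta>"])
      show "((\<lambda>\<beta>. norm (c \<alpha> * d \<beta>) * r ^ tdeg n (\<alpha> + \<beta>)) has_sum norm (c \<alpha>) * r ^ tdeg n \<alpha> * L) (Exps n)"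
        using has_sum_cmult_right[OF d(1), of "norm (c \<alpha>) * r ^ tdeg n \<alpha>"]
        by (simp add: norm_mult tdeg_add power_add mult_ac)
      show "((\<lambda>\<beta>. c \<alpha> * d \<beta> * pw n z (\<alpha> + \<beta>)) has_sum c \<alpha> * pw n z \<alpha> * G z) (Exps n)"
        if "z \<in> polydisc n r" for z
        using has_sum_cmult_right[OF d(4)[OF that], of "c \<alpha> * pw n z \<alpha>"]
        by (simp add: pw_add mult_ac)
      show "norm (c \<alpha>) * r ^ tdeg n \<alpha> * L \<le> norm (c \<alpha>) * r ^ tdeg n \<alpha> * C"
        using c(1) d(2) by (intro mult_left_mono) auto
    qed (use c(1) that Exps_add in auto)
  qed
  have hs: "((\<lambda>\<alpha>. norm (c \<alpha>) * r ^ tdeg n \<alpha> * C) has_sum H * C) (Exps n)"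
    using c(2) by (rule has_sum_cmult_left)
  have "series_bound n r (\<lambda>z. F z * G z) (infsum (\<lambda>\<alpha>. norm (c \<alpha>) * r ^ tdeg n \<alpha> * C) (Exps n))"
    by (rule series_bound_infsum[where F = "\<lambda>\<alpha> z. c \<alpha> * pw n z \<alpha> * G z"])
       (use c G has_sum_imp_summable[OF hs] in \<open>auto intro: has_sum_cmult_left\<close>)
  then have "series_bound n r (\<lambda>z. F z * G z) (H * C)" using infsumI[OF hs] by simp
  then show ?thesis
    by (rule series_bound_mono) (use c(3) series_bound_nonneg[OF assms(2)] in \<open>auto intro: mult_right_mono\<close>)
qed

lemma series_bound_power:
  "series_bound n r F B \<Longrightarrow> series_bound n r (\<lambda>z. F z ^ k) (B ^ k)"
proof (induction k)
  case 0
  then show ?case using series_bound_const[of r n 1] by (simp add: series_bound_def)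
qed (auto intro: series_bound_mult)

lemma series_bound_prod:
  assumes "r > 0" "finite A" "\<And>i. i \<in> A \<Longrightarrow> series_bound n r (F i) (B i)"
  shows "series_bound n r (\<lambda>z. \<Prod>i\<in>A. F i z) (\<Prod>i\<in>A. B i)"
  using assms(2,3,1)
proof (induction A rule: finite_induct)
  case empty
  then show ?case using series_bound_const[of r n 1] by simp
qed (auto intro: series_bound_mult)

lemma polydisc_mono: "r \<le> s \<Longrightarrow> polydisc n r \<subseteq> polydisc n s"
  by (auto simp: polydisc_def)

text \<open>A Schwarz type estimate: without constant term every monomial has degree at least 1, so
  scaling the radius by \<open>t\<close> gains a factor \<open>t\<close>. This makes inner functions
  small enough for composition.\<close>

lemma series_bound_shrink:
  assumes "series_bound n r F B" "F (\<lambda>_. 0) = 0" "0 < t" "t \<le> 1"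
  shows "series_bound n (t * r) F (t * B)"
proof -
  obtain c H where c: "r > 0" "((\<lambda>\<alpha>. norm (c \<alpha>) * r ^ tdeg n \<alpha>) has_sum H) (Exps n)" "H \<le> B" "0 \<le> H"
    "\<And>z. z \<in> polydisc n r \<Longrightarrow> ((\<lambda>\<alpha>. c \<alpha> * pw n z \<alpha>) has_sum F z) (Exps n)"
    by (rule series_boundE[OF assms(1)], rule that)
  have "((\<lambda>\<alpha>. c \<alpha> * pw n (\<lambda>_. 0) \<alpha>) has_sum F (\<lambda>_. 0)) (Exps n)"
    using c(1) by (intro c(5)) (auto simp: polydisc_def)
  then have "((\<lambda>\<alpha>. c \<alpha> * pw n (\<lambda>_. 0) \<alpha>) has_sum F (\<lambda>_. 0)) {0}"
    by (rule has_sum_cong_neutral[THEN iffD1, rotated 3]) (auto simp: pw_at_0)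
  then have c0: "c 0 = 0" using assms(2) has_sum_unique[OF has_sum_finite[of "{0}"]] by fastforce
  have le: "norm (c \<alpha>) * (t * r) ^ tdeg n \<alpha> \<le> t * (norm (c \<alpha>) * r ^ tdeg n \<alpha>)" if "\<alpha> \<in> Exps n" for \<alpha>
  proof (cases "\<alpha> = 0")
    case False
    then have "tdeg n \<alpha> \<ge> 1" using tdeg_eq_0[OF that] by auto
    then have "t ^ tdeg n \<alpha> \<le> t" using assms power_decreasing[of 1 "tdeg n \<alpha>" t] by simp
    then have "norm (c \<alpha>) * r ^ tdeg n \<alpha> * t ^ tdeg n \<alpha> \<le> norm (c \<alpha>) * r ^ tdeg n \<alpha> * t"
      using c(1) by (intro mult_left_mono) auto
    then show ?thesis by (simp add: power_mult_distrib mult_ac)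
  qed (use c0 in simp)
  have tH: "((\<lambda>\<alpha>. t * (norm (c \<alpha>) * r ^ tdeg n \<alpha>)) has_sum t * H) (Exps n)"
    using c(2) by (rule has_sum_cmult_right)
  have sum: "(\<lambda>\<alpha>. norm (c \<alpha>) * (t * r) ^ tdeg n \<alpha>) summable_on Exps n"
    by (rule summable_on_comparison_test[OF has_sum_imp_summable[OF tH]])
       (use le c(1) assms in auto)
  have "infsum (\<lambda>\<alpha>. norm (c \<alpha>) * (t * r) ^ tdeg n \<alpha>) (Exps n) \<le> t * H"
    by (rule has_sum_mono[OF has_sum_infsum[OF sum] tH]) (use le in auto)
  also have "\<dots> \<le> t * B" using c(3) assms by simp
  finally have "infsum (\<lambda>\<alpha>. norm (c \<alpha>) * (t * r) ^ tdeg n \<alpha>) (Exps n) \<le> t * B" .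
  moreover have "polydisc n (t * r) \<subseteq> polydisc n r"
    using assms c(1) by (intro polydisc_mono) (simp add: mult_left_le_one_le)
  ultimately show ?thesis
    unfolding series_bound_def using sum c(1,5) assms by (auto intro!: exI[of _ c])
qed

lemma series_bound_restrict:
  assumes "series_bound n r F B" "0 < s" "s \<le> r" shows "series_bound n s F B"
proof -
  obtain c H where c: "r > 0" "((\<lambda>\<alpha>. norm (c \<alpha>) * r ^ tdeg n \<alpha>) has_sum H) (Exps n)" "H \<le> B" "0 \<le> H"
    "\<And>z. z \<in> polydisc n r \<Longrightarrow> ((\<lambda>\<alpha>. c \<alpha> * pw n z \<alpha>) has_sum F z) (Exps n)"
    by (rule series_boundE[OF assms(1)], rule that)
  have le: "norm (c \<alpha>) * s ^ tdeg n \<alpha> \<le> norm (c \<alpha>) * r ^ tdeg n \<alpha>" for \<alpha>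
    using assms by (intro mult_left_mono power_mono) auto
  have sum: "(\<lambda>\<alpha>. norm (c \<alpha>) * s ^ tdeg n \<alpha>) summable_on Exps n"
    by (rule summable_on_comparison_test[OF has_sum_imp_summable[OF c(2)]])
       (use le assms in auto)
  have "infsum (\<lambda>\<alpha>. norm (c \<alpha>) * s ^ tdeg n \<alpha>) (Exps n) \<le> H"
    by (rule has_sum_mono[OF has_sum_infsum[OF sum] c(2)]) (use le in auto)
  then show ?thesis
    unfolding series_bound_def using sum c(3,5) assms polydisc_mono[OF assms(3), of n]
    by (auto intro!: exI[of _ c])
qed

lemma series_bound_compose:
  assumes F: "series_bound m \<rho> F B"
    and \<Phi>: "\<And>i. i < m \<Longrightarrow> series_bound n r (\<lambda>z. \<Phi> z i) \<rho>" and r: "r > 0"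
  shows "series_bound n r (\<lambda>z. F (\<Phi> z)) B"
proof -
  obtain c H where c: "\<rho> > 0" "((\<lambda>\<alpha>. norm (c \<alpha>) * \<rho> ^ tdeg m \<alpha>) has_sum H) (Exps m)" "H \<le> B" "0 \<le> H"
    "\<And>z. z \<in> polydisc m \<rho> \<Longrightarrow> ((\<lambda>\<alpha>. c \<alpha> * pw m z \<alpha>) has_sum F z) (Exps m)"
    by (rule series_boundE[OF F], rule that)
  have "series_bound n r (\<lambda>z. F (\<Phi> z)) (infsum (\<lambda>\<alpha>. norm (c \<alpha>) * \<rho> ^ tdeg m \<alpha>) (Exps m))"
  proof (rule series_bound_infsum[where F = "\<lambda>\<alpha> z. c \<alpha> * pw m (\<Phi> z) \<alpha>"])
    show "series_bound n r (\<lambda>z. c \<alpha> * pw m (\<Phi> z) \<alpha>) (norm (c \<alpha>) * \<rho> ^ tdeg m \<alpha>)" for \<alpha>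
      unfolding pw_def tdeg_def power_sum
      by (intro series_bound_mult series_bound_const series_bound_prod series_bound_power r \<Phi>) auto
    show "((\<lambda>\<alpha>. c \<alpha> * pw m (\<Phi> z) \<alpha>) has_sum F (\<Phi> z)) (Exps m)" if "z \<in> polydisc n r" for z
      using series_bound_norm_le[OF \<Phi> that] by (intro c(5)) (auto simp: polydisc_def)
  qed (use r has_sum_imp_summable[OF c(2)] in auto)
  then have "series_bound n r (\<lambda>z. F (\<Phi> z)) H" using infsumI[OF c(2)] by simp
  then show ?thesis using c(3) by (rule series_bound_mono)
qed

text \<open>The monomials that contain \<open>z i\<close> are divided by it, the others form the
  restriction to \<open>z i = 0\<close>. Division lowers the degree by one, hence the factor
  \<open>1 / r\<close>.\<close>

lemma series_bound_divide:
  assumes "series_bound n r F B" "i < n"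
  shows "\<exists>Q. series_bound n r Q (B / r) \<and> (\<forall>z\<in>polydisc n r. F z = F (z(i := 0)) + z i * Q z)"
proof -
  obtain c H where c: "r > 0" "((\<lambda>\<alpha>. norm (c \<alpha>) * r ^ tdeg n \<alpha>) has_sum H) (Exps n)" "H \<le> B" "0 \<le> H"
    "\<And>z. z \<in> polydisc n r \<Longrightarrow> ((\<lambda>\<alpha>. c \<alpha> * pw n z \<alpha>) has_sum F z) (Exps n)"
    by (rule series_boundE[OF assms(1)], rule that)
  define I where "I = {\<alpha> \<in> Exps n. lk \<alpha> i > 0}"
  have I: "I \<subseteq> Exps n" by (auto simp: I_def)
  define \<phi> where "\<phi> \<alpha> = \<alpha> - sg i 1" for \<alpha> :: "nat \<Rightarrow>\<^sub>0 nat"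
  have \<phi>: "\<alpha> = \<phi> \<alpha> + sg i 1" if "\<alpha> \<in> I" for \<alpha>
    using that by (intro poly_mapping_eqI)
      (auto simp: \<phi>_def I_def lookup_add lookup_minus lookup_single when_def)
  have \<phi>_Exps: "\<phi> \<alpha> \<in> Exps n" if "\<alpha> \<in> I" for \<alpha>
    using that by (auto simp: \<phi>_def I_def Exps_def in_keys_iff lookup_minus subset_iff)
  have tdeg\<phi>: "tdeg n \<alpha> = Suc (tdeg n (\<phi> \<alpha>))" if "\<alpha> \<in> I" for \<alpha>
    using tdeg_add[of n "\<phi> \<alpha>" "sg i 1"] \<phi>[OF that] tdeg_single[OF assms(2)] by simp
  have pw\<phi>: "pw n z \<alpha> = z i * pw n z (\<phi> \<alpha>)" if "\<alpha> \<in> I" for z \<alpha>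
    using pw_add[of n z "\<phi> \<alpha>" "sg i 1"] \<phi>[OF that] pw_single[OF assms(2)] by simp
  define H' where "H' = infsum (\<lambda>\<alpha>. norm (c \<alpha>) * r ^ tdeg n \<alpha>) I"
  have sumI: "(\<lambda>\<alpha>. norm (c \<alpha>) * r ^ tdeg n \<alpha>) summable_on I"
    using summable_on_subset_banach[OF has_sum_imp_summable[OF c(2)] I] .
  have H': "((\<lambda>\<alpha>. norm (c \<alpha>) * r ^ tdeg n \<alpha>) has_sum H') I"
    using sumI by (simp add: H'_def)
  have "H' \<le> H" by (rule has_sum_mono2[OF H' c(2) I]) (use c(1) in auto)
  have n\<phi>: "((\<lambda>\<alpha>. norm (c \<alpha>) * r ^ tdeg n (\<phi> \<alpha>)) has_sum (H' / r)) I"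
  proof -
    have "((\<lambda>\<alpha>. norm (c \<alpha>) * r ^ tdeg n \<alpha> * (1 / r)) has_sum H' * (1 / r)) I"
      using H' by (rule has_sum_cmult_left)
    also have "?this \<longleftrightarrow> ((\<lambda>\<alpha>. norm (c \<alpha>) * r ^ tdeg n (\<phi> \<alpha>)) has_sum H' * (1 / r)) I"
      by (rule has_sum_cong) (use c(1) in \<open>simp add: tdeg\<phi>\<close>)
    finally show ?thesis by simp
  qed
  define Q where "Q z = infsum (\<lambda>\<alpha>. c \<alpha> * pw n z (\<phi> \<alpha>)) I" for z
  have Q: "((\<lambda>\<alpha>. c \<alpha> * pw n z (\<phi> \<alpha>)) has_sum Q z) I" if "z \<in> polydisc n r" for z
  proof -
    have "(\<lambda>\<alpha>. norm (c \<alpha> * pw n z (\<phi> \<alpha>))) summable_on I"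
      by (rule Infinite_Sum.abs_summable_on_comparison_test'[OF has_sum_imp_summable[OF n\<phi>]])
         (auto simp: norm_mult intro!: mult_left_mono norm_pw_le[OF that])
    then show ?thesis by (simp add: Q_def summable_on_iff_abs_summable_on_complex)
  qed
  have "F z = F (z(i := 0)) + z i * Q z" if z: "z \<in> polydisc n r" for z
  proof -
    have z0: "z(i := 0) \<in> polydisc n r" using z c(1) by (auto simp: polydisc_def)
    have 1: "((\<lambda>\<alpha>. c \<alpha> * pw n z \<alpha>) has_sum z i * Q z) I"
      using has_sum_cmult_right[OF Q[OF z], of "z i"]
      by (rule has_sum_cong[THEN iffD1, rotated]) (simp add: pw\<phi>)
    have eq: "pw n (z(i := 0)) \<alpha> = (if \<alpha> \<in> I then 0 else pw n z \<alpha>)" if "\<alpha> \<in> Exps n" for \<alpha>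
    proof (cases "\<alpha> \<in> I")
      case True
      then show ?thesis using pw\<phi>[OF True, of "z(i := 0)"] by simp
    next
      case False
      then show ?thesis using that unfolding pw_def I_def by (auto intro!: prod.cong)
    qed
    have 2: "((\<lambda>\<alpha>. c \<alpha> * pw n z \<alpha>) has_sum F (z(i := 0))) (Exps n - I)"
      using c(5)[OF z0]
      by (rule has_sum_cong_neutral[THEN iffD1, rotated 3]) (use eq I in auto)
    have "((\<lambda>\<alpha>. c \<alpha> * pw n z \<alpha>) has_sum (F (z(i := 0)) + z i * Q z)) ((Exps n - I) \<union> I)"
      by (rule has_sum_Un_disjoint[OF 2 1]) auto
    moreover have "(Exps n - I) \<union> I = Exps n" using I by blast
    ultimately show ?thesis using has_sum_unique[OF c(5)[OF z]] by metis
  qed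
  moreover have "series_bound n r Q (B / r)"
    by (rule series_boundI[where I = I and \<phi> = \<phi> and a = c])
       (use c(1,3) \<open>H' \<le> H\<close> n\<phi> Q \<phi>_Exps in \<open>auto intro: divide_right_mono\<close>)
  ultimately show ?thesis by blast
qed

lemma series_bound_local:
  assumes "series_bound n r F B" "z \<in> polydisc n r" "\<And>i. i < n \<Longrightarrow> w i = z i"
  shows "F w = F z"
proof -
  have "w \<in> polydisc n r" "pw n w = pw n z"
    using assms(2,3) by (auto simp: polydisc_def pw_def)
  then show ?thesis using assms(1,2) unfolding series_bound_def by (metis has_sum_unique)
qed

subsection \<open>Germs of holomorphic functions\<close>

lemma near0_mono: "near0 n P \<Longrightarrow> (\<And>z. P z \<Longrightarrow> Q z) \<Longrightarrow> near0 n Q"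
  unfolding near0_def by blast

lemma near0_conj: "near0 n P \<Longrightarrow> near0 n Q \<Longrightarrow> near0 n (\<lambda>z. P z \<and> Q z)"
  unfolding near0_def
proof (elim exE conjE)
  fix r s assume r: "r > 0" "\<forall>z. (\<forall>i<n. norm (z i) < r) \<longrightarrow> P z"
    and s: "s > 0" "\<forall>z. (\<forall>i<n. norm (z i) < s) \<longrightarrow> Q z"
  then show "\<exists>r>0. \<forall>z. (\<forall>i<n. norm (z i) < r) \<longrightarrow> P z \<and> Q z"
    by (intro exI[of _ "min r s"]) auto
qed

lemma near0_True: "(\<And>z. P z) \<Longrightarrow> near0 n P"
  unfolding near0_def by (auto intro: exI[of _ 1])

lemma near0_all: "(\<And>i. i < k \<Longrightarrow> near0 n (P i)) \<Longrightarrow> near0 n (\<lambda>z. \<forall>i<(k::nat). P i z)"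
proof (induction k)
  case (Suc k)
  then have "near0 n (\<lambda>z. (\<forall>i<k. P i z) \<and> P k z)" by (intro near0_conj) auto
  then show ?case by (rule near0_mono) (auto simp: less_Suc_eq)
qed (simp add: near0_True)

lemma near0_at_0: "near0 n P \<Longrightarrow> (\<And>i. i < n \<Longrightarrow> z i = 0) \<Longrightarrow> P z"
  unfolding near0_def by fastforce

lemma near0_polydisc: "r > 0 \<Longrightarrow> near0 n (\<lambda>z. z \<in> polydisc n r)"
  unfolding near0_def polydisc_def by fastforce

lemma near0_weaken: "near0 n P \<Longrightarrow> n \<le> m \<Longrightarrow> near0 m P"
  unfolding near0_def by (meson less_le_trans)

lemma holo_iff_series_bound: "holo n F \<longleftrightarrow> (\<exists>r B. series_bound n r F B)"
proof
  assume "holo n F"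
  then obtain c where c: "near0 n (\<lambda>z. ((\<lambda>\<alpha>. c \<alpha> * pw n z \<alpha>) has_sum F z) (Exps n))"
    unfolding holo_def pw_def Exps_def by blast
  then obtain r where r: "r > 0" "\<And>z. (\<forall>i<n. norm (z i) < r) \<Longrightarrow> ((\<lambda>\<alpha>. c \<alpha> * pw n z \<alpha>) has_sum F z) (Exps n)"
    unfolding near0_def by blast
  define s where "s = r / 2"
  have s: "s > 0" "s < r" using r(1) by (auto simp: s_def)
  \<comment> \<open>Unconditional summability of complex numbers is absolute, so convergence at the
    single point \<open>(s, ..., s)\<close> already gives the weighted norm at radius
    \<open>s\<close>.\<close>
  have "((\<lambda>\<alpha>. c \<alpha> * pw n (\<lambda>_. of_real s) \<alpha>) has_sum F (\<lambda>_. of_real s)) (Exps n)"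
    using s by (intro r(2)) auto
  then have "(\<lambda>\<alpha>. norm (c \<alpha> * pw n (\<lambda>_. of_real s) \<alpha>)) summable_on (Exps n)"
    by (simp add: has_sum_imp_summable flip: summable_on_iff_abs_summable_on_complex)
  moreover have "norm (c \<alpha> * pw n (\<lambda>_. of_real s) \<alpha>) = norm (c \<alpha>) * s ^ tdeg n \<alpha>" for \<alpha>
    using s by (simp add: norm_mult pw_def tdeg_def power_sum prod_norm[symmetric] norm_power)
  ultimately have "(\<lambda>\<alpha>. norm (c \<alpha>) * s ^ tdeg n \<alpha>) summable_on (Exps n)" by simp
  moreover have "((\<lambda>\<alpha>. c \<alpha> * pw n z \<alpha>) has_sum F z) (Exps n)" if "z \<in> polydisc n s" for z
    using that s by (intro r(2)) (auto simp: polydisc_def)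
  ultimately show "\<exists>r B. series_bound n r F B"
    unfolding series_bound_def using s(1) by blast
next
  assume "\<exists>r B. series_bound n r F B"
  then obtain r B where "series_bound n r F B" by blast
  then obtain c where "r > 0" "\<forall>z\<in>polydisc n r. ((\<lambda>\<alpha>. c \<alpha> * pw n z \<alpha>) has_sum F z) (Exps n)"
    unfolding series_bound_def by blast
  then have "near0 n (\<lambda>z. ((\<lambda>\<alpha>. c \<alpha> * pw n z \<alpha>) has_sum F z) (Exps n))"
    using near0_polydisc by (blast intro: near0_mono)
  then show "holo n F" unfolding holo_def pw_def Exps_def by blast
qed

lemma holo_pair:
  assumes "holo n F" "holo n G"
  obtains r B C where "series_bound n r F B" "series_bound n r G C"
proof -
  obtain r s B C where F: "series_bound n r F B" and G: "series_bound n s G C"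
    using assms holo_iff_series_bound by blast
  then have "r > 0" "s > 0" by (auto simp: series_bound_def)
  then have "series_bound n (min r s) F B" "series_bound n (min r s) G C"
    using F G by (auto intro: series_bound_restrict)
  then show thesis by (rule that)
qed

lemma holo_const [intro!, simp]: "holo n (\<lambda>_. k)"
  using series_bound_const[of 1 n k] holo_iff_series_bound by force

lemma holo_coord [intro!]: "i < n \<Longrightarrow> holo n (\<lambda>z. z i)"
  using series_bound_coord[of 1 i n] holo_iff_series_bound by force

lemma holo_add [intro!]: "holo n F \<Longrightarrow> holo n G \<Longrightarrow> holo n (\<lambda>z. F z + G z)"
  by (erule holo_pair, assumption) (use series_bound_add holo_iff_series_bound in blast)

lemma holo_mult [intro!]: "holo n F \<Longrightarrow> holo n G \<Longrightarrow> holo n (\<lambda>z. F z * G z)"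
  by (erule holo_pair, assumption) (use series_bound_mult holo_iff_series_bound in blast)

lemma holo_uminus [intro!]: "holo n F \<Longrightarrow> holo n (\<lambda>z. - F z)"
  using holo_mult[of n "\<lambda>_. - 1" F] by simp

lemma holo_diff [intro!]: "holo n F \<Longrightarrow> holo n G \<Longrightarrow> holo n (\<lambda>z. F z - G z)"
  using holo_add[OF _ holo_uminus, of n F G] by simp

lemma holo_sum [intro!]: "(\<And>a. a \<in> A \<Longrightarrow> holo n (F a)) \<Longrightarrow> holo n (\<lambda>z. \<Sum>a\<in>A. F a z)"
  by (induction A rule: infinite_finite_induct) auto

lemma holo_prod [intro!]: "(\<And>a. a \<in> A \<Longrightarrow> holo n (F a)) \<Longrightarrow> holo n (\<lambda>z. \<Prod>a\<in>A. F a z)"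
  by (induction A rule: infinite_finite_induct) auto

lemma holo_power [intro!]: "holo n F \<Longrightarrow> holo n (\<lambda>z. F z ^ k)"
  by (induction k) auto

lemma holo_if [intro!]: "(P \<Longrightarrow> holo n F) \<Longrightarrow> (\<not> P \<Longrightarrow> holo n G) \<Longrightarrow> holo n (\<lambda>z. if P then F z else G z)"
  by (cases P) simp_all

lemma holo_cong:
  assumes "holo n F" "near0 n (\<lambda>z. G z = F z)" shows "holo n G"
proof -
  obtain c where "near0 n (\<lambda>z. ((\<lambda>\<alpha>. c \<alpha> * pw n z \<alpha>) has_sum F z) (Exps n))"
    using assms(1) unfolding holo_def pw_def Exps_def by blast
  from near0_conj[OF this assms(2)]
  have "near0 n (\<lambda>z. ((\<lambda>\<alpha>. c \<alpha> * pw n z \<alpha>) has_sum G z) (Exps n))"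
    by (rule near0_mono) auto
  then show ?thesis unfolding holo_def pw_def Exps_def by blast
qed

text \<open>Points are infinite sequences; this lets two arguments be exchanged that differ only
  from entry \<open>n\<close> on.\<close>

lemma holo_local: "holo n F \<Longrightarrow> near0 n (\<lambda>z. \<forall>w. (\<forall>i<n. w i = z i) \<longrightarrow> F w = F z)"
proof -
  assume "holo n F"
  then obtain r B where F: "series_bound n r F B" using holo_iff_series_bound by blast
  then have "r > 0" by (simp add: series_bound_def)
  from near0_polydisc[OF this, of n] show ?thesis
    by (rule near0_mono) (use series_bound_local[OF F] in blast)
qed

lemma holo_cont:
  assumes "holo n F" "\<epsilon> > 0" shows "near0 n (\<lambda>z. norm (F z - F (\<lambda>_. 0)) < \<epsilon>)"
proof -
  have "holo n (\<lambda>z. F z - F (\<lambda>_. 0))" using assms(1) by auto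
  then obtain r B where F: "series_bound n r (\<lambda>z. F z - F (\<lambda>_. 0)) B"
    using holo_iff_series_bound by blast
  have B: "B \<ge> 0" using series_bound_nonneg[OF F] .
  define t where "t = min 1 (\<epsilon> / (2 * (B + 1)))"
  have t: "t > 0" "t \<le> 1" using assms(2) B by (auto simp: t_def)
  have "t * B \<le> \<epsilon> / (2 * (B + 1)) * B" using B by (intro mult_right_mono) (auto simp: t_def)
  also have "\<dots> < \<epsilon>" using B assms(2) by (simp add: divide_simps)
  finally have tB: "t * B < \<epsilon>" .
  have F': "series_bound n (t * r) (\<lambda>z. F z - F (\<lambda>_. 0)) (t * B)"
    using series_bound_shrink[OF F _ t] by simp
  then have "t * r > 0" by (simp add: series_bound_def)
  from near0_polydisc[OF this, of n] show ?thesis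
    by (rule near0_mono) (use series_bound_norm_le[OF F'] tB in force)
qed

lemma holo_bounded: "holo n F \<Longrightarrow> \<exists>C>0. near0 n (\<lambda>z. norm (F z) \<le> C)"
proof -
  assume F: "holo n F"
  have "near0 n (\<lambda>z. norm (F z - F (\<lambda>_. 0)) < 1)" using F by (rule holo_cont) simp
  then have "near0 n (\<lambda>z. norm (F z) \<le> norm (F (\<lambda>_. 0)) + 1)"
  proof (rule near0_mono)
    fix z assume "norm (F z - F (\<lambda>_. 0)) < 1"
    then show "norm (F z) \<le> norm (F (\<lambda>_. 0)) + 1"
      using norm_triangle_ineq2[of "F z" "F (\<lambda>_. 0)"] by linarith
  qed
  then show ?thesis by (intro exI[of _ "norm (F (\<lambda>_. 0)) + 1"]) (simp add: add_nonneg_pos)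
qed

lemma near0_compose:
  assumes P: "near0 m P" and \<Phi>: "\<And>i. i < m \<Longrightarrow> holo n (\<lambda>z. \<Phi> z i)"
    and \<Phi>0: "\<And>i. i < m \<Longrightarrow> \<Phi> (\<lambda>_. 0) i = 0"
  shows "near0 n (\<lambda>z. P (\<Phi> z))"
proof -
  obtain r where r: "r > 0" "\<And>z. (\<forall>i<m. norm (z i) < r) \<Longrightarrow> P z"
    using P unfolding near0_def by blast
  have "near0 n (\<lambda>z. \<forall>i<m. norm (\<Phi> z i) < r)"
  proof (rule near0_all)
    show "near0 n (\<lambda>z. norm (\<Phi> z i) < r)" if "i < m" for i
      using holo_cont[OF \<Phi>[OF that] r(1)] \<Phi>0[OF that] by simp
  qed
  then show ?thesis by (rule near0_mono) (use r(2) in blast)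
qed

lemma holo_compose:
  assumes F: "holo m F" and \<Phi>: "\<And>i. i < m \<Longrightarrow> holo n (\<lambda>z. \<Phi> z i)"
    and \<Phi>0: "\<And>i. i < m \<Longrightarrow> \<Phi> (\<lambda>_. 0) i = 0"
  shows "holo n (\<lambda>z. F (\<Phi> z))"
proof -
  obtain \<rho> B where FB: "series_bound m \<rho> F B" using F holo_iff_series_bound by blast
  then have \<rho>: "\<rho> > 0" by (simp add: series_bound_def)
  have ex: "\<exists>r. series_bound n r (\<lambda>z. \<Phi> z i) \<rho>" if i: "i < m" for i
  proof -
    obtain r C where r: "series_bound n r (\<lambda>z. \<Phi> z i) C" using \<Phi>[OF i] holo_iff_series_bound by blast
    have C: "C \<ge> 0" using series_bound_nonneg[OF r] .
    define t where "t = min 1 (\<rho> / (C + 1))"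
    have t: "t > 0" "t \<le> 1" using \<rho> C by (auto simp: t_def)
    have "t * C \<le> \<rho> / (C + 1) * C" using C by (intro mult_right_mono) (auto simp: t_def)
    also have "\<dots> \<le> \<rho>" using C \<rho> by (simp add: divide_simps)
    finally have "t * C \<le> \<rho>" .
    then show ?thesis using series_bound_shrink[OF r \<Phi>0[OF i] t] series_bound_mono by blast
  qed
  have "\<exists>r>0. \<forall>i<k. series_bound n r (\<lambda>z. \<Phi> z i) \<rho>" if "k \<le> m" for k
    using that
  proof (induction k)
    case (Suc k)
    then obtain r where r: "r > 0" "\<forall>i<k. series_bound n r (\<lambda>z. \<Phi> z i) \<rho>" by auto
    obtain s where s: "series_bound n s (\<lambda>z. \<Phi> z k) \<rho>" using ex[of k] Suc by auto
    then have "s > 0" by (simp add: series_bound_def)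
    then have "\<forall>i<Suc k. series_bound n (min r s) (\<lambda>z. \<Phi> z i) \<rho>"
      using r s by (auto simp: less_Suc_eq intro: series_bound_restrict)
    then show ?case using r(1) \<open>s > 0\<close> by (intro exI[of _ "min r s"]) auto
  qed (auto intro: exI[of _ 1])
  then obtain r where "r > 0" "\<And>i. i < m \<Longrightarrow> series_bound n r (\<lambda>z. \<Phi> z i) \<rho>" by blast
  then show ?thesis using series_bound_compose[OF FB] holo_iff_series_bound by blast
qed

lemma holo_weaken: "holo n F \<Longrightarrow> n \<le> m \<Longrightarrow> holo m F"
  by (rule holo_compose[where \<Phi> = "\<lambda>z. z"]) auto

section \<open>Division of germs by coordinates, and Hadamard quotients\<close>

lemma holo_divide:
  assumes "holo n F" "i < n"
  obtains Q where "holo n Q" "near0 n (\<lambda>z. F z = F (z(i := 0)) + z i * Q z)"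
proof -
  obtain r B where F: "series_bound n r F B" using assms(1) holo_iff_series_bound by blast
  then have r: "r > 0" by (simp add: series_bound_def)
  obtain Q where Q: "series_bound n r Q (B / r)" "\<And>z. z \<in> polydisc n r \<Longrightarrow> F z = F (z(i := 0)) + z i * Q z"
    using series_bound_divide[OF F assms(2)] by blast
  from near0_polydisc[OF r, of n] have "near0 n (\<lambda>z. F z = F (z(i := 0)) + z i * Q z)"
    by (rule near0_mono) (rule Q(2))
  moreover have "holo n Q" using Q(1) holo_iff_series_bound by blast
  ultimately show thesis by (intro that)
qed

lemma holo_divide_vanishing:
  assumes "holo n F" "i < n" "near0 n (\<lambda>z. F (z(i := 0)) = 0)"
  obtains Q where "holo n Q" "near0 n (\<lambda>z. F z = z i * Q z)"
proof (rule holo_divide[OF assms(1,2)])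
  fix Q assume Q: "holo n Q" "near0 n (\<lambda>z. F z = F (z(i := 0)) + z i * Q z)"
  from near0_conj[OF assms(3) Q(2)] have "near0 n (\<lambda>z. F z = z i * Q z)"
    by (rule near0_mono) auto
  with Q(1) show thesis by (rule that)
qed

text \<open>Only points with \<open>z i = 0\<close> need care. Moving off the hyperplane by a small
  \<open>t\<close> gives \<open>A z = - t * Q w\<close> with \<open>Q\<close> bounded, and
  \<open>t\<close> is arbitrary.\<close>

lemma holo_cancel:
  assumes A: "holo n A" and i: "i < n" and 0: "near0 n (\<lambda>z. z i * A z = 0)"
  shows "near0 n (\<lambda>z. A z = 0)"
proof -
  obtain Q where Q: "holo n Q" "near0 n (\<lambda>z. A z = A (z(i := 0)) + z i * Q z)"
    using holo_divide[OF A i] .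
  obtain C where C: "C > 0" "near0 n (\<lambda>z. norm (Q z) \<le> C)" using holo_bounded[OF Q(1)] by blast
  obtain r where r: "r > 0" "\<And>z. (\<forall>i<n. norm (z i) < r) \<Longrightarrow>
      (z i * A z = 0 \<and> A z = A (z(i := 0)) + z i * Q z) \<and> norm (Q z) \<le> C"
    using near0_conj[OF near0_conj[OF 0 Q(2)] C(2)] unfolding near0_def by blast
  have "A z = 0" if z: "\<forall>i<n. norm (z i) < r" for z
  proof (cases "z i = 0")
    case True
    have "norm (A z) \<le> 0 + \<epsilon>" if "\<epsilon> > 0" for \<epsilon>
    proof -
      define t where "t = min (r / 2) (\<epsilon> / C)"
      have t: "t > 0" "t < r" "t * C \<le> \<epsilon>" using r(1) C(1) that by (auto simp: t_def min_def field_simps)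
      define w where "w = z(i := of_real t)"
      have w: "\<forall>i<n. norm (w i) < r" using z t by (auto simp: w_def)
      have "w(i := 0) = z" using True by (auto simp: w_def)
      moreover have "w i = of_real t" by (simp add: w_def)
      ultimately have "A w = 0" "A w = A z + of_real t * Q w" "norm (Q w) \<le> C"
        using r(2)[OF w] t(1) by auto
      then have "norm (A z) = t * norm (Q w)" "norm (Q w) \<le> C" using t(1)
        by (auto simp: add_eq_0_iff2 norm_mult)
      then show ?thesis using t mult_left_mono[of "norm (Q w)" C t] by linarith
    qed
    then show ?thesis using field_le_epsilon[of "norm (A z)" 0] by simp
  qed (use r(2)[OF z] in auto)
  then show ?thesis using r(1) unfolding near0_def by blast
qed

text \<open>Turns \<open>deriv\<close> into algebra: a difference quotient that extends to a germ
  \<open>Q\<close> tends to the value of \<open>Q\<close> at 0, by continuity.\<close>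

lemma partial0_eqI:
  assumes Q: "holo 1 Q" and F: "near0 1 (\<lambda>z. F ((\<lambda>_. 0)(i := z 0)) = F (\<lambda>_. 0) + z 0 * Q z)"
  shows "partial0 i F = Q (\<lambda>_. 0)"
  unfolding partial0_def
proof (rule DERIV_imp_deriv, unfold DERIV_def LIM_def, intro allI impI)
  fix \<epsilon> :: real assume "\<epsilon> > 0"
  from near0_conj[OF F holo_cont[OF Q this]] obtain r where r: "r > 0"
    "\<And>z. (\<forall>i<1. norm (z i) < r) \<Longrightarrow> F ((\<lambda>_. 0)(i := z 0)) = F (\<lambda>_. 0) + z 0 * Q z \<and>
       norm (Q z - Q (\<lambda>_. 0)) < \<epsilon>"
    unfolding near0_def by blast
  have "dist ((F ((\<lambda>_. 0)(i := 0 + t)) - F ((\<lambda>_. 0)(i := 0))) / t) (Q (\<lambda>_. 0)) < \<epsilon>"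
    if "t \<noteq> 0" "dist t 0 < r" for t
    using r(2)[of "\<lambda>_. t"] that by (simp add: dist_norm fun_upd_idem)
  then show "\<exists>s>0. \<forall>x. x \<noteq> 0 \<and> dist x 0 < s \<longrightarrow>
     dist ((F ((\<lambda>_. 0)(i := 0 + x)) - F ((\<lambda>_. 0)(i := 0))) / x) (Q (\<lambda>_. 0)) < \<epsilon>"
    using r(1) by blast
qed

text \<open>Hadamard's lemma: telescope over the coordinates; each term vanishes where \<open>z\<^sub>j = z\<^sub>m\<^sub>+\<^sub>j\<close> and
  becomes divisible by a coordinate after a linear change of variables.\<close>

lemma hadamard:
  assumes F: "holo m F"
  obtains Q where "\<And>i. i < m \<Longrightarrow> holo (m + m) (Q i)"
    "near0 (m + m) (\<lambda>z. F z - F (\<lambda>i. z (m + i)) = (\<Sum>i<m. (z i - z (m + i)) * Q i z))"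
proof -
  define hyb where "hyb j z = (\<lambda>i. if i < j then z i else z (m + i))" for j :: nat and z :: cvec
  have hyb: "holo (m + m) (\<lambda>z. F (hyb j z))" if "j \<le> m" for j
    by (rule holo_compose[OF F]) (use that in \<open>auto simp: hyb_def\<close>)
  have "\<exists>Q. holo (m + m) Q \<and> near0 (m + m) (\<lambda>z. F (hyb (Suc j) z) - F (hyb j z) = (z j - z (m + j)) * Q z)"
    if j: "j < m" for j
  proof -
    define E where "E z = F (hyb (Suc j) z) - F (hyb j z)" for z
    have E: "holo (m + m) E" unfolding E_def using hyb[of "Suc j"] hyb[of j] j by auto
    define L where "L z = z(j := z j + z (m + j))" for z :: cvec
    define L' where "L' z = z(j := z j - z (m + j))" for z :: cvec
    have holoL: "holo (m + m) (\<lambda>z. L z i)" "holo (m + m) (\<lambda>z. L' z i)" if "i < m + m" for i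
      using that j unfolding L_def L'_def by auto
    have EL: "holo (m + m) (\<lambda>z. E (L z))"
      by (rule holo_compose[OF E]) (use holoL in \<open>auto simp: L_def\<close>)
    have "E (L (z(j := 0))) = 0" for z
    proof -
      have "hyb (Suc j) (L (z(j := 0))) = hyb j (L (z(j := 0)))"
        using j by (auto simp: hyb_def L_def less_Suc_eq)
      then show ?thesis by (simp add: E_def)
    qed
    then have v: "near0 (m + m) (\<lambda>z. E (L (z(j := 0))) = 0)" by (rule near0_True)
    have j': "j < m + m" using j by simp
    obtain Q where Q: "holo (m + m) Q" "near0 (m + m) (\<lambda>z. E (L z) = z j * Q z)"
      by (rule holo_divide_vanishing[OF EL j' v], rule that)
    have "holo (m + m) (\<lambda>z. Q (L' z))"
      by (rule holo_compose[OF Q(1)]) (use holoL in \<open>auto simp: L'_def\<close>)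
    moreover have "near0 (m + m) (\<lambda>z. E (L (L' z)) = L' z j * Q (L' z))"
      by (rule near0_compose[OF Q(2)]) (use holoL in \<open>auto simp: L'_def\<close>)
    moreover have "L (L' z) = z" "L' z j = z j - z (m + j)" for z
      using j by (auto simp: L_def L'_def)
    ultimately show ?thesis unfolding E_def by (intro exI[of _ "\<lambda>z. Q (L' z)"]) simp
  qed
  then have "\<forall>j\<in>{..<m}. \<exists>Q. holo (m + m) Q \<and>
      near0 (m + m) (\<lambda>z. F (hyb (Suc j) z) - F (hyb j z) = (z j - z (m + j)) * Q z)"
    by simp
  from bchoice[OF this] obtain Q where "\<forall>j\<in>{..<m}. holo (m + m) (Q j) \<and>
      near0 (m + m) (\<lambda>z. F (hyb (Suc j) z) - F (hyb j z) = (z j - z (m + j)) * Q j z)" ..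
  then have Q: "\<And>j. j < m \<Longrightarrow> holo (m + m) (Q j)"
    "\<And>j. j < m \<Longrightarrow> near0 (m + m) (\<lambda>z. F (hyb (Suc j) z) - F (hyb j z) = (z j - z (m + j)) * Q j z)"
    by simp_all
  \<comment> \<open>\<open>hyb m z\<close> agrees with \<open>z\<close> only in the first
    \<open>m\<close> entries, so locality is needed to end the telescoping sum at
    \<open>F z\<close>.\<close>
  have loc: "near0 (m + m) (\<lambda>z. \<forall>w. (\<forall>i<m. w i = z i) \<longrightarrow> F w = F z)"
    using holo_local[OF F] by (rule near0_weaken) simp
  have "near0 (m + m) (\<lambda>z. \<forall>i<m. F (hyb (Suc i) z) - F (hyb i z) = (z i - z (m + i)) * Q i z)"
    by (rule near0_all) (rule Q(2))
  from near0_conj[OF this loc]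
  have "near0 (m + m) (\<lambda>z. F z - F (\<lambda>i. z (m + i)) = (\<Sum>i<m. (z i - z (m + i)) * Q i z))"
  proof (rule near0_mono, elim conjE)
    fix z assume 1: "\<forall>i<m. F (hyb (Suc i) z) - F (hyb i z) = (z i - z (m + i)) * Q i z"
      and 2: "\<forall>w. (\<forall>i<m. w i = z i) \<longrightarrow> F w = F z"
    have "F (hyb m z) = F z" by (rule 2[rule_format]) (simp add: hyb_def)
    moreover have "hyb 0 z = (\<lambda>i. z (m + i))" by (simp add: hyb_def)
    moreover have "F (hyb m z) - F (hyb 0 z) = (\<Sum>i<m. F (hyb (Suc i) z) - F (hyb i z))"
      by (rule sum_lessThan_telescope[symmetric])
    ultimately show "F z - F (\<lambda>i. z (m + i)) = (\<Sum>i<m. (z i - z (m + i)) * Q i z)"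
      using 1 by simp
  qed
  with Q(1) show thesis by (rule that)
qed

text \<open>Hadamard's lemma with the second point at the origin. The quotients are not unique, but
  their values at 0 are.\<close>

lemma holo_expand_at_0:
  assumes F: "holo n F"
  obtains P where "\<And>i. i < n \<Longrightarrow> holo n (P i)" "\<And>i. i < n \<Longrightarrow> P i (\<lambda>_. 0) = partial0 i F"
    "near0 n (\<lambda>z. F z = F (\<lambda>_. 0) + (\<Sum>i<n. z i * P i z))"
proof -
  obtain Q where Q: "\<And>i. i < n \<Longrightarrow> holo (n + n) (Q i)"
    "near0 (n + n) (\<lambda>z. F z - F (\<lambda>i. z (n + i)) = (\<Sum>i<n. (z i - z (n + i)) * Q i z))"
    by (rule hadamard[OF F], rule that)
  \<comment> \<open>Cuts off the entries from \<open>n\<close> on, where Hadamard's lemma keeps the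
    second point.\<close>
  define \<Phi> where "\<Phi> z = (\<lambda>i. if i < n then z i else 0)" for z :: cvec
  have \<Phi>: "holo n (\<lambda>z. \<Phi> z i)" "\<Phi> (\<lambda>_. 0) i = 0" for i
    by (auto simp: \<Phi>_def)
  have P: "holo n (\<lambda>z. Q i (\<Phi> z))" if "i < n" for i
    by (rule holo_compose[OF Q(1)[OF that]]) (use \<Phi> in auto)
  have "near0 n (\<lambda>z. F (\<Phi> z) - F (\<lambda>i. \<Phi> z (n + i)) = (\<Sum>i<n. (\<Phi> z i - \<Phi> z (n + i)) * Q i (\<Phi> z)))"
    by (rule near0_compose[OF Q(2)]) (use \<Phi> in auto)
  from near0_conj[OF this holo_local[OF F]]
  have exp: "near0 n (\<lambda>z. F z = F (\<lambda>_. 0) + (\<Sum>i<n. z i * Q i (\<Phi> z)))"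
  proof (rule near0_mono, elim conjE)
    fix z assume 1: "F (\<Phi> z) - F (\<lambda>i. \<Phi> z (n + i)) = (\<Sum>i<n. (\<Phi> z i - \<Phi> z (n + i)) * Q i (\<Phi> z))"
      and 2: "\<forall>w. (\<forall>i<n. w i = z i) \<longrightarrow> F w = F z"
    have "F (\<Phi> z) = F z" by (rule 2[rule_format]) (simp add: \<Phi>_def)
    then show "F z = F (\<lambda>_. 0) + (\<Sum>i<n. z i * Q i (\<Phi> z))"
      using 1 by (simp add: \<Phi>_def algebra_simps)
  qed
  have "Q i (\<Phi> (\<lambda>_. 0)) = partial0 i F" if i: "i < n" for i
  proof -
    let ?e = "\<lambda>z::cvec. (\<lambda>_. 0)(i := z 0)"
    have e: "holo 1 (\<lambda>z. ?e z j)" "?e (\<lambda>_. 0) j = 0" for j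
      by auto
    have "partial0 i F = (\<lambda>z. Q i (\<Phi> (?e z))) (\<lambda>_. 0)"
    proof (rule partial0_eqI[where Q = "\<lambda>z. Q i (\<Phi> (?e z))"])
      show "holo 1 (\<lambda>z. Q i (\<Phi> (?e z)))"
        by (rule holo_compose[OF P[OF i]]) (use e in auto)
      have "near0 1 (\<lambda>z. F (?e z) = F (\<lambda>_. 0) + (\<Sum>j<n. ?e z j * Q j (\<Phi> (?e z))))"
        by (rule near0_compose[OF exp]) (use e in auto)
      moreover have "(\<Sum>j<n. ?e z j * Q j (\<Phi> (?e z))) = z 0 * Q i (\<Phi> (?e z))" for z
      proof -
        have "(\<Sum>j<n. ?e z j * Q j (\<Phi> (?e z))) = (\<Sum>j<n. if j = i then z 0 * Q i (\<Phi> (?e z)) else 0)"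
          by (intro sum.cong) auto
        then show ?thesis using i by simp
      qed
      ultimately show "near0 1 (\<lambda>z. F (?e z) = F (\<lambda>_. 0) + z 0 * Q i (\<Phi> (?e z)))" by simp
    qed
    then show ?thesis by (simp add: fun_upd_idem)
  qed
  with P exp show thesis by (intro that)
qed

text \<open>A Taylor formula with parameters: \<open>z 0\<close>, \<open>z 1\<close> are the point
  \<open>x\<close> of the plane, \<open>z 2\<close> is the time \<open>s\<close>, \<delta> the
  velocity. The coefficients \<open>D\<close> are Hadamard quotients on the diagonal over
  \<open>(x, 0)\<close>, so one family serves all \<delta>.\<close>

lemma curve_expansion:
  assumes F: "holo (2 + \<tau>) F"
  obtains D where "\<And>i. i < 2 + \<tau> \<Longrightarrow> holo 2 (D i)"
    "\<And>\<delta>. (\<And>i. i < 2 + \<tau> \<Longrightarrow> holo 3 (\<delta> i)) \<Longrightarrow> \<exists>R. holo 3 R \<and>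
       near0 3 (\<lambda>z. F (\<lambda>i. (if i < 2 then z i else 0) + z 2 * \<delta> i z) =
         F (join z (\<lambda>_. 0)) + z 2 * (\<Sum>i<2 + \<tau>. \<delta> i (z(2 := 0)) * D i z) + z 2 ^ 2 * R z)"
proof -
  define m where "m = 2 + \<tau>"
  obtain Q where Q: "\<And>i. i < m \<Longrightarrow> holo (m + m) (Q i)"
    "near0 (m + m) (\<lambda>z. F z - F (\<lambda>i. z (m + i)) = (\<Sum>i<m. (z i - z (m + i)) * Q i z))"
    by (rule hadamard[OF F[folded m_def]], rule that)
  \<comment> \<open>The point \<open>(x, 0)\<close> written twice, once in each block of
    \<open>m\<close> coordinates.\<close>
  define \<Delta> where "\<Delta> x = (\<lambda>j. if j < m then if j < 2 then x j else 0
      else if j < m + 2 then x (j - m) else 0)" for x :: cvec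
  have D: "holo 2 (\<lambda>x. Q i (\<Delta> x))" if "i < m" for i
    by (rule holo_compose[OF Q(1)[OF that]]) (auto simp: \<Delta>_def)
  have R: "\<exists>R. holo 3 R \<and>
       near0 3 (\<lambda>z. F (\<lambda>i. (if i < 2 then z i else 0) + z 2 * \<delta> i z) =
         F (join z (\<lambda>_. 0)) + z 2 * (\<Sum>i<2 + \<tau>. \<delta> i (z(2 := 0)) * Q i (\<Delta> z)) + z 2 ^ 2 * R z)"
    if \<delta>: "\<And>i. i < m \<Longrightarrow> holo 3 (\<delta> i)" for \<delta>
  proof -
    define \<Phi> where "\<Phi> z = (\<lambda>i. (if i < 2 then z i else 0) + z 2 * \<delta> i z)" for z :: cvec
    \<comment> \<open>The first block holds the moving point, the second its starting point
      \<open>(x, 0)\<close>.\<close>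
    define \<Psi> where "\<Psi> z = (\<lambda>j. if j < m then \<Phi> z j else if j < m + 2 then z (j - m) else 0)" for z :: cvec
    have \<Phi>: "holo 3 (\<lambda>z. \<Phi> z i)" "\<Phi> (\<lambda>_. 0) i = 0" if "i < m" for i
      using \<delta> that unfolding \<Phi>_def by auto
    have \<Psi>: "holo 3 (\<lambda>z. \<Psi> z i)" "\<Psi> (\<lambda>_. 0) i = 0" for i
      using \<Phi> unfolding \<Psi>_def by auto
    define E where "E z = (\<Sum>i<m. \<delta> i z * Q i (\<Psi> z))" for z
    have "holo 3 (\<lambda>z. Q i (\<Psi> z))" if "i < m" for i
      by (rule holo_compose[OF Q(1)[OF that]]) (use \<Psi> in auto)
    then have E: "holo 3 E" unfolding E_def using \<delta> by auto
    obtain R where R: "holo 3 R" "near0 3 (\<lambda>z. E z = E (z(2 := 0)) + z 2 * R z)"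
      by (rule holo_divide[OF E, of 2], simp, rule that)
    have "\<Psi> (z(2 := 0)) = \<Delta> z" for z
      by (rule ext) (auto simp: \<Psi>_def \<Delta>_def \<Phi>_def m_def)
    then have E0: "E (z(2 := 0)) = (\<Sum>i<m. \<delta> i (z(2 := 0)) * Q i (\<Delta> z))" for z
      by (simp add: E_def)
    have 1: "near0 3 (\<lambda>z. F (\<Psi> z) - F (\<lambda>i. \<Psi> z (m + i)) = (\<Sum>i<m. (\<Psi> z i - \<Psi> z (m + i)) * Q i (\<Psi> z)))"
      by (rule near0_compose[OF Q(2)]) (use \<Psi> in auto)
    have 2: "near0 3 (\<lambda>z. \<forall>w. (\<forall>i<m. w i = \<Phi> z i) \<longrightarrow> F w = F (\<Phi> z))"
      by (rule near0_compose[OF holo_local[OF F, folded m_def]]) (use \<Phi> in auto)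
    from near0_conj[OF near0_conj[OF 1 2] R(2)]
    have "near0 3 (\<lambda>z. F (\<Phi> z) = F (join z (\<lambda>_. 0)) + z 2 * E (z(2 := 0)) + z 2 ^ 2 * R z)"
    proof (rule near0_mono, elim conjE)
      fix z assume 1: "F (\<Psi> z) - F (\<lambda>i. \<Psi> z (m + i)) = (\<Sum>i<m. (\<Psi> z i - \<Psi> z (m + i)) * Q i (\<Psi> z))"
        and 2: "\<forall>w. (\<forall>i<m. w i = \<Phi> z i) \<longrightarrow> F w = F (\<Phi> z)" and 3: "E z = E (z(2 := 0)) + z 2 * R z"
      have "F (\<Psi> z) = F (\<Phi> z)" by (rule 2[rule_format]) (simp add: \<Psi>_def)
      moreover have b: "(\<lambda>i. \<Psi> z (m + i)) = join z (\<lambda>_. 0)" by (auto simp: \<Psi>_def join_def)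
      moreover have "\<Psi> z i - \<Psi> z (m + i) = z 2 * \<delta> i z" if "i < m" for i
        using that fun_cong[OF b, of i] by (simp add: \<Psi>_def \<Phi>_def join_def)
      ultimately have "F (\<Phi> z) - F (join z (\<lambda>_. 0)) = (\<Sum>i<m. z 2 * \<delta> i z * Q i (\<Psi> z))"
        using 1 by simp
      also have "\<dots> = z 2 * E z" by (simp add: E_def sum_distrib_left mult.assoc)
      finally show "F (\<Phi> z) = F (join z (\<lambda>_. 0)) + z 2 * E (z(2 := 0)) + z 2 ^ 2 * R z"
        using 3 by (simp add: algebra_simps power2_eq_square)
    qed
    with R(1) show ?thesis unfolding \<Phi>_def E0 m_def by blast
  qed
  show thesis
    by (rule that[of "\<lambda>i x. Q i (\<Delta> x)"]) (use D R in \<open>auto simp: m_def\<close>)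
qed

subsection \<open>First order deformations\<close>

text \<open>This is the Tjurina ideal when \<open>g\<^sub>0\<close>, \<open>g\<^sub>1\<close> are
  the partial derivatives of \<open>g\<close>. They are kept as parameters because they occur both
  as \<open>D 0\<close>, \<open>D 1\<close> and as values of \<open>local_pd\<close>.\<close>

definition tjurina :: "(cvec \<Rightarrow> complex) \<Rightarrow> (cvec \<Rightarrow> complex) \<Rightarrow> (cvec \<Rightarrow> complex) \<Rightarrow> (cvec \<Rightarrow> complex) \<Rightarrow> bool" where
  "tjurina g g\<^sub>0 g\<^sub>1 h \<longleftrightarrow> (\<exists>\<alpha> \<beta>\<^sub>0 \<beta>\<^sub>1. holo 2 \<alpha> \<and> holo 2 \<beta>\<^sub>0 \<and> holo 2 \<beta>\<^sub>1 \<and>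
     near0 2 (\<lambda>x. h x = \<alpha> x * g x + \<beta>\<^sub>0 x * g\<^sub>0 x + \<beta>\<^sub>1 x * g\<^sub>1 x))"

lemma tjurinaI:
  "holo 2 \<alpha> \<Longrightarrow> holo 2 \<beta>\<^sub>0 \<Longrightarrow> holo 2 \<beta>\<^sub>1 \<Longrightarrow>
   near0 2 (\<lambda>x. h x = \<alpha> x * g x + \<beta>\<^sub>0 x * g\<^sub>0 x + \<beta>\<^sub>1 x * g\<^sub>1 x) \<Longrightarrow> tjurina g g\<^sub>0 g\<^sub>1 h"
  unfolding tjurina_def by blast

lemma tjurinaE:
  assumes "tjurina g g\<^sub>0 g\<^sub>1 h"
  obtains \<alpha> \<beta>\<^sub>0 \<beta>\<^sub>1 where "holo 2 \<alpha>" "holo 2 \<beta>\<^sub>0" "holo 2 \<beta>\<^sub>1"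
    "near0 2 (\<lambda>x. h x = \<alpha> x * g x + \<beta>\<^sub>0 x * g\<^sub>0 x + \<beta>\<^sub>1 x * g\<^sub>1 x)"
  using assms unfolding tjurina_def by blast

lemma tjurina_cong:
  assumes "tjurina g g\<^sub>0 g\<^sub>1 h" "near0 2 (\<lambda>x. g\<^sub>0' x = g\<^sub>0 x)" "near0 2 (\<lambda>x. g\<^sub>1' x = g\<^sub>1 x)" "near0 2 (\<lambda>x. h' x = h x)"
  shows "tjurina g g\<^sub>0' g\<^sub>1' h'"
proof -
  obtain \<alpha> \<beta>\<^sub>0 \<beta>\<^sub>1 where *: "holo 2 \<alpha>" "holo 2 \<beta>\<^sub>0" "holo 2 \<beta>\<^sub>1"
    "near0 2 (\<lambda>x. h x = \<alpha> x * g x + \<beta>\<^sub>0 x * g\<^sub>0 x + \<beta>\<^sub>1 x * g\<^sub>1 x)"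
    by (rule tjurinaE[OF assms(1)], rule that)
  from near0_conj[OF *(4) near0_conj[OF assms(2) near0_conj[OF assms(3,4)]]]
  have "near0 2 (\<lambda>x. h' x = \<alpha> x * g x + \<beta>\<^sub>0 x * g\<^sub>0' x + \<beta>\<^sub>1 x * g\<^sub>1' x)"
    by (rule near0_mono) simp
  with *(1-3) show ?thesis by (rule tjurinaI)
qed

lemma tjurina_add:
  assumes "tjurina g g\<^sub>0 g\<^sub>1 h" "tjurina g g\<^sub>0 g\<^sub>1 h'"
  shows "tjurina g g\<^sub>0 g\<^sub>1 (\<lambda>x. h x + h' x)"
proof -
  obtain \<alpha> \<beta>\<^sub>0 \<beta>\<^sub>1 where *: "holo 2 \<alpha>" "holo 2 \<beta>\<^sub>0" "holo 2 \<beta>\<^sub>1"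
    "near0 2 (\<lambda>x. h x = \<alpha> x * g x + \<beta>\<^sub>0 x * g\<^sub>0 x + \<beta>\<^sub>1 x * g\<^sub>1 x)"
    by (rule tjurinaE[OF assms(1)], rule that)
  obtain \<alpha>' \<beta>\<^sub>0' \<beta>\<^sub>1' where **: "holo 2 \<alpha>'" "holo 2 \<beta>\<^sub>0'" "holo 2 \<beta>\<^sub>1'"
    "near0 2 (\<lambda>x. h' x = \<alpha>' x * g x + \<beta>\<^sub>0' x * g\<^sub>0 x + \<beta>\<^sub>1' x * g\<^sub>1 x)"
    by (rule tjurinaE[OF assms(2)], rule that)
  have "near0 2 (\<lambda>x. h x + h' x = (\<alpha> x + \<alpha>' x) * g x + (\<beta>\<^sub>0 x + \<beta>\<^sub>0' x) * g\<^sub>0 x + (\<beta>\<^sub>1 x + \<beta>\<^sub>1' x) * g\<^sub>1 x)"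
    using near0_conj[OF *(4) **(4)] by (rule near0_mono) (simp add: algebra_simps)
  then show ?thesis by (rule tjurinaI[rotated 3]) (use * ** in auto)
qed

lemma tjurina_mult:
  assumes "tjurina g g\<^sub>0 g\<^sub>1 h" "holo 2 a"
  shows "tjurina g g\<^sub>0 g\<^sub>1 (\<lambda>x. a x * h x)"
proof -
  obtain \<alpha> \<beta>\<^sub>0 \<beta>\<^sub>1 where *: "holo 2 \<alpha>" "holo 2 \<beta>\<^sub>0" "holo 2 \<beta>\<^sub>1"
    "near0 2 (\<lambda>x. h x = \<alpha> x * g x + \<beta>\<^sub>0 x * g\<^sub>0 x + \<beta>\<^sub>1 x * g\<^sub>1 x)"
    by (rule tjurinaE[OF assms(1)], rule that)
  have "near0 2 (\<lambda>x. a x * h x = (a x * \<alpha> x) * g x + (a x * \<beta>\<^sub>0 x) * g\<^sub>0 x + (a x * \<beta>\<^sub>1 x) * g\<^sub>1 x)"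
    using *(4) by (rule near0_mono) (simp add: algebra_simps)
  then show ?thesis by (rule tjurinaI[rotated 3]) (use * assms(2) in auto)
qed

lemma tjurina_0: "tjurina g g\<^sub>0 g\<^sub>1 (\<lambda>_. 0)"
  by (rule tjurinaI[of "\<lambda>_. 0" "\<lambda>_. 0" "\<lambda>_. 0"]) (auto intro: near0_True)

lemma tjurina_sum:
  "(\<And>a. a \<in> A \<Longrightarrow> tjurina g g\<^sub>0 g\<^sub>1 (h a)) \<Longrightarrow> tjurina g g\<^sub>0 g\<^sub>1 (\<lambda>x. \<Sum>a\<in>A. h a x)"
  by (induction A rule: infinite_finite_induct) (auto intro: tjurina_0 tjurina_add)

lemma tjurina_gens:
  "tjurina g g\<^sub>0 g\<^sub>1 g" "tjurina g g\<^sub>0 g\<^sub>1 g\<^sub>0" "tjurina g g\<^sub>0 g\<^sub>1 g\<^sub>1"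
  by (rule tjurinaI[of "\<lambda>_. 1" "\<lambda>_. 0" "\<lambda>_. 0"] tjurinaI[of "\<lambda>_. 0" "\<lambda>_. 1" "\<lambda>_. 0"]
        tjurinaI[of "\<lambda>_. 0" "\<lambda>_. 0" "\<lambda>_. 1"]; auto intro: near0_True)+

section \<open>Curves in the base of a deformation and the Kodaira-Spencer map\<close>

lemma sum_lessThan_2_add: "(\<Sum>i<2 + \<tau>. f i) = f 0 + f 1 + (\<Sum>l<(\<tau>::nat). f (2 + l) :: complex)"
proof -
  have "(\<Sum>i<Suc (Suc \<tau>). f i) = f 0 + (f (Suc 0) + (\<Sum>l<\<tau>. f (Suc (Suc l))))"
    by (simp only: sum.lessThan_Suc_shift)
  then show ?thesis by (simp add: add.assoc)
qed

lemma join_simps [simp]: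
  "join (join x s) t = join x t" "param (join x t) = t" "join (z(2 := a)) t = join z t"
  by (auto simp: join_def param_def)

lemma join_ge: "\<not> i < 2 \<Longrightarrow> join x t i = t (i - 2)"
  by (simp add: join_def)

lemma holo_join:
  "(\<And>i. i < 2 \<Longrightarrow> holo n (\<lambda>z. x z i)) \<Longrightarrow> (\<And>i. i < k \<Longrightarrow> holo n (\<lambda>z. t z i)) \<Longrightarrow> i < 2 + k \<Longrightarrow>
   holo n (\<lambda>z. join (x z) (t z) i)"
  by (auto simp: join_def)

lemma holo_agree:
  assumes "holo n F" "\<And>z i. i < n \<Longrightarrow> \<Phi> z i = z i" shows "near0 n (\<lambda>z. F (\<Phi> z) = F z)"
  using holo_local[OF assms(1)]
proof (rule near0_mono)
  fix z assume *: "\<forall>w. (\<forall>i<n. w i = z i) \<longrightarrow> F w = F z"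
  show "F (\<Phi> z) = F z" by (rule *[rule_format]) (rule assms(2))
qed

lemma holo2_local3: "holo 2 h \<Longrightarrow> near0 3 (\<lambda>z. h (z(2 := a)) = h z)"
  by (rule near0_weaken[OF holo_agree]) auto

lemma near0_3_at_0: "near0 3 P \<Longrightarrow> near0 2 (\<lambda>x. P (x(2 := 0)))"
  by (rule near0_compose) auto

text \<open>The data of \<open>curve_expansion\<close>: \<open>D\<close> are the partial derivatives of \<open>F\<close> along \<open>t = 0\<close>.\<close>

definition first_order :: "nat \<Rightarrow> (cvec \<Rightarrow> complex) \<Rightarrow> (nat \<Rightarrow> cvec \<Rightarrow> complex) \<Rightarrow> bool" where
  "first_order \<tau> F D \<longleftrightarrow> (\<forall>i<2 + \<tau>. holo 2 (D i)) \<and>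
    (\<forall>\<delta>. (\<forall>i<2 + \<tau>. holo 3 (\<delta> i)) \<longrightarrow> (\<exists>R. holo 3 R \<and>
       near0 3 (\<lambda>z. F (\<lambda>i. (if i < 2 then z i else 0) + z 2 * \<delta> i z) =
         F (join z (\<lambda>_. 0)) + z 2 * (\<Sum>i<2 + \<tau>. \<delta> i (z(2 := 0)) * D i z) + z 2 ^ 2 * R z)))"

lemma first_order_exists: "holo (2 + \<tau>) F \<Longrightarrow> \<exists>D. first_order \<tau> F D"
  unfolding first_order_def by (rule curve_expansion[of \<tau> F], assumption) blast

lemma first_orderE:
  assumes "first_order \<tau> F D" "\<And>i. i < 2 + \<tau> \<Longrightarrow> holo 3 (\<delta> i)"
  obtains R where "holo 3 R"
    "near0 3 (\<lambda>z. F (\<lambda>i. (if i < 2 then z i else 0) + z 2 * \<delta> i z) =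
       F (join z (\<lambda>_. 0)) + z 2 * (\<Sum>i<2 + \<tau>. \<delta> i (z(2 := 0)) * D i z) + z 2 ^ 2 * R z)"
  using assms unfolding first_order_def by blast

lemma first_order_holo: "first_order \<tau> F D \<Longrightarrow> i < 2 + \<tau> \<Longrightarrow> holo 2 (D i)"
  unfolding first_order_def by blast

text \<open>Put \<open>t = s v\<close> into \<open>G = u * F(\<Psi>, \<phi>)\<close> and compare the
  terms linear in \<open>s\<close>: the unit contributes a multiple of \<open>g\<close>, the
  coordinate change multiples of \<open>D 0\<close> and \<open>D 1\<close>, and the base map its
  derivative along \<open>v\<close> times the \<open>D (2 + l)\<close>.\<close>

lemma kodaira_spencer:
  assumes F: "holo (2 + \<tau>) F" and D: "first_order \<tau> F D"
    and F0: "near0 2 (\<lambda>x. F (join x (\<lambda>_. 0)) = g x)"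
    and ind: "induced_by k G \<tau> F \<phi>"
    and g: "holo 2 g" and h: "holo 2 h"
    and G: "near0 3 (\<lambda>z. G (join z (\<lambda>i. z 2 * v i)) = g z + z 2 * h z)"
  shows "tjurina g (D 0) (D 1) (\<lambda>x. h x - (\<Sum>l<\<tau>. (\<Sum>i<k. v i * partial0 i (\<lambda>t. \<phi> t l)) * D (2 + l) x))"
proof -
  obtain \<Psi> u where \<phi>: "\<And>l. l < \<tau> \<Longrightarrow> holo k (\<lambda>t. \<phi> t l)" "\<And>l. l < \<tau> \<Longrightarrow> \<phi> (\<lambda>_. 0) l = 0"
    and \<Psi>: "\<And>i. i < 2 \<Longrightarrow> holo (2 + k) (\<lambda>z. \<Psi> z i)" and u: "holo (2 + k) u"
    and id: "near0 2 (\<lambda>x. u (join x (\<lambda>_. 0)) = 1 \<and> (\<forall>i<2. \<Psi> (join x (\<lambda>_. 0)) i = x i))"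
    and eq: "near0 (2 + k) (\<lambda>z. G z = u z * F (join (\<Psi> z) (\<phi> (param z))))"
    using ind unfolding induced_by_def by blast
  \<comment> \<open>The line \<open>s v\<close> in the base over the point \<open>x\<close>, with
    \<open>s = z 2\<close>.\<close>
  define J where "J z = join z (\<lambda>i. z 2 * v i)" for z :: cvec
  have J: "holo 3 (\<lambda>z. J z i)" "J (\<lambda>_. 0) i = 0" if "i < 2 + k" for i
    using that by (auto simp: J_def join_def)
  have J0: "J (z(2 := 0)) = join z (\<lambda>_. 0)" for z
    by (simp add: J_def)
  have U: "holo 3 (\<lambda>z. u (J z))" by (rule holo_compose[OF u]) (use J in auto)
  obtain u1 where u1: "holo 3 u1" "near0 3 (\<lambda>z. u (J z) = u (J (z(2 := 0))) + z 2 * u1 z)"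
    by (rule holo_divide[OF U, of 2], simp, rule that)
  have "\<exists>\<psi>. holo 3 \<psi> \<and> near0 3 (\<lambda>z. \<Psi> (J z) i = \<Psi> (J (z(2 := 0))) i + z 2 * \<psi> z)" if i: "i < 2" for i
  proof -
    have "holo 3 (\<lambda>z. \<Psi> (J z) i)" by (rule holo_compose[OF \<Psi>[OF i]]) (use J in auto)
    then show ?thesis by (rule holo_divide[of 3 _ 2]) (simp, blast)
  qed
  then have "\<forall>i\<in>{..<2}. \<exists>\<psi>. holo 3 \<psi> \<and> near0 3 (\<lambda>z. \<Psi> (J z) i = \<Psi> (J (z(2 := 0))) i + z 2 * \<psi> z)" by simp
  from bchoice[OF this] obtain \<psi> where "\<forall>i\<in>{..<2}. holo 3 (\<psi> i) \<and>
      near0 3 (\<lambda>z. \<Psi> (J z) i = \<Psi> (J (z(2 := 0))) i + z 2 * \<psi> i z)" ..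
  then have \<psi>: "\<And>i. i < 2 \<Longrightarrow> holo 3 (\<psi> i)"
    "\<And>i. i < 2 \<Longrightarrow> near0 3 (\<lambda>z. \<Psi> (J z) i = \<Psi> (J (z(2 := 0))) i + z 2 * \<psi> i z)" by simp_all
  define pd\<phi> where "pd\<phi> l i = partial0 i (\<lambda>t. \<phi> t l)" for l i
  have "\<exists>P. (\<forall>i<k. holo k (P i) \<and> P i (\<lambda>_. 0) = pd\<phi> l i) \<and> near0 k (\<lambda>t. \<phi> t l = (\<Sum>i<k. t i * P i t))"
    if l: "l < \<tau>" for l
  proof (rule holo_expand_at_0[OF \<phi>(1)[OF l]])
    fix P assume "\<And>i. i < k \<Longrightarrow> holo k (P i)" "\<And>i. i < k \<Longrightarrow> P i (\<lambda>_. 0) = partial0 i (\<lambda>t. \<phi> t l)"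
      "near0 k (\<lambda>t. \<phi> t l = \<phi> (\<lambda>_. 0) l + (\<Sum>i<k. t i * P i t))"
    then show ?thesis using \<phi>(2)[OF l] by (intro exI[of _ P]) (simp add: pd\<phi>_def)
  qed
  then have "\<forall>l\<in>{..<\<tau>}. \<exists>P. (\<forall>i<k. holo k (P i) \<and> P i (\<lambda>_. 0) = pd\<phi> l i) \<and> near0 k (\<lambda>t. \<phi> t l = (\<Sum>i<k. t i * P i t))"
    by simp
  from bchoice[OF this] obtain P where "\<forall>l\<in>{..<\<tau>}. (\<forall>i<k. holo k (P l i) \<and> P l i (\<lambda>_. 0) = pd\<phi> l i) \<and>
      near0 k (\<lambda>t. \<phi> t l = (\<Sum>i<k. t i * P l i t))" ..
  then have P: "\<And>l i. l < \<tau> \<Longrightarrow> i < k \<Longrightarrow> holo k (P l i)" "\<And>l i. l < \<tau> \<Longrightarrow> i < k \<Longrightarrow> P l i (\<lambda>_. 0) = pd\<phi> l i"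
    "\<And>l. l < \<tau> \<Longrightarrow> near0 k (\<lambda>t. \<phi> t l = (\<Sum>i<k. t i * P l i t))" by simp_all
  \<comment> \<open>The base map along this line divided by \<open>s\<close>; the value at
    \<open>s = 0\<close> is the directional derivative in the claim.\<close>
  define w where "w l z = (\<Sum>i<k. v i * P l i (\<lambda>i. z 2 * v i))" for l and z :: cvec
  have hw: "holo 3 (w l)" if "l < \<tau>" for l
  proof -
    have "holo 3 (\<lambda>z. P l i (\<lambda>i. z 2 * v i))" if i: "i < k" for i
      by (rule holo_compose[OF P(1)[OF \<open>l < \<tau>\<close> i]]) auto
    then show ?thesis unfolding w_def[abs_def] by auto
  qed
  have \<phi>w: "near0 3 (\<lambda>z. \<phi> (\<lambda>i. z 2 * v i) l = z 2 * w l z)" if l: "l < \<tau>" for l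
  proof -
    have "near0 3 (\<lambda>z. \<phi> (\<lambda>i. z 2 * v i) l = (\<Sum>i<k. (z 2 * v i) * P l i (\<lambda>i. z 2 * v i)))"
      by (rule near0_compose[OF P(3)[OF l]]) auto
    then show ?thesis by (simp add: w_def sum_distrib_left mult.assoc)
  qed
  define \<delta> where "\<delta> i z = (if i < 2 then \<psi> i z else w (i - 2) z)" for i z
  have \<delta>: "holo 3 (\<delta> i)" if "i < 2 + \<tau>" for i
    using that \<psi>(1) hw[of "i - 2"] unfolding \<delta>_def[abs_def] by (cases "i < 2") auto
  define \<Phi> where "\<Phi> z = (\<lambda>i. (if i < 2 then z i else 0) + z 2 * \<delta> i z)" for z :: cvec
  obtain R where R: "holo 3 R"
    "near0 3 (\<lambda>z. F (\<Phi> z) = F (join z (\<lambda>_. 0)) + z 2 * (\<Sum>i<2 + \<tau>. \<delta> i (z(2 := 0)) * D i z) + z 2 ^ 2 * R z)"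
    by (rule first_orderE[where \<delta> = \<delta>, OF D \<delta>, folded \<Phi>_def], assumption, rule that)
  define S where "S z = (\<Sum>i<2 + \<tau>. \<delta> i (z(2 := 0)) * D i z)" for z
  have D3: "holo 3 (D i)" if "i < 2 + \<tau>" for i
    using first_order_holo[OF D that] by (rule holo_weaken) simp
  have at0: "holo 3 (\<lambda>z. H (z(2 := 0)))" if "holo 3 H" for H
    by (rule holo_compose[OF that]) auto
  have S: "holo 3 S" unfolding S_def[abs_def] using D3 at0[OF \<delta>] by auto
  \<comment> \<open>The terms without \<open>s\<close> on both sides of the isomorphism agree, and
    \<open>A\<close> is the remaining difference divided by \<open>s\<close>. The factor
    \<open>s\<close> has to be cancelled before \<open>s = 0\<close> is inserted.\<close>
  define A where "A z = h z - (u1 z * g z + (1 + z 2 * u1 z) * (S z + z 2 * R z))" for z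
  have holoA: "holo 3 A" unfolding A_def[abs_def]
    using u1(1) S R(1) holo_weaken[OF g, of 3] holo_weaken[OF h, of 3] by auto
  have "near0 3 (\<lambda>z. z 2 * A z = 0)"
  proof -
    have e1: "near0 3 (\<lambda>z. G (J z) = u (J z) * F (join (\<Psi> (J z)) (\<phi> (param (J z)))))"
      by (rule near0_compose[OF eq]) (use J in auto)
    have e2: "near0 3 (\<lambda>z. u (join z (\<lambda>_. 0)) = 1 \<and> (\<forall>i<2. \<Psi> (join z (\<lambda>_. 0)) i = z i))"
      using id by (rule near0_weaken) simp
    have e3: "near0 3 (\<lambda>z. \<forall>i<2. \<Psi> (J z) i = \<Psi> (J (z(2 := 0))) i + z 2 * \<psi> i z)"
      by (rule near0_all) (rule \<psi>(2))
    have e4: "near0 3 (\<lambda>z. \<forall>l<\<tau>. \<phi> (\<lambda>i. z 2 * v i) l = z 2 * w l z)"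
      by (rule near0_all) (rule \<phi>w)
    have e5: "near0 3 (\<lambda>z. \<forall>y. (\<forall>i<2 + \<tau>. y i = \<Phi> z i) \<longrightarrow> F y = F (\<Phi> z))"
      by (rule near0_compose[OF holo_local[OF F]]) (use \<delta> in \<open>auto simp: \<Phi>_def\<close>)
    have e6: "near0 3 (\<lambda>z. F (join z (\<lambda>_. 0)) = g z)" using F0 by (rule near0_weaken) simp
    show ?thesis
      using near0_conj[OF near0_conj[OF near0_conj[OF e1 e2] near0_conj[OF e3 e4]]
          near0_conj[OF near0_conj[OF e5 e6] near0_conj[OF G near0_conj[OF u1(2) R(2)]]]]
    proof (rule near0_mono, elim conjE)
      fix z
      assume 1: "G (J z) = u (J z) * F (join (\<Psi> (J z)) (\<phi> (param (J z))))"
        and 2: "u (join z (\<lambda>_. 0)) = 1" "\<forall>i<2. \<Psi> (join z (\<lambda>_. 0)) i = z i"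
        and 3: "\<forall>i<2. \<Psi> (J z) i = \<Psi> (J (z(2 := 0))) i + z 2 * \<psi> i z"
        and 4: "\<forall>l<\<tau>. \<phi> (\<lambda>i. z 2 * v i) l = z 2 * w l z"
        and 5: "\<forall>y. (\<forall>i<2 + \<tau>. y i = \<Phi> z i) \<longrightarrow> F y = F (\<Phi> z)"
        and 6: "F (join z (\<lambda>_. 0)) = g z"
        and 7: "G (join z (\<lambda>i. z 2 * v i)) = g z + z 2 * h z"
        and 8: "u (J z) = u (J (z(2 := 0))) + z 2 * u1 z"
        and 9: "F (\<Phi> z) = F (join z (\<lambda>_. 0)) + z 2 * (\<Sum>i<2 + \<tau>. \<delta> i (z(2 := 0)) * D i z) + z 2 ^ 2 * R z"
      have "F (join (\<Psi> (J z)) (\<phi> (param (J z)))) = F (\<Phi> z)"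
      proof (rule 5[rule_format])
        fix i assume i: "i < 2 + \<tau>"
        show "join (\<Psi> (J z)) (\<phi> (param (J z))) i = \<Phi> z i"
        proof (cases "i < 2")
          case True
          then show ?thesis using 3 2(2) by (simp add: join_def[of "\<Psi> (J z)"] \<Phi>_def \<delta>_def J0)
        next
          case False
          then have "i - 2 < \<tau>" using i by simp
          then show ?thesis using False 4 by (simp add: join_ge \<Phi>_def \<delta>_def J_def)
        qed
      qed
      then have "g z + z 2 * h z = (1 + z 2 * u1 z) * (g z + z 2 * S z + z 2 ^ 2 * R z)"
        using 1 2(1) 6 7 8 9 by (simp add: J0 S_def J_def)
      then show "z 2 * A z = 0" by (simp add: A_def algebra_simps power2_eq_square)
    qed
  qed
  then have "near0 3 (\<lambda>z. A z = 0)" by (intro holo_cancel[OF holoA, of 2]) auto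
  then have A0: "near0 2 (\<lambda>x. A (x(2 := 0)) = 0)" by (rule near0_3_at_0)
  have loc: "near0 2 (\<lambda>x. h (x(2 := 0)) = h x)" if "holo 2 h" for h
    by (rule holo_agree[OF that]) simp
  have locD: "near0 2 (\<lambda>x. \<forall>i<2 + \<tau>. D i (x(2 := 0)) = D i x)"
    by (rule near0_all) (intro loc first_order_holo[OF D])
  have "near0 2 (\<lambda>x. h x - (\<Sum>l<\<tau>. (\<Sum>i<k. v i * pd\<phi> l i) * D (2 + l) x) =
      u1 (x(2 := 0)) * g x + \<psi> 0 (x(2 := 0)) * D 0 x + \<psi> 1 (x(2 := 0)) * D 1 x)"
    using near0_conj[OF A0 near0_conj[OF locD near0_conj[OF loc[OF g] loc[OF h]]]]
  proof (rule near0_mono, elim conjE)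
    fix x assume 1: "A (x(2 := 0)) = 0" and 2: "\<forall>i<2 + \<tau>. D i (x(2 := 0)) = D i x"
      and 3: "g (x(2 := 0)) = g x" and 4: "h (x(2 := 0)) = h x"
    have "w l (x(2 := 0)) = (\<Sum>i<k. v i * pd\<phi> l i)" if "l < \<tau>" for l
      using P(2)[OF that] by (simp add: w_def)
    then have "S (x(2 := 0)) = \<psi> 0 (x(2 := 0)) * D 0 x + \<psi> 1 (x(2 := 0)) * D 1 x +
        (\<Sum>l<\<tau>. (\<Sum>i<k. v i * pd\<phi> l i) * D (2 + l) x)"
      unfolding S_def sum_lessThan_2_add using 2 by (simp add: \<delta>_def)
    then show "h x - (\<Sum>l<\<tau>. (\<Sum>i<k. v i * pd\<phi> l i) * D (2 + l) x) =
      u1 (x(2 := 0)) * g x + \<psi> 0 (x(2 := 0)) * D 0 x + \<psi> 1 (x(2 := 0)) * D 1 x"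
      using 1 3 4 by (simp add: A_def algebra_simps)
  qed
  moreover have "holo 2 (\<lambda>x. H (x(2 := 0)))" if "holo 3 H" for H
    by (rule holo_compose[OF that]) auto
  ultimately show ?thesis unfolding pd\<phi>_def by (rule_tac tjurinaI[rotated 3]) (use u1(1) \<psi>(1) in auto)
qed

section \<open>Base change of deformations and consequences of the unique differential\<close>

lemma induced_by_cong:
  "induced_by k G \<tau> F \<phi> \<Longrightarrow> near0 (2 + k) (\<lambda>z. G' z = G z) \<Longrightarrow> induced_by k G' \<tau> F \<phi>"
  unfolding induced_by_def
proof (elim conjE exE, intro conjI exI, assumption, assumption, assumption, assumption)
  fix \<Psi> u
  assume "near0 (2 + k) (\<lambda>z. G z = u z * F (join (\<Psi> z) (\<phi> (param z))))" "near0 (2 + k) (\<lambda>z. G' z = G z)"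
  then have "near0 (2 + k) (\<lambda>z. G z = u z * F (join (\<Psi> z) (\<phi> (param z))) \<and> G' z = G z)"
    by (rule near0_conj)
  then show "near0 (2 + k) (\<lambda>z. G' z = u z * F (join (\<Psi> z) (\<phi> (param z))))"
    by (rule near0_mono) simp
qed

lemma induced_by_pullback:
  assumes ind: "induced_by k G \<tau> F \<phi>"
    and \<theta>: "\<And>i. i < k \<Longrightarrow> holo k' (\<lambda>t. \<theta> t i)" "\<theta> (\<lambda>_. 0) = (\<lambda>_. 0)"
  shows "induced_by k' (\<lambda>z. G (join z (\<theta> (param z)))) \<tau> F (\<lambda>t. \<phi> (\<theta> t))"
proof -
  obtain \<Psi> u where \<phi>: "\<And>l. l < \<tau> \<Longrightarrow> holo k (\<lambda>t. \<phi> t l)" "\<And>l. l < \<tau> \<Longrightarrow> \<phi> (\<lambda>_. 0) l = 0"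
    and \<Psi>: "\<And>i. i < 2 \<Longrightarrow> holo (2 + k) (\<lambda>z. \<Psi> z i)" and u: "holo (2 + k) u"
    and id: "near0 2 (\<lambda>x. u (join x (\<lambda>_. 0)) = 1 \<and> (\<forall>i<2. \<Psi> (join x (\<lambda>_. 0)) i = x i))"
    and eq: "near0 (2 + k) (\<lambda>z. G z = u z * F (join (\<Psi> z) (\<phi> (param z))))"
    using ind unfolding induced_by_def by blast
  define J where "J z = join z (\<theta> (param z))" for z
  have p0: "param (\<lambda>_. 0) = (\<lambda>_. 0)" by (simp add: param_def)
  have th: "holo (2 + k') (\<lambda>z. \<theta> (param z) i)" if "i < k" for i
    by (rule holo_compose[OF \<theta>(1)[OF that]]) (auto simp: param_def)
  have J: "holo (2 + k') (\<lambda>z. J z i)" "J (\<lambda>_. 0) i = 0" if "i < 2 + k" for i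
    unfolding J_def by (rule holo_join[OF _ th that]) (auto simp: p0 \<theta>(2) join_def)
  have J0: "J (join x (\<lambda>_. 0)) = join x (\<lambda>_. 0)" for x
    by (simp add: J_def \<theta>(2))
  show ?thesis
    unfolding induced_by_def J_def[symmetric]
  proof (intro conjI exI allI impI)
    show "holo k' (\<lambda>t. \<phi> (\<theta> t) i)" if "i < \<tau>" for i
      by (rule holo_compose[OF \<phi>(1)[OF that]]) (use \<theta> in auto)
    show "\<phi> (\<theta> (\<lambda>_. 0)) i = 0" if "i < \<tau>" for i using \<phi>(2)[OF that] by (simp add: \<theta>(2))
    show "holo (2 + k') (\<lambda>z. \<Psi> (J z) i)" if "i < 2" for i
      by (rule holo_compose[OF \<Psi>[OF that]]) (use J in auto)
    show "holo (2 + k') (\<lambda>z. u (J z))"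
      by (rule holo_compose[OF u]) (use J in auto)
    show "near0 2 (\<lambda>x. u (J (join x (\<lambda>_. 0))) = 1 \<and> (\<forall>i<2. \<Psi> (J (join x (\<lambda>_. 0))) i = x i))"
      unfolding J0 by (rule id)
    have "near0 (2 + k') (\<lambda>z. G (J z) = u (J z) * F (join (\<Psi> (J z)) (\<phi> (param (J z)))))"
      by (rule near0_compose[OF eq]) (use J in auto)
    then show "near0 (2 + k') (\<lambda>z. G (J z) = u (J z) * F (join (\<Psi> (J z)) (\<phi> (\<theta> (param z)))))"
      by (simp add: J_def)
  qed
qed

lemma partial0_1:
  assumes Q: "holo 1 Q" and F: "near0 1 (\<lambda>t. F t = t 0 * Q t)"
  shows "partial0 0 F = Q (\<lambda>_. 0)"
proof (rule partial0_eqI[OF Q])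
  let ?e = "\<lambda>z::cvec. (\<lambda>_. 0)(0 := z 0) :: cvec"
  have 1: "near0 1 (\<lambda>z. F (?e z) = ?e z 0 * Q (?e z))"
    by (rule near0_compose[where \<Phi> = ?e, OF F]) auto
  have 2: "near0 1 (\<lambda>z. Q (?e z) = Q z)"
    by (rule holo_agree[OF Q]) simp
  have "F (\<lambda>_. 0) = 0" using near0_at_0[OF F, of "\<lambda>_. 0"] by simp
  with near0_conj[OF 1 2] show "near0 1 (\<lambda>z. F (?e z) = F (\<lambda>_. 0) + z 0 * Q z)"
    by (elim near0_mono) simp
qed

text \<open>The partial derivatives of a miniversal deformation along the base are linearly independent
  modulo the Tjurina ideal: a relation with coefficients \<open>w\<close> produces a one-parameter deformation
  \<open>g + s\<^sup>2 K\<close> induced by \<open>s \<mapsto> s w\<close>. It is also the pull-back under \<open>s \<mapsto> (s\<^sup>2, s)\<close> of the deformation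
  \<open>g + r K(x, s)\<close>, which is trivial on \<open>r = 0\<close>; hence it is induced by a map with zero derivative.\<close>

lemma miniversal_independent:
  assumes mini: "miniversal g \<tau> F" and D: "first_order \<tau> F D"
    and rel: "tjurina g (D 0) (D 1) (\<lambda>x. \<Sum>l<\<tau>. w l * D (2 + l) x)" and l: "l < \<tau>"
  shows "w l = 0"
proof -
  have F: "holo (2 + \<tau>) F" and F0: "near0 2 (\<lambda>x. F (join x (\<lambda>_. 0)) = g x)"
    using mini[unfolded miniversal_def, THEN conjunct1] unfolding deformation_def by blast+
  note versal = mini[unfolded miniversal_def, THEN conjunct2, THEN conjunct1, rule_format]
  note unique = mini[unfolded miniversal_def, THEN conjunct2, THEN conjunct2, rule_format,
      OF conjI, OF _ conjI]
  have "holo 2 (\<lambda>x. F (join x (\<lambda>_. 0)))"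
    by (rule holo_compose[OF F]) (auto simp: join_def)
  then have g: "holo 2 g" by (rule holo_cong) (use F0 in \<open>simp add: eq_commute\<close>)
  obtain \<alpha> \<beta>\<^sub>0 \<beta>\<^sub>1 where ab: "holo 2 \<alpha>" "holo 2 \<beta>\<^sub>0" "holo 2 \<beta>\<^sub>1"
    "near0 2 (\<lambda>x. (\<Sum>l<\<tau>. w l * D (2 + l) x) = \<alpha> x * g x + \<beta>\<^sub>0 x * D 0 x + \<beta>\<^sub>1 x * D 1 x)"
    by (rule tjurinaE[OF rel], rule that)
  define \<beta> where "\<beta> i = (if i = (0::nat) then \<beta>\<^sub>0 else \<beta>\<^sub>1)" for i
  have \<beta>: "holo 2 (\<beta> i)" for i using ab by (simp add: \<beta>_def)
  have w3: "holo 3 f" if "holo 2 f" for f using that by (rule holo_weaken) simp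
  \<comment> \<open>The velocity \<open>- \<beta>\<close> in the plane removes \<open>D 0\<close>
    and \<open>D 1\<close> from the given relation, so that the first order term along
    \<open>s w\<close> becomes \<open>\<alpha> * g\<close>.\<close>
  define \<delta> where "\<delta> i z = (if i < 2 then - \<beta> i z else w (i - 2))" for i z
  have \<delta>: "holo 3 (\<delta> i)" if "i < 2 + \<tau>" for i
    unfolding \<delta>_def[abs_def] using w3[OF \<beta>] by auto
  define \<Phi> where "\<Phi> z = (\<lambda>i. (if i < 2 then z i else 0) + z 2 * \<delta> i z)" for z :: cvec
  obtain R where R: "holo 3 R"
    "near0 3 (\<lambda>z. F (\<Phi> z) = F (join z (\<lambda>_. 0)) + z 2 * (\<Sum>i<2 + \<tau>. \<delta> i (z(2 := 0)) * D i z) + z 2 ^ 2 * R z)"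
    by (rule first_orderE[where \<delta> = \<delta>, OF D \<delta>, folded \<Phi>_def], assumption, rule that)
  \<comment> \<open>Chosen so that
    \<open>(1 - s \<alpha>)(g + s \<alpha> g + s^2 R) = g + s^2 K\<close>: the unit
    \<open>1 - s \<alpha>\<close> cancels the first order term.\<close>
  define K where "K z = (1 - z 2 * \<alpha> z) * R z - \<alpha> z ^ 2 * g z" for z
  define Gt where "Gt z = (1 - z 2 * \<alpha> z) * F (\<Phi> z)" for z
  have \<Phi>: "holo 3 (\<lambda>z. \<Phi> z i)" "\<Phi> (\<lambda>_. 0) i = 0" if "i < 2 + \<tau>" for i
    using \<delta>[OF that] unfolding \<Phi>_def by auto
  have holoF\<Phi>: "holo 3 (\<lambda>z. F (\<Phi> z))" by (rule holo_compose[OF F]) (use \<Phi> in auto)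
  have K: "holo 3 K" unfolding K_def[abs_def] using R(1) w3[OF ab(1)] w3[OF g] by auto
  have Gt: "holo 3 Gt" unfolding Gt_def[abs_def] using holoF\<Phi> w3[OF ab(1)] by auto
  have GtK: "near0 3 (\<lambda>z. Gt z = g z + z 2 ^ 2 * K z)"
  proof -
    have e1: "near0 3 (\<lambda>z. (\<Sum>l<\<tau>. w l * D (2 + l) z) = \<alpha> z * g z + \<beta>\<^sub>0 z * D 0 z + \<beta>\<^sub>1 z * D 1 z)"
      using ab(4) by (rule near0_weaken) simp
    have e2: "near0 3 (\<lambda>z. F (join z (\<lambda>_. 0)) = g z)" using F0 by (rule near0_weaken) simp
    show ?thesis
      using near0_conj[OF near0_conj[OF e1 e2] near0_conj[OF R(2) near0_conj[OF holo2_local3[OF ab(2), of 0] holo2_local3[OF ab(3), of 0]]]]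
    proof (rule near0_mono, elim conjE)
      fix z
      assume 1: "(\<Sum>l<\<tau>. w l * D (2 + l) z) = \<alpha> z * g z + \<beta>\<^sub>0 z * D 0 z + \<beta>\<^sub>1 z * D 1 z"
        and 2: "F (join z (\<lambda>_. 0)) = g z"
        and 3: "F (\<Phi> z) = F (join z (\<lambda>_. 0)) + z 2 * (\<Sum>i<2 + \<tau>. \<delta> i (z(2 := 0)) * D i z) + z 2 ^ 2 * R z"
        and 4: "\<beta>\<^sub>0 (z(2 := 0)) = \<beta>\<^sub>0 z" "\<beta>\<^sub>1 (z(2 := 0)) = \<beta>\<^sub>1 z"
      have "(\<Sum>i<2 + \<tau>. \<delta> i (z(2 := 0)) * D i z) = \<alpha> z * g z"
        unfolding sum_lessThan_2_add using 1 4 by (simp add: \<delta>_def \<beta>_def)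
      then have "F (\<Phi> z) = g z + z 2 * (\<alpha> z * g z) + z 2 ^ 2 * R z" using 2 3 by simp
      then show "Gt z = g z + z 2 ^ 2 * K z"
        by (simp add: Gt_def K_def algebra_simps power2_eq_square)
    qed
  qed
  have "induced_by 1 Gt \<tau> F (\<lambda>t l. t 0 * w l)"
    unfolding induced_by_def
  proof (intro conjI allI impI exI)
    show "holo (2 + 1) (\<lambda>z. (\<lambda>i. z i + z 2 * - \<beta> i z) i)" if "i < 2" for i
      using that w3[OF \<beta>] by auto
    show "holo (2 + 1) (\<lambda>z. 1 - z 2 * \<alpha> z)" using w3[OF ab(1)] by auto
    show "near0 2 (\<lambda>x. 1 - join x (\<lambda>_. 0) 2 * \<alpha> (join x (\<lambda>_. 0)) = 1 \<and>
        (\<forall>i<2. join x (\<lambda>_. 0) i + join x (\<lambda>_. 0) 2 * - \<beta> i (join x (\<lambda>_. 0)) = x i))"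
      by (rule near0_True) (simp add: join_def)
    have "join (\<lambda>i. z i + z 2 * - \<beta> i z) (\<lambda>l. param z 0 * w l) = \<Phi> z" for z
      by (rule ext) (auto simp: join_def param_def \<Phi>_def \<delta>_def numeral_2_eq_2)
    then show "near0 (2 + 1) (\<lambda>z. Gt z = (1 - z 2 * \<alpha> z) *
        F (join (\<lambda>i. z i + z 2 * - \<beta> i z) (\<lambda>l. param z 0 * w l)))"
      by (simp add: Gt_def near0_True)
  qed auto
  \<comment> \<open>Coordinate 2 is the parameter \<open>r\<close>, coordinate 3 the parameter
    \<open>s\<close> on which \<open>K\<close> depends.\<close>
  moreover define H where "H z = g z + z 2 * K (\<lambda>i. if i = 2 then z 3 else z i)" for z :: cvec
  have Kr: "holo 4 (\<lambda>z. K (\<lambda>i. if i = 2 then z 3 else z i))" by (rule holo_compose[OF K]) auto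
  have "holo 4 H" unfolding H_def[abs_def] using Kr holo_weaken[OF g, of 4] by auto
  moreover have gj: "near0 2 (\<lambda>x. g (join x (\<lambda>_. 0)) = g x)"
    by (rule holo_agree[OF g]) (simp add: join_def)
  then have "near0 2 (\<lambda>x. H (join x (\<lambda>_. 0)) = g x)"
    by (rule near0_mono) (simp add: H_def join_def)
  ultimately have defH: "deformation g 2 H" by (simp add: deformation_def)
  obtain \<phi> where \<phi>: "induced_by 2 H \<tau> F \<phi>" using versal[OF defH] by blast
  have \<phi>l: "holo 2 (\<lambda>t. \<phi> t l)" "\<phi> (\<lambda>_. 0) l = 0" using \<phi> l by (auto simp: induced_by_def)
  obtain P where P: "\<And>i. i < 2 \<Longrightarrow> holo 2 (P i)" "near0 2 (\<lambda>t. \<phi> t l = (\<Sum>i<2. t i * P i t))"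
  proof (rule holo_expand_at_0[OF \<phi>l(1)])
    fix P assume "\<And>i. i < 2 \<Longrightarrow> holo 2 (P i)" "near0 2 (\<lambda>t. \<phi> t l = \<phi> (\<lambda>_. 0) l + (\<Sum>i<2. t i * P i t))"
    then show thesis using \<phi>l(2) by (intro that[of P]) auto
  qed
  define \<theta>\<^sub>1 where "\<theta>\<^sub>1 t = ((\<lambda>i. if i = 1 then t 0 else 0) :: cvec)" for t :: cvec
  define \<theta>\<^sub>2 where "\<theta>\<^sub>2 t = ((\<lambda>i. if i = 0 then t 0 ^ 2 else if i = 1 then t 0 else 0) :: cvec)" for t :: cvec
  have \<theta>\<^sub>1: "holo 1 (\<lambda>t. \<theta>\<^sub>1 t i)" "\<theta>\<^sub>1 (\<lambda>_. 0) = (\<lambda>_. 0)" for i by (auto simp: \<theta>\<^sub>1_def)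
  have \<theta>\<^sub>2: "holo 1 (\<lambda>t. \<theta>\<^sub>2 t i)" "\<theta>\<^sub>2 (\<lambda>_. 0) = (\<lambda>_. 0)" for i by (auto simp: \<theta>\<^sub>2_def)
  have ind1: "induced_by 1 g \<tau> F (\<lambda>t. \<phi> (\<theta>\<^sub>1 t))"
  proof (rule induced_by_cong[OF induced_by_pullback[OF \<phi> \<theta>\<^sub>1]])
    have "near0 (2 + 1) (\<lambda>z. g (join z (\<theta>\<^sub>1 (param z))) = g z)"
      by (rule near0_weaken[OF holo_agree[OF g]]) (auto simp: join_def)
    then show "near0 (2 + 1) (\<lambda>z. g z = H (join z (\<theta>\<^sub>1 (param z))))"
      by (rule near0_mono) (simp add: H_def join_def \<theta>\<^sub>1_def)
  qed
  have ind0: "induced_by 1 g \<tau> F (\<lambda>_ _. 0)"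
    unfolding induced_by_def
  proof (intro conjI allI impI exI)
    show "holo (2 + 1) (\<lambda>z. (\<lambda>i. z i) i)" if "i < 2" for i using that by auto
    show "holo (2 + 1) (\<lambda>z. 1)" by auto
    show "near0 2 (\<lambda>x. (1::complex) = 1 \<and> (\<forall>i<2. join x (\<lambda>_. 0) i = x i))"
      by (rule near0_True) (simp add: join_def)
    show "near0 (2 + 1) (\<lambda>z. g z = 1 * F (join (\<lambda>i. z i) (\<lambda>_. 0)))"
      using near0_weaken[OF F0, of "2 + 1"] by (simp add: eq_commute)
  qed auto
  have def_g: "deformation g 1 g"
    unfolding deformation_def using w3[OF g] gj by simp
  have "partial0 0 (\<lambda>t. \<phi> (\<theta>\<^sub>1 t) l) = P 1 (\<theta>\<^sub>1 (\<lambda>_. 0))"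
  proof (rule partial0_1)
    show "holo 1 (\<lambda>t. P 1 (\<theta>\<^sub>1 t))" by (rule holo_compose[OF P(1)]) (use \<theta>\<^sub>1 in auto)
    have "near0 1 (\<lambda>t. \<phi> (\<theta>\<^sub>1 t) l = (\<Sum>i<2. \<theta>\<^sub>1 t i * P i (\<theta>\<^sub>1 t)))"
      by (rule near0_compose[OF P(2)]) (use \<theta>\<^sub>1 in auto)
    then show "near0 1 (\<lambda>t. \<phi> (\<theta>\<^sub>1 t) l = t 0 * P 1 (\<theta>\<^sub>1 t))"
      by (simp add: numeral_2_eq_2 \<theta>\<^sub>1_def)
  qed
  moreover have "partial0 0 (\<lambda>t. \<phi> (\<theta>\<^sub>1 t) l) = partial0 0 (\<lambda>t. 0)"
    by (rule unique[OF def_g ind1 ind0 l]) simp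
  moreover have "partial0 0 (\<lambda>t. 0) = 0"
    using partial0_1[of "\<lambda>_. 0" "\<lambda>_. 0"] by (simp add: near0_True)
  ultimately have P10: "P 1 (\<lambda>_. 0) = 0" by (simp add: \<theta>\<^sub>1(2))
  have ind2: "induced_by 1 Gt \<tau> F (\<lambda>t. \<phi> (\<theta>\<^sub>2 t))"
  proof (rule induced_by_cong[OF induced_by_pullback[OF \<phi> \<theta>\<^sub>2]])
    have e1: "near0 3 (\<lambda>z. \<forall>w. (\<forall>i<2. w i = z i) \<longrightarrow> g w = g z)"
      using holo_local[OF g] by (rule near0_weaken) simp
    have "near0 3 (\<lambda>z. Gt z = H (join z (\<theta>\<^sub>2 (param z))))"
      using near0_conj[OF GtK near0_conj[OF e1 holo_local[OF K]]]
    proof (rule near0_mono, elim conjE)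
      fix z assume 1: "Gt z = g z + z 2 ^ 2 * K z"
        and 2: "\<forall>w. (\<forall>i<2. w i = z i) \<longrightarrow> g w = g z" and 3: "\<forall>w. (\<forall>i<3. w i = z i) \<longrightarrow> K w = K z"
      let ?J = "join z (\<theta>\<^sub>2 (param z))"
      have "g ?J = g z" by (rule 2[rule_format]) (simp add: join_def)
      moreover have "K (\<lambda>i. if i = 2 then ?J 3 else ?J i) = K z"
        by (rule 3[rule_format]) (auto simp: join_def \<theta>\<^sub>2_def param_def numeral_2_eq_2)
      moreover have "?J 2 = z 2 ^ 2" by (simp add: join_def \<theta>\<^sub>2_def param_def numeral_2_eq_2)
      ultimately show "Gt z = H ?J" using 1 by (simp add: H_def)
    qed
    then show "near0 (2 + 1) (\<lambda>z. Gt z = H (join z (\<theta>\<^sub>2 (param z))))" by simp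
  qed
  have def_Gt: "deformation g 1 Gt"
    unfolding deformation_def
  proof
    show "holo (2 + 1) Gt" using Gt by simp
    have "near0 2 (\<lambda>x. Gt (join x (\<lambda>_. 0)) = g (join x (\<lambda>_. 0)) + join x (\<lambda>_. 0) 2 ^ 2 * K (join x (\<lambda>_. 0)))"
      by (rule near0_compose[OF GtK]) (auto simp: join_def)
    from near0_conj[OF this gj]
    show "near0 2 (\<lambda>x. Gt (join x (\<lambda>_. 0)) = g x)"
      by (rule near0_mono) (simp add: join_def)
  qed
  have "partial0 0 (\<lambda>t. \<phi> (\<theta>\<^sub>2 t) l) = (\<lambda>t. t 0 * P 0 (\<theta>\<^sub>2 t) + P 1 (\<theta>\<^sub>2 t)) (\<lambda>_. 0)"
  proof (rule partial0_1[where Q = "\<lambda>t. t 0 * P 0 (\<theta>\<^sub>2 t) + P 1 (\<theta>\<^sub>2 t)"])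
    have "holo 1 (\<lambda>t. P i (\<theta>\<^sub>2 t))" if "i < 2" for i
      by (rule holo_compose[OF P(1)[OF that]]) (use \<theta>\<^sub>2 in auto)
    then show "holo 1 (\<lambda>t. t 0 * P 0 (\<theta>\<^sub>2 t) + P 1 (\<theta>\<^sub>2 t))" by auto
    have "near0 1 (\<lambda>t. \<phi> (\<theta>\<^sub>2 t) l = (\<Sum>i<2. \<theta>\<^sub>2 t i * P i (\<theta>\<^sub>2 t)))"
      by (rule near0_compose[OF P(2)]) (use \<theta>\<^sub>2 in auto)
    then show "near0 1 (\<lambda>t. \<phi> (\<theta>\<^sub>2 t) l = t 0 * (t 0 * P 0 (\<theta>\<^sub>2 t) + P 1 (\<theta>\<^sub>2 t)))"
      by (rule near0_mono) (simp add: numeral_2_eq_2 \<theta>\<^sub>2_def algebra_simps)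
  qed
  then have "partial0 0 (\<lambda>t. \<phi> (\<theta>\<^sub>2 t) l) = 0" using P10 by (simp add: \<theta>\<^sub>2(2))
  moreover have "partial0 0 (\<lambda>t. \<phi> (\<theta>\<^sub>2 t) l) = partial0 0 (\<lambda>t. t 0 * w l)"
    by (rule unique[OF def_Gt ind2 \<open>induced_by 1 Gt \<tau> F (\<lambda>t l. t 0 * w l)\<close> l]) simp
  moreover have "partial0 0 (\<lambda>t. t 0 * w l) = w l"
    using partial0_1[of "\<lambda>_. w l"] by (simp add: near0_True)
  ultimately show ?thesis by simp
qed

subsection \<open>The Tjurina ideal at a point of the curve\<close>

definition chart :: "complex ^ 3 ^ 3 \<Rightarrow> cvec \<Rightarrow> complex ^ 3" where
  "chart q x = q $ 1 + x 0 *s q $ 2 + x 1 *s q $ 3"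

lemma local_eq_chart: "local_eq q h x = eval h (chart q x)"
  by (simp add: local_eq_def chart_def)

lemma chart_nth: "chart q x $ i = q $ 1 $ i + x 0 * q $ 2 $ i + x 1 * q $ 3 $ i"
  by (simp add: chart_def)

lemma holo_local_eq: "2 \<le> n \<Longrightarrow> holo n (local_eq q h)"
  unfolding local_eq_chart[abs_def] eval_def chart_nth by auto

text \<open>The derivative in the direction of a row of the frame. Rows 2 and 3 give the partial
  derivatives of the local equation; row 1, the direction of the centre vector, is tied to them by
  Euler's identity when \<open>h\<close> is homogeneous.\<close>

definition local_pd :: "complex ^ 3 ^ 3 \<Rightarrow> poly3 \<Rightarrow> 3 \<Rightarrow> cvec \<Rightarrow> complex" where
  "local_pd q h j x = (\<Sum>i\<in>UNIV. q $ j $ i * eval (pd i h) (chart q x))"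

lemma holo_local_pd: "2 \<le> n \<Longrightarrow> holo n (local_pd q h j)"
  unfolding local_pd_def[abs_def] using holo_local_eq[of n q] by (auto simp: local_eq_chart[abs_def])

definition tjurina_at :: "complex ^ 3 ^ 3 \<Rightarrow> poly3 \<Rightarrow> poly3 \<Rightarrow> bool" where
  "tjurina_at q f h \<longleftrightarrow> tjurina (local_eq q f) (local_pd q f 2) (local_pd q f 3) (local_eq q h)"

text \<open>Unit speed in the plane direction \<open>e\<close>, with the base fixed, has first order
  term \<open>D e\<close>. Uniqueness of the derivative at each \<open>x\<close> near 0 identifies
  it with that of the local equation.\<close>

lemma first_order_local_pd:
  assumes D: "first_order \<tau> F D" and F0: "near0 2 (\<lambda>x. F (join x (\<lambda>_. 0)) = local_eq q f x)"
    and e: "e < 2"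
  shows "near0 2 (\<lambda>x. local_pd q f (if e = 0 then 2 else 3) x = D e x)"
proof -
  let ?j = "if e = 0 then 2 else 3 :: 3"
  define \<delta> where "\<delta> i z = (if i = e then 1 else 0 :: complex)" for i and z :: cvec
  have \<delta>: "holo 3 (\<delta> i)" for i by (auto simp: \<delta>_def[abs_def])
  obtain R where R: "holo 3 R"
    "near0 3 (\<lambda>z. F (\<lambda>i. (if i < 2 then z i else 0) + z 2 * \<delta> i z) =
       F (join z (\<lambda>_. 0)) + z 2 * (\<Sum>i<2 + \<tau>. \<delta> i (z(2 := 0)) * D i z) + z 2 ^ 2 * R z)"
    by (rule first_orderE[where \<delta> = \<delta>, OF D \<delta>], rule that)
  have sum: "(\<Sum>i<2 + \<tau>. \<delta> i (z(2 := 0)) * D i z) = D e z" for z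
  proof -
    have "(\<Sum>i<2 + \<tau>. \<delta> i (z(2 := 0)) * D i z) = (\<Sum>i<2 + \<tau>. if i = e then D e z else 0)"
      by (intro sum.cong) (auto simp: \<delta>_def)
    then show ?thesis using e by simp
  qed
  have arg: "(\<lambda>i. (if i < 2 then z i else 0) + z 2 * \<delta> i z) = join (z(e := z e + z 2)) (\<lambda>_. 0)" for z
    using e by (auto simp: join_def \<delta>_def)
  have e1: "near0 3 (\<lambda>z. F (join (z(e := z e + z 2)) (\<lambda>_. 0)) = local_eq q f (z(e := z e + z 2)))"
    by (rule near0_compose[OF F0]) (use e in auto)
  have e2: "near0 3 (\<lambda>z. F (join z (\<lambda>_. 0)) = local_eq q f z)"
    using F0 by (rule near0_weaken) simp
  have De: "holo 2 (D e)" using first_order_holo[OF D, of e] e by simp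
  obtain C where C: "C > 0" "near0 3 (\<lambda>z. norm (R z) \<le> C)" using holo_bounded[OF R(1)] by blast
  have loc: "near0 3 (\<lambda>z. \<forall>w. (\<forall>i<2. w i = z i) \<longrightarrow> D e w = D e z)"
    using holo_local[OF De] by (rule near0_weaken) simp
  obtain r where r: "r > 0" and eq: "\<And>z. (\<forall>i<3. norm (z i) < r) \<Longrightarrow>
      (local_eq q f (z(e := z e + z 2)) = local_eq q f z + z 2 * D e z + z 2 ^ 2 * R z \<and> norm (R z) \<le> C) \<and>
      (\<forall>w. (\<forall>i<2. w i = z i) \<longrightarrow> D e w = D e z)"
  proof -
    have "near0 3 (\<lambda>z. local_eq q f (z(e := z e + z 2)) = local_eq q f z + z 2 * D e z + z 2 ^ 2 * R z \<and> norm (R z) \<le> C)"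
      using near0_conj[OF near0_conj[OF e1 e2] near0_conj[OF R(2)[unfolded arg sum] C(2)]]
      by (rule near0_mono) metis
    from near0_conj[OF this loc] show thesis unfolding near0_def using that by blast
  qed
  have "local_pd q f ?j x = D e x" if x: "\<forall>i<2. norm (x i) < r" for x
  proof (rule DERIV_unique)
    let ?G = "\<lambda>s. eval f (chart q x + s *s q $ ?j)"
    show "(?G has_field_derivative local_pd q f ?j x) (at 0)"
      unfolding local_pd_def by (rule has_derivative_eval)
    show "(?G has_field_derivative D e x) (at 0)"
      unfolding DERIV_def LIM_def
    proof (intro allI impI)
      fix \<epsilon> :: real assume \<epsilon>: "\<epsilon> > 0"
      have "dist ((?G (0 + s) - ?G 0) / s) (D e x) < \<epsilon>" if s: "s \<noteq> 0" "dist s 0 < min r (\<epsilon> / C)" for s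
      proof -
        define z where "z = x(2 := s)"
        have "\<forall>i<3. norm (z i) < r" using x s by (auto simp: z_def less_Suc_eq numeral_3_eq_3 numeral_2_eq_2)
        from eq[OF this] have 1: "local_eq q f (z(e := z e + z 2)) = local_eq q f z + z 2 * D e z + z 2 ^ 2 * R z"
          and 2: "norm (R z) \<le> C" and 3: "\<forall>w. (\<forall>i<2. w i = z i) \<longrightarrow> D e w = D e z" by blast+
        have "D e x = D e z" by (rule 3[rule_format]) (simp add: z_def)
        moreover have "local_eq q f (z(e := z e + z 2)) = ?G s"
          using e by (auto simp: local_eq_chart z_def less_2_cases_iff vec_eq_iff chart_nth algebra_simps
             intro!: arg_cong[of _ _ "eval f"])
        moreover have "local_eq q f z = ?G 0"
          by (auto simp: local_eq_chart z_def vec_eq_iff chart_nth intro!: arg_cong[of _ _ "eval f"])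
        ultimately have "?G s - ?G 0 = s * (D e x + s * R z)"
          using 1 by (simp add: z_def algebra_simps power2_eq_square)
        then have "(?G (0 + s) - ?G 0) / s - D e x = s * R z" using s(1) by simp
        moreover have "norm s * norm (R z) < \<epsilon>"
        proof -
          have "norm s * norm (R z) \<le> norm s * C" using 2 by (simp add: mult_left_mono)
          also have "\<dots> < \<epsilon>" using s(2) C(1) by (simp add: pos_less_divide_eq)
          finally show ?thesis .
        qed
        ultimately show ?thesis by (simp add: dist_norm norm_mult)
      qed
      then show "\<exists>s>0. \<forall>y. y \<noteq> 0 \<and> dist y 0 < s \<longrightarrow> dist ((?G (0 + y) - ?G 0) / y) (D e x) < \<epsilon>"
        using r C(1) \<epsilon> by (intro exI[of _ "min r (\<epsilon> / C)"]) auto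
    qed
  qed
  then show ?thesis using r unfolding near0_def by blast
qed

subsection \<open>The Jacobian ideal\<close>

lemma poly_ideal_jacobian: "poly_ideal (jacobian_ideal f)"
  unfolding poly_ideal_def
proof (intro conjI ballI allI)
  show "0 \<in> jacobian_ideal f"
    unfolding jacobian_ideal_def by (intro CollectI exI[of _ "\<lambda>_. 0"]) simp
  fix a assume "a \<in> jacobian_ideal f"
  then obtain c where c: "a = (\<Sum>i\<in>UNIV. c i * pd i f)" by (auto simp: jacobian_ideal_def)
  show "r * a \<in> jacobian_ideal f" for r
    unfolding jacobian_ideal_def c
    by (intro CollectI exI[of _ "\<lambda>i. r * c i"]) (simp add: sum_distrib_left mult.assoc)
  fix b assume "b \<in> jacobian_ideal f"
  then obtain e where e: "b = (\<Sum>i\<in>UNIV. e i * pd i f)" by (auto simp: jacobian_ideal_def)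
  show "a + b \<in> jacobian_ideal f"
    unfolding jacobian_ideal_def c e
    by (intro CollectI exI[of _ "\<lambda>i. c i + e i"]) (simp add: sum.distrib distrib_right)
qed

lemma jacobian_add: "a \<in> jacobian_ideal f \<Longrightarrow> b \<in> jacobian_ideal f \<Longrightarrow> a + b \<in> jacobian_ideal f"
  and jacobian_mult: "a \<in> jacobian_ideal f \<Longrightarrow> r * a \<in> jacobian_ideal f"
  and jacobian_smul: "a \<in> jacobian_ideal f \<Longrightarrow> smul c a \<in> jacobian_ideal f"
  and jacobian_0: "0 \<in> jacobian_ideal f"
  using poly_ideal_jacobian[of f] unfolding poly_ideal_def smul_def by blast+

lemmas jacobian_sum = poly_ideal_sum[OF poly_ideal_jacobian]

lemma pd_in_jacobian: "pd i f \<in> jacobian_ideal f"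
proof -
  have "(\<Sum>j\<in>UNIV. (if j = i then 1 else 0) * pd j f) = (\<Sum>j\<in>UNIV. if j = i then pd i f else 0)"
    by (intro sum.cong) auto
  then show ?thesis
    unfolding jacobian_ideal_def by (intro CollectI exI[of _ "\<lambda>j. if j = i then 1 else 0"]) simp
qed

text \<open>Euler's identity divided by \<open>d\<close>.\<close>

lemma self_in_jacobian:
  assumes "f \<in> homog d" "d > 0" shows "f \<in> jacobian_ideal f"
proof -
  have "smul (1 / of_nat d) (\<Sum>i\<in>UNIV. X i * pd i f) \<in> jacobian_ideal f"
    by (intro jacobian_smul jacobian_sum jacobian_mult pd_in_jacobian)
  then show ?thesis using assms by (simp add: euler poly3.scale_scale)
qed

lemma jacobian_in_saturation: "jacobian_ideal f \<subseteq> saturation (jacobian_ideal f)"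
  unfolding saturation_def using jacobian_mult by blast

subsection \<open>Dual coordinates of a frame\<close>

locale frame =
  fixes q :: "complex ^ 3 ^ 3" assumes inv: "invertible q"
begin

definition q' where "q' = (SOME B. q ** B = mat 1 \<and> B ** q = mat 1)"

lemma q_q': "(\<Sum>k\<in>UNIV. q $ i $ k * q' $ k $ j) = (if i = j then 1 else 0)"
  and q'_q: "(\<Sum>k\<in>UNIV. q' $ i $ k * q $ k $ j) = (if i = j then 1 else 0)"
proof -
  have "q ** q' = mat 1 \<and> q' ** q = mat 1"
    unfolding q'_def using inv unfolding invertible_def by (rule someI_ex)
  then have "(q ** q') $ i $ j = mat 1 $ i $ j" "(q' ** q) $ i $ j = mat 1 $ i $ j" by auto
  then show "(\<Sum>k\<in>UNIV. q $ i $ k * q' $ k $ j) = (if i = j then 1 else 0)"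
    "(\<Sum>k\<in>UNIV. q' $ i $ k * q $ k $ j) = (if i = j then 1 else 0)"
    by (simp_all add: matrix_matrix_mult_def mat_def)
qed

text \<open>The linear coordinates dual to the rows of \<open>q\<close>. On the chart they are
  \<open>1\<close>, \<open>x 0\<close>, \<open>x 1\<close>, so a power of \<open>L 1\<close> adjusts
  degrees without changing local values.\<close>

definition L :: "3 \<Rightarrow> poly3" where "L j = (\<Sum>k\<in>UNIV. smul (q' $ k $ j) (X k))"

lemma homog_L: "L j \<in> homog 1"
  unfolding L_def by (intro homog_sum homog_smul homog_X)

lemma eval_L: "eval (L j) v = (\<Sum>k\<in>UNIV. q' $ k $ j * v $ k)"
  by (simp add: L_def)

lemma eval_L_q: "eval (L j) (q $ i) = (if i = j then 1 else 0)"
  using q_q'[of i j] by (simp add: eval_L mult.commute)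

lemma eval_L_add: "eval (L j) (v + w) = eval (L j) v + eval (L j) w"
  and eval_L_smult: "eval (L j) (c *s v) = c * eval (L j) v"
  by (simp_all add: eval_L algebra_simps sum.distrib sum_distrib_left)

lemma eval_L_chart: "eval (L j) (chart q x) = (if j = 1 then 1 else if j = 2 then x 0 else x 1)"
  using exhaust_3[of j] by (auto simp: chart_def eval_L_add eval_L_smult eval_L_q)

lemma expand: "v $ i = (\<Sum>j\<in>UNIV. eval (L j) v * q $ j $ i)"
proof -
  have "(\<Sum>j\<in>UNIV. eval (L j) v * q $ j $ i) = (\<Sum>k\<in>UNIV. v $ k * (\<Sum>j\<in>UNIV. q' $ k $ j * q $ j $ i))"
    unfolding eval_L sum_distrib_left sum_distrib_right by (subst sum.swap) (simp add: mult_ac)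
  also have "\<dots> = (\<Sum>k\<in>UNIV. if k = i then v $ i else 0)"
    unfolding q'_q by (intro sum.cong) auto
  finally show ?thesis by simp
qed

text \<open>The derivatives along rows 2 and 3 are generators of the Tjurina ideal, and Euler's
  identity supplies row 1 from these and \<open>f\<close>. The inverse frame then gives the
  coordinate derivatives.\<close>

lemma tjurina_at_pd:
  assumes f: "f \<in> homog d" shows "tjurina_at q f (pd i f)"
proof -
  let ?T = "tjurina (local_eq q f) (local_pd q f 2) (local_pd q f 3)"
  have t1: "?T (local_pd q f 1)"
  proof -
    have eq: "local_pd q f 1 x = of_nat d * local_eq q f x + (- x 0) * local_pd q f 2 x + (- x 1) * local_pd q f 3 x" for x
    proof -
      have "of_nat d * local_eq q f x = eval (\<Sum>i\<in>UNIV. X i * pd i f) (chart q x)"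
        by (simp add: euler[OF f] local_eq_chart)
      also have "\<dots> = local_pd q f 1 x + x 0 * local_pd q f 2 x + x 1 * local_pd q f 3 x"
        by (simp add: chart_nth local_pd_def sum_3 algebra_simps)
      finally show ?thesis by simp
    qed
    show ?thesis
      by (rule tjurinaI[of "\<lambda>_. of_nat d" "\<lambda>x. - x 0" "\<lambda>x. - x 1"]) (auto simp: eq intro!: near0_True)
  qed
  have tj: "?T (local_pd q f j)" for j
    using exhaust_3[of j] t1 tjurina_gens by metis
  have "local_eq q (pd i f) = (\<lambda>x. \<Sum>j\<in>UNIV. q' $ i $ j * local_pd q f j x)"
  proof
    fix x
    have "(\<Sum>j\<in>UNIV. q' $ i $ j * local_pd q f j x)
        = (\<Sum>k\<in>UNIV. (\<Sum>j\<in>UNIV. q' $ i $ j * q $ j $ k) * eval (pd k f) (chart q x))"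
      unfolding local_pd_def sum_distrib_left sum_distrib_right by (subst sum.swap) (simp add: mult_ac)
    also have "\<dots> = (\<Sum>k\<in>UNIV. if k = i then eval (pd i f) (chart q x) else 0)"
      unfolding q'_q by (intro sum.cong) auto
    finally show "local_eq q (pd i f) x = (\<Sum>j\<in>UNIV. q' $ i $ j * local_pd q f j x)"
      by (simp add: local_eq_chart)
  qed
  then show ?thesis unfolding tjurina_at_def by (auto intro!: tjurina_sum tjurina_mult tj)
qed

text \<open>\<open>L 1 ^ k\<close> is a form of degree \<open>k\<close> equal to 1 on the chart, so
  \<open>h\<close> has the same local equation as \<open>L 1 ^ k * h\<close>, which lies in
  \<open>J\<close> for suitable \<open>k\<close>.\<close>

lemma tjurina_at_saturation:
  assumes f: "f \<in> homog d" and h: "h \<in> saturation (jacobian_ideal f)"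
  shows "tjurina_at q f h"
proof -
  obtain k where k: "\<And>m. mdeg m = k \<Longrightarrow> sg m 1 * h \<in> jacobian_ideal f"
    using h unfolding saturation_def by blast
  have "L 1 ^ k \<in> homog k" using homog_power[OF homog_L, of 1 k] by simp
  then have "smul c (sg m 1 * h) \<in> jacobian_ideal f" if "m \<in> Poly_Mapping.keys (L 1 ^ k)" for m c
    using that k by (intro jacobian_smul) (auto simp: homog_def)
  then have "(\<Sum>m\<in>Poly_Mapping.keys (L 1 ^ k). smul (lk (L 1 ^ k) m) (sg m 1 * h)) \<in> jacobian_ideal f"
    by (intro jacobian_sum)
  moreover have "(\<Sum>m\<in>Poly_Mapping.keys (L 1 ^ k). smul (lk (L 1 ^ k) m) (sg m 1 * h)) = L 1 ^ k * h"
    unfolding smul_mult_left sum_distrib_right[symmetric]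
    by (simp add: smul_def mult_single sum_singles)
  ultimately obtain a where a: "L 1 ^ k * h = (\<Sum>i\<in>UNIV. a i * pd i f)"
    by (auto simp: jacobian_ideal_def)
  have "local_eq q h x = eval (L 1 ^ k * h) (chart q x)" for x
    by (simp add: local_eq_chart eval_L_chart)
  then have "local_eq q h = (\<lambda>x. \<Sum>i\<in>UNIV. local_eq q (a i) x * local_eq q (pd i f) x)"
    unfolding a by (auto simp: local_eq_chart)
  then show ?thesis
    using tjurina_at_pd[OF f] holo_local_eq[of 2 q] unfolding tjurina_at_def
    by (auto intro!: tjurina_sum tjurina_mult)
qed

end

subsection \<open>From analytic to algebraic membership\<close>

text \<open>The value at 0 vanishes by continuity, and dividing by the variable lowers
  \<open>D\<close>.\<close>

lemma low_coeffs_zero: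
  fixes p :: "complex poly"
  assumes "r > 0" "\<And>t. t \<noteq> 0 \<Longrightarrow> norm t < r \<Longrightarrow> norm (poly p t) \<le> C * norm t ^ D" "e < D"
  shows "coeff p e = 0"
  using assms
proof (induction D arbitrary: p e)
  case (Suc D)
  have "((\<lambda>t. poly p t) \<longlongrightarrow> 0) (at 0)"
  proof (rule Lim_null_comparison)
    show "\<forall>\<^sub>F t in at 0. norm (poly p t) \<le> C * norm t ^ Suc D"
      unfolding eventually_at using Suc.prems(1,2) by (auto simp: dist_norm)
    have "((\<lambda>t::complex. C * norm t ^ Suc D) \<longlongrightarrow> C * norm (0::complex) ^ Suc D) (at 0)"
      by (intro tendsto_intros)
    then show "((\<lambda>t::complex. C * norm t ^ Suc D) \<longlongrightarrow> 0) (at 0)" by simp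
  qed
  moreover have "((\<lambda>t. poly p t) \<longlongrightarrow> poly p 0) (at 0)"
    using poly_isCont[of 0 p] by (simp add: isCont_def)
  ultimately have "poly p 0 = 0" using tendsto_unique[of "at (0::complex)"] by force
  then obtain q where q: "p = pCons 0 q" by (cases p) auto
  show ?case
  proof (cases e)
    case 0
    then show ?thesis by (simp add: q)
  next
    case (Suc e')
    have "norm (poly q t) \<le> C * norm t ^ D" if "t \<noteq> 0" "norm t < r" for t
    proof -
      have "norm t * norm (poly q t) \<le> norm t * (C * norm t ^ D)"
        using Suc.prems(2)[OF that] by (simp add: q norm_mult mult_ac)
      then show ?thesis using that(1) by simp
    qed
    then have "coeff q e' = 0" using Suc.IH[of q e'] Suc.prems(1,3) Suc by auto
    then show ?thesis by (simp add: q Suc)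
  qed
qed simp

text \<open>Orders of vanishing at the centre of a chart are measured by powers of this norm, so
  that germs and polynomials are compared by estimates.\<close>

definition size2 :: "cvec \<Rightarrow> real" where "size2 x = norm (x 0) + norm (x 1)"

context frame
begin

text \<open>The witness is the Taylor polynomial of degree below \<open>D\<close>, homogenised to
  degree \<open>D\<close> with \<open>L 1\<close>. The induction splits off the value at 0 and
  truncates the two Hadamard quotients.\<close>

lemma truncation:
  assumes "holo 2 \<alpha>"
  shows "\<exists>a\<in>homog D. \<exists>C\<ge>0. near0 2 (\<lambda>x. norm (\<alpha> x - eval a (chart q x)) \<le> C * size2 x ^ D)"
  using assms
proof (induction D arbitrary: \<alpha>)
  case 0
  obtain C where "C > 0" "near0 2 (\<lambda>x. norm (\<alpha> x) \<le> C)" using holo_bounded[OF 0] by blast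
  then show ?case by (intro bexI[of _ 0] exI[of _ C]) auto
next
  case (Suc D)
  show ?case
  proof (rule holo_expand_at_0[OF Suc.prems])
    fix P assume P: "\<And>i. i < 2 \<Longrightarrow> holo 2 (P i)" "near0 2 (\<lambda>x. \<alpha> x = \<alpha> (\<lambda>_. 0) + (\<Sum>i<2. x i * P i x))"
    obtain a C where a: "a \<in> homog D" "C \<ge> 0" "near0 2 (\<lambda>x. norm (P 0 x - eval a (chart q x)) \<le> C * size2 x ^ D)"
      using Suc.IH[OF P(1)[of 0]] by auto
    obtain b B where b: "b \<in> homog D" "B \<ge> 0" "near0 2 (\<lambda>x. norm (P 1 x - eval b (chart q x)) \<le> B * size2 x ^ D)"
      using Suc.IH[OF P(1)[of 1]] by auto
    define c where "c = smul (\<alpha> (\<lambda>_. 0)) (L 1 ^ Suc D) + L 2 * a + L 3 * b"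
    have "c \<in> homog (Suc D)"
      unfolding c_def using homog_power[OF homog_L, of 1 "Suc D"]
        homog_mult[OF homog_L a(1), of 2] homog_mult[OF homog_L b(1), of 3]
      by (auto intro!: homog_add homog_smul)
    moreover have "near0 2 (\<lambda>x. norm (\<alpha> x - eval c (chart q x)) \<le> (C + B) * size2 x ^ Suc D)"
      using near0_conj[OF P(2) near0_conj[OF a(3) b(3)]]
    proof (rule near0_mono, elim conjE)
      fix x assume 1: "\<alpha> x = \<alpha> (\<lambda>_. 0) + (\<Sum>i<2. x i * P i x)"
        and 2: "norm (P 0 x - eval a (chart q x)) \<le> C * size2 x ^ D"
        and 3: "norm (P 1 x - eval b (chart q x)) \<le> B * size2 x ^ D"
      have "\<alpha> x - eval c (chart q x) = x 0 * (P 0 x - eval a (chart q x)) + x 1 * (P 1 x - eval b (chart q x))"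
        using 1 by (simp add: c_def eval_L_chart numeral_2_eq_2 algebra_simps)
      then have "norm (\<alpha> x - eval c (chart q x)) \<le>
          norm (x 0) * norm (P 0 x - eval a (chart q x)) + norm (x 1) * norm (P 1 x - eval b (chart q x))"
        by (metis norm_mult norm_triangle_ineq)
      also have "\<dots> \<le> size2 x * (C * size2 x ^ D) + size2 x * (B * size2 x ^ D)"
        using 2 3 by (intro add_mono mult_mono) (auto simp: size2_def)
      finally show "norm (\<alpha> x - eval c (chart q x)) \<le> (C + B) * size2 x ^ Suc D"
        by (simp add: algebra_simps)
    qed
    ultimately show ?thesis using a(2) b(2) by (intro bexI[of _ c] exI[of _ "C + B"]) auto
  qed
qed

text \<open>Written in the coordinates \<open>L j\<close>, the monomials of degree \<open>e\<close>
  in \<open>L 2\<close>, \<open>L 3\<close> restrict on the chart to the part of degree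
  \<open>e\<close> in \<open>x\<close>; the growth bound kills the parts below
  \<open>D\<close>.\<close>

lemma high_order:
  assumes E: "E \<in> homog M" and bound: "near0 2 (\<lambda>x. norm (eval E (chart q x)) \<le> C * size2 x ^ D)"
  obtains S c where "finite S" "\<And>m. m \<in> S \<Longrightarrow> D \<le> lk m 2 + lk m 3"
    "E = (\<Sum>m\<in>S. smul (c m) (\<Prod>j\<in>UNIV. L j ^ lk m j))"
proof -
  \<comment> \<open>\<open>E\<close> in the coordinates dual to the frame, so that substituting
    \<open>L 1\<close>, \<open>L 2\<close>, \<open>L 3\<close> into \<open>E'\<close> returns
    \<open>E\<close>.\<close>
  define E' where "E' = lin_subst (transpose q) E"
  have E': "E' \<in> homog M" unfolding E'_def by (rule homog_lin_subst[OF E])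
  have "transpose q *v (\<chi> j. eval (L j) v) = v" for v
    by (simp add: vec_eq_iff matrix_vector_mult_def transpose_def expand[of v] mult.commute)
  then have "eval E v = eval E' (\<chi> j. eval (L j) v)" for v
    by (simp add: E'_def eval_lin_subst)
  then have E_eq: "E = (\<Sum>m\<in>Poly_Mapping.keys E'. smul (lk E' m) (\<Prod>j\<in>UNIV. L j ^ lk m j))"
    by (intro eval_inject) (simp add: eval_def[of E'])
  have chart': "transpose q *v vector [1, x 0, x 1] = chart q x" for x
    by (simp add: vec_eq_iff matrix_vector_mult_def transpose_def chart_nth sum_3 mult.commute)
  define ord where "ord m = lk m 2 + lk m 3" for m :: "3 \<Rightarrow>\<^sub>0 nat"
  have me: "monom_eval m (vector [1, t * a, t * b]) = t ^ ord m * monom_eval m (vector [1, a, b])" for m t a b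
    by (simp add: monom_eval_def prod_3 ord_def power_mult_distrib power_add mult_ac)
  define K where "K = Poly_Mapping.keys E'"
  define E'' where "E'' = (\<Sum>m\<in>{m\<in>K. ord m < D}. sg m (lk E' m))"
  have low: "eval E'' (vector [1, a, b]) = 0" for a b
  proof -
    \<comment> \<open>The restriction of \<open>E\<close> to the line through the centre in
      direction \<open>(a, b)\<close>. The coefficient of \<open>t^e\<close> is the part of order
      \<open>e\<close>, evaluated at \<open>(a, b)\<close>.\<close>
    define p where "p = (\<Sum>m\<in>K. Polynomial.monom (lk E' m * monom_eval m (vector [1, a, b])) (ord m))"
    have p: "poly p t = eval E (chart q (\<lambda>i. t * (if i = 0 then a else b)))" for t
    proof -
      have "eval E (chart q (\<lambda>i. t * (if i = 0 then a else b))) = eval E' (vector [1, t * a, t * b])"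
        unfolding chart'[symmetric] E'_def eval_lin_subst by simp
      also have "\<dots> = (\<Sum>m\<in>K. lk E' m * monom_eval m (vector [1, t * a, t * b]))"
        by (rule eval_eq_sum) (auto simp: K_def)
      finally show ?thesis unfolding me by (simp add: p_def poly_sum poly_monom mult_ac)
    qed
    obtain r where r: "r > 0" "\<And>x. (\<forall>i<2. norm (x i) < r) \<Longrightarrow> norm (eval E (chart q x)) \<le> C * size2 x ^ D"
      using bound unfolding near0_def by blast
    define A where "A = norm a + norm b"
    have A: "A \<ge> 0" "norm a \<le> A" "norm b \<le> A" by (auto simp: A_def)
    have c0: "coeff p e = 0" if "e < D" for e
    proof (rule low_coeffs_zero[OF _ _ that])
      show "r / (A + 1) > 0" using r(1) A by simp
      fix t :: complex assume t: "norm t < r / (A + 1)"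
      have tA: "norm t * c < r" if "c \<le> A" "0 \<le> c" for c
      proof -
        have "norm t * c \<le> norm t * (A + 1)" using that by (intro mult_left_mono) auto
        also have "\<dots> < r" using t A by (simp add: pos_less_divide_eq)
        finally show ?thesis .
      qed
      have "norm (poly p t) \<le> C * size2 (\<lambda>i. t * (if i = 0 then a else b)) ^ D"
        unfolding p by (rule r(2)) (use tA A in \<open>auto simp: norm_mult\<close>)
      also have "size2 (\<lambda>i. t * (if i = 0 then a else b)) = norm t * A"
        by (simp add: size2_def norm_mult A_def algebra_simps)
      finally show "norm (poly p t) \<le> (C * A ^ D) * norm t ^ D"
        by (simp add: power_mult_distrib mult_ac)
    qed
    have "eval E'' (vector [1, a, b]) = (\<Sum>m\<in>{m\<in>K. ord m < D}. lk E' m * monom_eval m (vector [1, a, b]))"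
      by (simp add: E''_def)
    also have "\<dots> = (\<Sum>m\<in>K. \<Sum>e<D. if ord m = e then lk E' m * monom_eval m (vector [1, a, b]) else 0)"
    proof -
      have "(\<Sum>e<D. if ord m = e then c else 0) = (if ord m < D then c else 0)" for m and c :: complex
        by simp
      then show ?thesis by (simp only:) (rule sum.inter_filter, simp add: K_def)
    qed
    also have "\<dots> = (\<Sum>e<D. coeff p e)"
      by (subst sum.swap) (simp add: p_def coeff_sum)
    also have "\<dots> = 0" using c0 by simp
    finally show ?thesis .
  qed
  have "E'' \<in> homog M" unfolding E''_def
    using E' by (intro homog_sum homog_single) (auto simp: homog_def K_def)
  \<comment> \<open>Vanishing is known only where the first coordinate is nonzero; the factor
    \<open>X 1\<close> covers the remaining plane and is cancelled afterwards.\<close>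
  have "X 1 * E'' = 0"
  proof (rule eval_eq_0_imp)
    fix v :: "complex ^ 3"
    show "eval (X 1 * E'') v = 0"
    proof (cases "v $ 1 = 0")
      case False
      have "v = v $ 1 *s vector [1, v $ 2 / v $ 1, v $ 3 / v $ 1]"
        using False by (simp add: vec_eq_iff forall_3)
      then have "eval E'' v = 0" using eval_homog[OF \<open>E'' \<in> homog M\<close>] low by (metis mult_zero_right)
      then show ?thesis by simp
    qed simp
  qed
  moreover have "X 1 \<noteq> 0" by (metis X_def lookup_single_eq lookup_zero zero_neq_one)
  ultimately have "E'' = 0" by simp
  have "D \<le> ord m" if m: "m \<in> K" for m
  proof (rule ccontr)
    assume "\<not> D \<le> ord m"
    then have "lk E'' m = lk E' m"
      using m by (simp add: E''_def lookup_sum lookup_single when_def K_def)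
    then show False using m \<open>E'' = 0\<close> by (simp add: K_def in_keys_iff)
  qed
  then show thesis using that[of K "lk E'"] E_eq by (auto simp: K_def ord_def)
qed

text \<open>Replacing the analytic coefficients of the Tjurina relation by forms of degree
  \<open>D\<close> costs an error of order \<open>D\<close>, since the generators are bounded near
  the centre.\<close>

lemma truncated_membership:
  assumes f: "f \<in> homog d" and h: "h \<in> homog d" and d: "d > 0" and tj: "tjurina_at q f h"
  obtains A S c where "A \<in> jacobian_ideal f" "finite S" "\<And>m. m \<in> S \<Longrightarrow> D \<le> lk m 2 + lk m 3"
    "L 1 ^ D * h = A + (\<Sum>m\<in>S. smul (c m) (\<Prod>j\<in>UNIV. L j ^ lk m j))"
proof -
  obtain \<alpha> \<beta>\<^sub>0 \<beta>\<^sub>1 where ab: "holo 2 \<alpha>" "holo 2 \<beta>\<^sub>0" "holo 2 \<beta>\<^sub>1"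
    "near0 2 (\<lambda>x. local_eq q h x = \<alpha> x * local_eq q f x + \<beta>\<^sub>0 x * local_pd q f 2 x + \<beta>\<^sub>1 x * local_pd q f 3 x)"
    by (rule tjurinaE[OF tj[unfolded tjurina_at_def]], rule that)
  obtain a C where a: "a \<in> homog D" "C \<ge> 0" "near0 2 (\<lambda>x. norm (\<alpha> x - eval a (chart q x)) \<le> C * size2 x ^ D)"
    using truncation[OF ab(1)] by blast
  obtain b\<^sub>0 B\<^sub>0 where b0: "b\<^sub>0 \<in> homog D" "B\<^sub>0 \<ge> 0" "near0 2 (\<lambda>x. norm (\<beta>\<^sub>0 x - eval b\<^sub>0 (chart q x)) \<le> B\<^sub>0 * size2 x ^ D)"
    using truncation[OF ab(2)] by blast
  obtain b\<^sub>1 B\<^sub>1 where b1: "b\<^sub>1 \<in> homog D" "B\<^sub>1 \<ge> 0" "near0 2 (\<lambda>x. norm (\<beta>\<^sub>1 x - eval b\<^sub>1 (chart q x)) \<le> B\<^sub>1 * size2 x ^ D)"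
    using truncation[OF ab(3)] by blast
  define dq where "dq j = (\<Sum>i\<in>UNIV. smul (q $ j $ i) (pd i f))" for j
  have dJ: "dq j \<in> jacobian_ideal f" for j
    unfolding dq_def by (intro jacobian_sum jacobian_smul pd_in_jacobian)
  obtain d' where d': "d = Suc d'" using d by (cases d) auto
  have dh: "dq j \<in> homog d'" for j
    unfolding dq_def using f by (intro homog_sum homog_smul homog_pd) (simp add: d')
  have de: "eval (dq j) (chart q x) = local_pd q f j x" for j x
    by (simp add: dq_def local_pd_def)
  \<comment> \<open>The derivatives have degree \<open>d - 1\<close>; the extra factor
    \<open>L 1\<close>, equal to 1 on the chart, makes all summands homogeneous of degree
    \<open>D + d\<close>.\<close>
  define A where "A = a * f + L 1 * b\<^sub>0 * dq 2 + L 1 * b\<^sub>1 * dq 3"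
  define E where "E = L 1 ^ D * h - A"
  have AJ: "A \<in> jacobian_ideal f"
    unfolding A_def using self_in_jacobian[OF f d] dJ by (intro jacobian_add jacobian_mult)
  have "L 1 * b * dq j \<in> homog (D + d)" if "b \<in> homog D" for b j
    using homog_mult[OF homog_mult[OF homog_L that] dh, of 1 j] by (simp add: d')
  moreover have "L 1 ^ D * h \<in> homog (D + d)"
    using homog_mult[OF homog_power[OF homog_L, of 1 D] h] by simp
  ultimately have EM: "E \<in> homog (D + d)"
    unfolding E_def A_def using homog_mult[OF a(1) f] b0(1) b1(1) by (intro homog_diff homog_add) auto
  obtain G0 where G0: "G0 > 0" "near0 2 (\<lambda>x. norm (local_eq q f x) \<le> G0)"
    using holo_bounded[OF holo_local_eq[of 2]] by blast
  obtain G1 where G1: "G1 > 0" "near0 2 (\<lambda>x. norm (local_pd q f 2 x) \<le> G1)"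
    using holo_bounded[OF holo_local_pd[of 2]] by blast
  obtain G2 where G2: "G2 > 0" "near0 2 (\<lambda>x. norm (local_pd q f 3 x) \<le> G2)"
    using holo_bounded[OF holo_local_pd[of 2]] by blast
  have bound: "near0 2 (\<lambda>x. norm (eval E (chart q x)) \<le> (C * G0 + B\<^sub>0 * G1 + B\<^sub>1 * G2) * size2 x ^ D)"
    using near0_conj[OF near0_conj[OF near0_conj[OF ab(4) a(3)] near0_conj[OF b0(3) b1(3)]]
        near0_conj[OF G0(2) near0_conj[OF G1(2) G2(2)]]]
  proof (rule near0_mono, elim conjE)
    fix x
    assume 1: "local_eq q h x = \<alpha> x * local_eq q f x + \<beta>\<^sub>0 x * local_pd q f 2 x + \<beta>\<^sub>1 x * local_pd q f 3 x"
      and bounds: "norm (\<alpha> x - eval a (chart q x)) \<le> C * size2 x ^ D"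
        "norm (\<beta>\<^sub>0 x - eval b\<^sub>0 (chart q x)) \<le> B\<^sub>0 * size2 x ^ D"
        "norm (\<beta>\<^sub>1 x - eval b\<^sub>1 (chart q x)) \<le> B\<^sub>1 * size2 x ^ D"
        "norm (local_eq q f x) \<le> G0" "norm (local_pd q f 2 x) \<le> G1" "norm (local_pd q f 3 x) \<le> G2"
    have s: "size2 x ^ D \<ge> 0" by (simp add: size2_def)
    have "eval E (chart q x) = (\<alpha> x - eval a (chart q x)) * local_eq q f x +
        (\<beta>\<^sub>0 x - eval b\<^sub>0 (chart q x)) * local_pd q f 2 x + (\<beta>\<^sub>1 x - eval b\<^sub>1 (chart q x)) * local_pd q f 3 x"
      using 1 by (simp add: E_def A_def eval_L_chart de local_eq_chart algebra_simps)
    also have "norm \<dots> \<le> norm (\<alpha> x - eval a (chart q x)) * norm (local_eq q f x) +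
        norm (\<beta>\<^sub>0 x - eval b\<^sub>0 (chart q x)) * norm (local_pd q f 2 x) +
        norm (\<beta>\<^sub>1 x - eval b\<^sub>1 (chart q x)) * norm (local_pd q f 3 x)"
      by (intro order_trans[OF norm_triangle_ineq] add_mono) (simp_all add: norm_mult)
    also have "\<dots> \<le> C * size2 x ^ D * G0 + B\<^sub>0 * size2 x ^ D * G1 + B\<^sub>1 * size2 x ^ D * G2"
      using bounds a(2) b0(2) b1(2) s by (intro add_mono mult_mono) auto
    finally show "norm (eval E (chart q x)) \<le> (C * G0 + B\<^sub>0 * G1 + B\<^sub>1 * G2) * size2 x ^ D"
      by (simp add: algebra_simps)
  qed
  obtain S c where S: "finite S" "\<And>m. m \<in> S \<Longrightarrow> D \<le> lk m 2 + lk m 3"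
    "E = (\<Sum>m\<in>S. smul (c m) (\<Prod>j\<in>UNIV. L j ^ lk m j))"
    by (rule high_order[OF EM bound], rule that)
  have "L 1 ^ D * h = A + (\<Sum>m\<in>S. smul (c m) (\<Prod>j\<in>UNIV. L j ^ lk m j))"
    unfolding S(3)[symmetric] by (simp add: E_def)
  with AJ S(1,2) show thesis by (intro that[of A S c]) auto
qed

end

section \<open>Polynomial multipliers at the points of the plane, and saturation\<close>

lemma separating_form:
  fixes p p' :: "complex ^ 3"
  assumes "p' \<noteq> 0" "\<nexists>c. p = c *s p'"
  obtains M where "\<And>c. eval M (c *s p') = 0" "eval M p \<noteq> 0"
proof -
  obtain k where k: "p' $ k \<noteq> 0" using assms(1) by (auto simp: vec_eq_iff)
  have "p \<noteq> (p $ k / p' $ k) *s p'" using assms(2) by blast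
  then obtain l where l: "p $ l \<noteq> (p $ k / p' $ k) * p' $ l" by (auto simp: vec_eq_iff)
  \<comment> \<open>A 2 by 2 minor of \<open>p\<close> and \<open>p'\<close> that involves the
    nonzero entry \<open>p' $ k\<close>.\<close>
  define M where "M = smul (p' $ k) (X l) - smul (p' $ l) (X k)"
  have "eval M p \<noteq> 0" using l k by (simp add: M_def field_simps)
  moreover have "eval M (c *s p') = 0" for c by (simp add: M_def mult_ac)
  ultimately show thesis by (rule that[rotated])
qed

lemma singular_atI:
  assumes "f \<in> homog d" "d > 0" "p \<noteq> 0" "\<And>i. eval (pd i f) p = 0"
  shows "singular_at f p"
proof -
  have "of_nat d * eval f p = eval (\<Sum>i\<in>UNIV. X i * pd i f) p" by (simp add: euler[OF assms(1)])
  then show ?thesis using assms by (simp add: singular_at_def)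
qed

text \<open>At a singular point \<open>p\<close>, the other singular points are removed by a product \<open>u\<close> of linear forms
  not vanishing at \<open>p\<close>; the Nullstellensatz then gives a power of the ideal of \<open>p\<close> inside \<open>J\<close>, up to
  powers of \<open>u\<close>, so that the analytic relation can be replaced by a truncation.\<close>

lemma local_multiplier:
  assumes f: "f \<in> homog d" and d: "d > 0" and h: "h \<in> homog d"
    and qs: "singular_frames f qs" and tj: "\<And>q. q \<in> set qs \<Longrightarrow> tjurina_at q f h" and p: "p \<noteq> 0"
  shows "\<exists>k. k * h \<in> jacobian_ideal f \<and> eval k p \<noteq> 0"
proof (cases "singular_at f p")
  case False
  then obtain i where "eval (pd i f) p \<noteq> 0" using singular_atI[OF f d p] by blast
  then show ?thesis using jacobian_mult[OF pd_in_jacobian, of h i f] by (metis mult.commute)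
next
  case True
  have ex1: "\<exists>!j. j < length qs \<and> (\<exists>c. v = c *s qs ! j $ 1)" if "singular_at f v" for v
    using qs that unfolding singular_frames_def by blast
  obtain j c where j: "j < length qs" "p = c *s qs ! j $ 1" using ex1[OF True] by blast
  define q where "q = qs ! j"
  have q: "q \<in> set qs" using j by (simp add: q_def)
  interpret frame q by unfold_locales (use q qs in \<open>auto simp: singular_frames_def\<close>)
  have c: "c \<noteq> 0" using p j by auto
  have "\<exists>M. (\<forall>c. eval M (c *s qs ! i $ 1) = 0) \<and> eval M p \<noteq> 0" if i: "i < length qs" "i \<noteq> j" for i
  proof -
    have "qs ! i $ 1 \<noteq> 0" using qs i by (auto simp: singular_frames_def singular_at_def)
    moreover have "\<nexists>c. p = c *s qs ! i $ 1" using ex1[OF True] i j by blast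
    ultimately obtain M where "\<And>c. eval M (c *s qs ! i $ 1) = 0" "eval M p \<noteq> 0"
      by (rule separating_form) blast
    then show ?thesis by blast
  qed
  then obtain M where M: "\<And>i c. i < length qs \<Longrightarrow> i \<noteq> j \<Longrightarrow> eval (M i) (c *s qs ! i $ 1) = 0"
    "\<And>i. i < length qs \<Longrightarrow> i \<noteq> j \<Longrightarrow> eval (M i) p \<noteq> 0" by metis
  define u where "u = (\<Prod>i\<in>{..<length qs} - {j}. M i)"
  have up: "eval u p \<noteq> 0" using M(2) by (simp add: u_def)
  \<comment> \<open>The zeros of \<open>J\<close> are the singular points and the origin. On the
    line of \<open>p\<close> and at the origin \<open>L a\<close> vanishes, at the other singular
    points \<open>u\<close> does.\<close>
  have null: "\<exists>n. (u * L a) ^ n \<in> jacobian_ideal f" if a: "a \<noteq> 1" for a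
  proof (rule nullstellensatz[OF poly_ideal_jacobian])
    fix v assume v: "\<forall>k\<in>jacobian_ideal f. eval k v = 0"
    show "eval (u * L a) v = 0"
    proof (cases "v = 0")
      case True
      then show ?thesis by (simp add: eval_L)
    next
      case False
      then have "singular_at f v" using v pd_in_jacobian by (intro singular_atI[OF f d]) auto
      then obtain i e where i: "i < length qs" "v = e *s qs ! i $ 1" using ex1 by blast
      show ?thesis
      proof (cases "i = j")
        case True
        then have "v = e *s q $ 1" using i by (simp add: q_def)
        then show ?thesis using a by (simp add: eval_L_smult eval_L_q)
      next
        case False
        then have "eval u v = 0" unfolding u_def eval_prod using i M(1)
          by (intro prod_zero) auto
        then show ?thesis by simp
      qed
    qed
  qed
  obtain n2 where n2: "(u * L 2) ^ n2 \<in> jacobian_ideal f" using null[of 2] by auto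
  obtain n3 where n3: "(u * L 3) ^ n3 \<in> jacobian_ideal f" using null[of 3] by auto
  \<comment> \<open>If the exponents of \<open>L 2\<close> and \<open>L 3\<close> add up to at least
    \<open>n2 + n3\<close>, one of them reaches its own bound; \<open>u ^ n\<close> has enough
    factors in either case.\<close>
  define n where "n = n2 + n3"
  have high: "u ^ n * (\<Prod>j\<in>UNIV. L j ^ lk m j) \<in> jacobian_ideal f" if "n \<le> lk m 2 + lk m 3" for m
  proof -
    have "n2 \<le> lk m 2 \<or> n3 \<le> lk m 3" using that by (auto simp: n_def)
    then show ?thesis
    proof
      assume "n2 \<le> lk m 2"
      then have "u ^ n * (\<Prod>j\<in>UNIV. L j ^ lk m j) =
          (u ^ n3 * L 1 ^ lk m 1 * L 2 ^ (lk m 2 - n2) * L 3 ^ lk m 3) * (u * L 2) ^ n2"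
        by (simp add: prod_3 n_def power_add power_mult_distrib mult_ac flip: power_add)
      then show ?thesis using jacobian_mult[OF n2] by simp
    next
      assume "n3 \<le> lk m 3"
      then have "u ^ n * (\<Prod>j\<in>UNIV. L j ^ lk m j) =
          (u ^ n2 * L 1 ^ lk m 1 * L 2 ^ lk m 2 * L 3 ^ (lk m 3 - n3)) * (u * L 3) ^ n3"
        by (simp add: prod_3 n_def power_add power_mult_distrib mult_ac flip: power_add)
      then show ?thesis using jacobian_mult[OF n3] by simp
    qed
  qed
  obtain A S b where S: "A \<in> jacobian_ideal f" "finite S" "\<And>m. m \<in> S \<Longrightarrow> n \<le> lk m 2 + lk m 3"
    "L 1 ^ n * h = A + (\<Sum>m\<in>S. smul (b m) (\<Prod>j\<in>UNIV. L j ^ lk m j))"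
    by (rule truncated_membership[OF f h d tj[OF q], of n], rule that)
  have "u ^ n * (L 1 ^ n * h) = u ^ n * A + (\<Sum>m\<in>S. smul (b m) (u ^ n * (\<Prod>j\<in>UNIV. L j ^ lk m j)))"
    unfolding S(4) by (simp add: distrib_left sum_distrib_left smul_mult_right)
  also have "\<dots> \<in> jacobian_ideal f"
    by (intro jacobian_add jacobian_mult[OF S(1)] jacobian_sum jacobian_smul high S(3))
  finally have "(u ^ n * L 1 ^ n) * h \<in> jacobian_ideal f" by (simp add: mult.assoc)
  moreover have "eval (L 1) p = c"
    using j(2) by (simp add: eval_L_smult eval_L_q flip: q_def)
  then have "eval (u ^ n * L 1 ^ n) p \<noteq> 0" using up c by simp
  ultimately show ?thesis by blast
qed

text \<open>The ideal \<open>K\<close> of multipliers of \<open>h\<close> into \<open>J\<close> has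
  no zero besides the origin, by \<open>local_multiplier\<close>. Hence it contains a power of each
  variable, and therefore all monomials of a suitable degree.\<close>

lemma saturation_if_tjurina_at:
  assumes f: "f \<in> homog d" and d: "d > 0" and h: "h \<in> homog d"
    and qs: "singular_frames f qs" and tj: "\<And>q. q \<in> set qs \<Longrightarrow> tjurina_at q f h"
  shows "h \<in> saturation (jacobian_ideal f)"
proof -
  define K where "K = {k. k * h \<in> jacobian_ideal f}"
  have K: "poly_ideal K"
    unfolding poly_ideal_def K_def
    by (auto simp: distrib_right mult.assoc jacobian_0 intro: jacobian_add jacobian_mult)
  have "\<exists>n. X i ^ n \<in> K" for i
  proof (rule nullstellensatz[OF K])
    fix v assume "\<forall>k\<in>K. eval k v = 0"
    then have "v = 0" using local_multiplier[OF f d h qs tj, of v] unfolding K_def by blast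
    then show "eval (X i) v = 0" by simp
  qed
  then obtain n where n: "\<And>i. X i ^ n i \<in> K" by metis
  show ?thesis
    unfolding saturation_def
  proof (intro CollectI exI[of _ "\<Sum>i\<in>UNIV. n i"] allI impI)
    fix m assume m: "mdeg m = (\<Sum>i\<in>UNIV. n i)"
    obtain i where i: "n i \<le> lk m i"
    proof (rule ccontr)
      assume "\<not> thesis"
      then have "\<And>i. lk m i < n i" using that not_le by blast
      then have "mdeg m < (\<Sum>i\<in>UNIV. n i)" unfolding mdeg_def by (intro sum_strict_mono) auto
      then show False using m by simp
    qed
    have "sg m 1 = sg (m - sg i (n i)) 1 * X i ^ n i"
    proof (rule eval_inject)
      fix v
      have "m = (m - sg i (n i)) + sg i (n i)"
        using i by (intro poly_mapping_eqI) (auto simp: lookup_add lookup_minus lookup_single when_def)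
      then have "monom_eval m v = monom_eval (m - sg i (n i)) v * monom_eval (sg i (n i)) v"
        by (metis monom_eval_add)
      moreover have "monom_eval (sg i k) v = v $ i ^ k" for k
      proof -
        have "monom_eval (sg i k) v = (\<Prod>j\<in>UNIV. if j = i then v $ i ^ k else 1)"
          unfolding monom_eval_def by (intro prod.cong) (auto simp: lookup_single when_def)
        then show ?thesis by simp
      qed
      ultimately show "eval (sg m 1) v = eval (sg (m - sg i (n i)) 1 * X i ^ n i) v" by simp
    qed
    moreover have "sg (m - sg i (n i)) 1 * X i ^ n i \<in> K" using n K by (auto simp: poly_ideal_def)
    ultimately show "sg m 1 * h \<in> jacobian_ideal f" by (simp add: K_def)
  qed
qed

subsection \<open>The tangent space of the orbit\<close>

text \<open>A linear functional reduces a polynomial in \<open>t\<close> with coefficients in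
  \<open>S\<close> to an ordinary one. It is applied to evaluation at a point and to extraction of a
  coefficient.\<close>

lemma poly_coeff_map:
  fixes ev :: "poly3 \<Rightarrow> complex"
  assumes add: "\<And>a b. ev (a + b) = ev a + ev b" and smul: "\<And>c a. ev (smul c a) = c * ev a"
  shows "((\<lambda>t. ev (poly Q (sg 0 t))) has_field_derivative ev (coeff Q 1)) (at 0)"
proof -
  have zero: "ev 0 = 0" using smul[of 0 0] by simp
  have sum: "ev (sum h A) = (\<Sum>a\<in>A. ev (h a))" for h :: "nat \<Rightarrow> poly3" and A
    by (induction A rule: infinite_finite_induct) (auto simp: add zero)
  define R where "R = (\<Sum>e\<le>Polynomial.degree Q. Polynomial.monom (ev (coeff Q e)) e)"
  have pow: "sg 0 t ^ e = sg 0 (t ^ e)" for t :: complex and e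
    by (induction e) (simp_all add: mult_single)
  have "ev (poly Q (sg 0 t)) = poly R t" for t
  proof -
    have "coeff Q e * sg 0 t ^ e = smul (t ^ e) (coeff Q e)" for e
      by (simp add: pow smul_def mult.commute)
    then show ?thesis by (simp add: poly_altdef[of Q] sum smul R_def poly_sum poly_monom mult.commute)
  qed
  moreover have "poly (pderiv R) 0 = ev (coeff Q 1)"
  proof -
    have "coeff R 1 = (\<Sum>e\<le>Polynomial.degree Q. if e = 1 then ev (coeff Q 1) else 0)"
      unfolding R_def coeff_sum by (intro sum.cong) auto
    also have "\<dots> = ev (coeff Q 1)" using coeff_eq_0[of Q 1] zero by auto
    finally show ?thesis by (simp add: poly_0_coeff_0 coeff_pderiv)
  qed
  ultimately show ?thesis using poly_DERIV[of R 0] by simp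
qed

text \<open>The Lie algebra action of \<open>B\<close>: the derivative of \<open>f\<close> along the
  linear vector field with value \<open>B v\<close> at \<open>v\<close>.\<close>

definition lie_deriv :: "complex ^ 3 ^ 3 \<Rightarrow> poly3 \<Rightarrow> poly3" where
  "lie_deriv B f = (\<Sum>i\<in>UNIV. (\<Sum>j\<in>UNIV. smul (B $ i $ j) (X j)) * pd i f)"

text \<open>The substituted polynomial is a polynomial \<open>Q\<close> in \<open>t\<close>, so
  differentiating its coefficients is formal. The linear coefficient of \<open>Q\<close> is
  identified by evaluating at every \<open>v\<close> and applying the chain rule along
  \<open>v + t B v\<close>.\<close>

lemma orbit_derivative:
  "((\<lambda>t. lk (lin_subst (\<chi> i j. (if i = j then 1 else 0) + t * B $ i $ j) f) m)
     has_field_derivative lk (lie_deriv B f) m) (at 0)"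
proof -
  let ?A = "\<lambda>t. \<chi> i j. (if i = j then 1 else 0) + t * B $ i $ j"
  define Y where "Y i = (\<Sum>j\<in>UNIV. smul (B $ i $ j) (X j))" for i
  define Q where "Q = (\<Sum>k\<in>Poly_Mapping.keys f. Polynomial.smult (sg 0 (lk f k)) (\<Prod>i\<in>UNIV. [:X i, Y i:] ^ lk k i))"
  have "(\<Sum>j\<in>UNIV. sg (sg j 1) (?A t $ i $ j)) = X i + sg 0 t * Y i" for t i
  proof (rule eval_inject)
    fix v
    have m1: "monom_eval (sg j 1) v = v $ j" for j using eval_X[of j v] by (simp add: X_def)
    have "eval (\<Sum>j\<in>UNIV. sg (sg j 1) (?A t $ i $ j)) v =
        (\<Sum>j\<in>UNIV. (if j = i then v $ i else 0) + t * (B $ i $ j * v $ j))"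
      unfolding eval_sum eval_single m1 by (intro sum.cong) (auto simp: algebra_simps)
    then show "eval (\<Sum>j\<in>UNIV. sg (sg j 1) (?A t $ i $ j)) v = eval (X i + sg 0 t * Y i) v"
      by (simp add: Y_def sum.distrib sum_distrib_left)
  qed
  then have Q: "lin_subst (?A t) f = poly Q (sg 0 t)" for t
    by (simp add: lin_subst_def Q_def poly_sum poly_prod smul_def)
  have "coeff Q 1 = lie_deriv B f"
  proof (rule eval_inject)
    fix v
    have "((\<lambda>t. eval (poly Q (sg 0 t)) v) has_field_derivative eval (coeff Q 1) v) (at 0)"
      by (rule poly_coeff_map) auto
    moreover have "eval (poly Q (sg 0 t)) v = eval f (v + t *s (B *v v))" for t
    proof -
      have "?A t *v v = v + t *s (B *v v)"
      proof (rule vec_eq_iff[THEN iffD2], rule allI)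
        fix i
        have "(?A t *v v) $ i = (\<Sum>j\<in>UNIV. (if j = i then v $ i else 0) + t * (B $ i $ j * v $ j))"
          unfolding matrix_vector_mult_def by (auto intro!: sum.cong simp: algebra_simps)
        then show "(?A t *v v) $ i = (v + t *s (B *v v)) $ i"
          by (simp add: sum.distrib matrix_vector_mult_def sum_distrib_left)
      qed
      then show ?thesis by (simp add: eval_lin_subst flip: Q)
    qed
    ultimately have "((\<lambda>t. eval f (v + t *s (B *v v))) has_field_derivative eval (coeff Q 1) v) (at 0)"
      by simp
    then have "eval (coeff Q 1) v = (\<Sum>i\<in>UNIV. (B *v v) $ i * eval (pd i f) v)"
      using has_derivative_eval DERIV_unique by blast
    then show "eval (coeff Q 1) v = eval (lie_deriv B f) v"
      by (simp add: lie_deriv_def matrix_vector_mult_def)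
  qed
  then show ?thesis
    unfolding Q using poly_coeff_map[of "\<lambda>a. lk a m" Q] by (simp add: lookup_add)
qed

lemma orbit_derivative_iff:
  "(\<forall>m. ((\<lambda>t. lk (lin_subst (\<chi> i j. (if i = j then 1 else 0) + t * B $ i $ j) f) m)
     has_field_derivative lk h m) (at 0)) \<longleftrightarrow> h = lie_deriv B f"
proof
  assume *: "\<forall>m. ((\<lambda>t. lk (lin_subst (\<chi> i j. (if i = j then 1 else 0) + t * B $ i $ j) f) m)
     has_field_derivative lk h m) (at 0)"
  show "h = lie_deriv B f"
    by (rule poly_mapping_eqI) (rule DERIV_unique[OF *[rule_format] orbit_derivative])
qed (simp add: orbit_derivative)

section \<open>Linear forms and the degree \<open>d\<close> part of the Jacobian ideal\<close>

lemma mdeg_1: "mdeg m = 1 \<Longrightarrow> \<exists>j. m = sg j 1"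
proof -
  assume m: "mdeg m = 1"
  then have "mdeg m \<noteq> 0" by simp
  then obtain j where j: "lk m j \<noteq> 0" unfolding mdeg_def by (meson sum.neutral)
  have "mdeg m = lk m j + (\<Sum>i\<in>UNIV - {j}. lk m i)"
    unfolding mdeg_def by (rule sum.remove) auto
  then have 1: "lk m j = 1" and 0: "(\<Sum>i\<in>UNIV - {j}. lk m i) = 0" using m j by linarith+
  have "lk m i = 0" if "i \<noteq> j" for i using 0 that by simp
  with 1 have "m = sg j 1" by (intro poly_mapping_eqI) (auto simp: lookup_single when_def)
  then show ?thesis by blast
qed

lemma homog_1_eq:
  assumes "p \<in> homog 1" shows "p = (\<Sum>j\<in>UNIV. smul (lk p (sg j 1)) (X j))"
proof (rule poly_mapping_eqI)
  fix m
  have inj: "sg j (1::nat) = sg i 1 \<longleftrightarrow> j = i" for i j :: 3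
    by (metis lookup_single_eq lookup_single_not_eq zero_neq_one)
  have "lk (\<Sum>j\<in>UNIV. smul (lk p (sg j 1)) (X j)) m = (\<Sum>j\<in>UNIV. if sg j 1 = m then lk p m else 0)"
    unfolding lookup_sum lookup_smul X_def by (intro sum.cong) (auto simp: lookup_single when_def)
  moreover have "(\<Sum>j\<in>UNIV. if sg j 1 = m then lk p m else 0) = lk p m"
  proof (cases "mdeg m = 1")
    case True
    then obtain i where i: "m = sg i 1" using mdeg_1 by blast
    show ?thesis unfolding i inj by simp
  next
    case False
    then have "lk p m = 0" using homogD[OF assms, of m] by auto
    then show ?thesis by (simp cong: if_cong)
  qed
  ultimately show "lk p m = lk (\<Sum>j\<in>UNIV. smul (lk p (sg j 1)) (X j)) m" by simp
qed

definition syz_map :: "poly3 \<Rightarrow> poly3 ^ 3 \<Rightarrow> poly3" where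
  "syz_map f a = (\<Sum>i\<in>UNIV. a $ i * pd i f)"

text \<open>Coefficients in \<open>J\<close> are arbitrary, but the partial derivatives have degree
  \<open>d - 1\<close>, so taking components leaves linear forms. The entries of \<open>B\<close>
  are the coefficients of these forms.\<close>

lemma jacobian_degree_d:
  assumes f: "f \<in> homog d" and d: "d > 0"
  shows "jacobian_ideal f \<inter> homog d = syz_map f ` {a. \<forall>i. a $ i \<in> homog 1}"
    and "jacobian_ideal f \<inter> homog d = range (\<lambda>B. lie_deriv B f)"
proof -
  obtain d' where d': "d = Suc d'" using d by (cases d) auto
  have pdh: "pd i f \<in> homog d'" for i using homog_pd[of f d' i] f by (simp add: d')
  show 1: "jacobian_ideal f \<inter> homog d = syz_map f ` {a. \<forall>i. a $ i \<in> homog 1}"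
  proof (intro equalityI subsetI)
    fix h assume h: "h \<in> jacobian_ideal f \<inter> homog d"
    then obtain a where a: "h = (\<Sum>i\<in>UNIV. a i * pd i f)" by (auto simp: jacobian_ideal_def)
    have "h = hcomp d h" using h by (simp add: hcomp_homog[of h d])
    also have "\<dots> = (\<Sum>i\<in>UNIV. hcomp 1 (a i) * pd i f)"
      unfolding a hcomp_sum using hcomp_mult[OF pdh, of 1] by (simp add: d')
    finally have "h = syz_map f (\<chi> i. hcomp 1 (a i))" by (simp add: syz_map_def)
    then show "h \<in> syz_map f ` {a. \<forall>i. a $ i \<in> homog 1}" by (intro image_eqI) auto
  next
    fix h assume "h \<in> syz_map f ` {a. \<forall>i. a $ i \<in> homog 1}"
    then obtain a where a: "h = syz_map f a" "\<And>i. a $ i \<in> homog 1" by blast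
    have "h \<in> jacobian_ideal f"
      unfolding a(1) syz_map_def jacobian_ideal_def by (intro CollectI exI[of _ "\<lambda>i. a $ i"]) simp
    moreover have "h \<in> homog d"
      unfolding a(1) syz_map_def using homog_mult[OF a(2) pdh] by (intro homog_sum) (simp add: d')
    ultimately show "h \<in> jacobian_ideal f \<inter> homog d" by simp
  qed
  show "jacobian_ideal f \<inter> homog d = range (\<lambda>B. lie_deriv B f)"
    unfolding 1
  proof (intro equalityI subsetI)
    fix h assume "h \<in> syz_map f ` {a. \<forall>i. a $ i \<in> homog 1}"
    then obtain a where a: "h = syz_map f a" "\<And>i. a $ i \<in> homog 1" by blast
    have "h = lie_deriv (\<chi> i j. lk (a $ i) (sg j 1)) f"
      unfolding a(1) syz_map_def lie_deriv_def using homog_1_eq[OF a(2)] by simp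
    then show "h \<in> range (\<lambda>B. lie_deriv B f)" by blast
  next
    fix h assume "h \<in> range (\<lambda>B. lie_deriv B f)"
    then obtain B where h: "h = lie_deriv B f" by blast
    then have "h = syz_map f (\<chi> i. \<Sum>j\<in>UNIV. smul (B $ i $ j) (X j))"
      by (simp add: syz_map_def lie_deriv_def)
    moreover have "(\<Sum>j\<in>UNIV. smul (B $ i $ j) (X j)) \<in> homog 1" for i
      by (intro homog_sum homog_smul homog_X)
    ultimately show "h \<in> syz_map f ` {a. \<forall>i. a $ i \<in> homog 1}" by (intro image_eqI) auto
  qed
qed

subsection \<open>Subspaces and quotients as vector space records\<close>

lemma complex_field: "Ring.field complex_field"
proof -
  have "cring complex_field"
  proof (rule cringI)
    show "abelian_group complex_field"
      by (rule abelian_groupI) (auto simp: complex_field_def intro: exI[of _ "- x" for x])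
    show "Group.comm_monoid complex_field"
      by (rule Group.comm_monoidI) (auto simp: complex_field_def)
  qed (auto simp: complex_field_def algebra_simps)
  then show ?thesis
  proof (rule cring.cring_fieldI2)
    show "\<exists>b\<in>carrier complex_field. a \<otimes>\<^bsub>complex_field\<^esub> b = \<one>\<^bsub>complex_field\<^esub>"
      if "a \<noteq> \<zero>\<^bsub>complex_field\<^esub>" for a
      using that by (intro bexI[of _ "inverse a"]) (auto simp: complex_field_def)
  qed (simp add: complex_field_def)
qed

lemma complex_field_simps [simp]:
  "carrier complex_field = UNIV" "one complex_field = 1" "zero complex_field = 0"
  "mult complex_field = (*)" "add complex_field = (+)"
  by (simp_all add: complex_field_def)

lemma vspace_simps [simp]:
  "carrier (vspace sc A) = A" "zero (vspace sc A) = 0" "add (vspace sc A) = (+)"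
  "smult (vspace sc A) = sc" "(vspace sc A)\<lparr>carrier := B\<rparr> = vspace sc B"
  by (simp_all add: vspace_def)

text \<open>A bridge between subspaces of a type and the module records of the definitions, kept
  generic because polynomials and triples of polynomials both need it.\<close>

locale complex_vs = vector_space sc for sc :: "complex \<Rightarrow> 'a::ab_group_add \<Rightarrow> 'a"
begin

lemma vspace_vectorspace:
  assumes A: "subspace A" shows "vectorspace complex_field (vspace sc A)"
  by (rule vs_criteria[OF complex_field])
     (use A subspace_neg[OF A] in \<open>auto simp: subspace_def scale_left_distrib scale_right_distrib
       add_ac intro!: bexI[of _ "- v" for v]\<close>)

text \<open>The coset \<open>W + v\<close>; it does not depend on the ambient space of the quotient.\<close>

definition cl :: "'a set \<Rightarrow> 'a \<Rightarrow> 'a set" where "cl W v = (\<lambda>w. w + v) ` W"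

definition quot :: "'a set \<Rightarrow> 'a set \<Rightarrow> (complex, 'a set) module" where
  "quot W A = \<lparr>carrier = cl W ` A, mult = undefined, one = undefined, zero = W,
     add = (\<lambda>X Y. {x + y | x y. x \<in> X \<and> y \<in> Y}), smult = (\<lambda>c X. \<Union>x\<in>X. cl W (sc c x))\<rparr>"

lemma coset_vspace: "W +>\<^bsub>vspace sc V\<^esub> v = cl W v"
  by (auto simp: a_r_coset_def' cl_def)

lemma quotient_space_eq: "quotient_space (vspace sc V) W = quot W V"
proof -
  have "a_rcosets\<^bsub>vspace sc V\<^esub> W = cl W ` V" 
    unfolding A_RCOSETS_defs a_r_coset_def[symmetric] coset_vspace by auto
  moreover have "set_add (vspace sc V) = (\<lambda>X Y. {x + y | x y. x \<in> X \<and> y \<in> Y})"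
    by (auto simp: fun_eq_iff set_add_def set_mult_def)
  ultimately show ?thesis by (simp add: quotient_space_def quot_def coset_vspace)
qed

text \<open>Tangent spaces are defined by shrinking the carrier of the tangent space of projective
  space; this makes such records quotients again.\<close>

lemma quot_carrier_update: "(quot W V)\<lparr>carrier := cl W ` A\<rparr> = quot W A"
  by (simp add: quot_def)

lemma quot_simps [simp]: "carrier (quot W A) = cl W ` A" "zero (quot W A) = W"
  by (simp_all add: quot_def)

lemma cl_eq_iff: "subspace W \<Longrightarrow> cl W v = cl W u \<longleftrightarrow> v - u \<in> W"
proof
  assume W: "subspace W" and "cl W v = cl W u"
  moreover have "v \<in> cl W v" using subspace_0[OF W] by (auto simp: cl_def intro: image_eqI[of _ _ 0])
  ultimately obtain w where "w \<in> W" "v = w + u" by (auto simp: cl_def)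
  then show "v - u \<in> W" by simp
next
  assume W: "subspace W" and "v - u \<in> W"
  then have "w + (v - u) \<in> W" "w - (v - u) \<in> W" if "w \<in> W" for w
    using that subspace_add subspace_diff by blast+
  then show "cl W v = cl W u"
    unfolding cl_def by (auto intro: image_eqI[of _ _ "w + (v - u)" for w] image_eqI[of _ _ "w - (v - u)" for w])
qed

lemma cl_eq_zero_iff: "subspace W \<Longrightarrow> cl W v = W \<longleftrightarrow> v \<in> W"
  using cl_eq_iff[of W v 0] by (simp add: cl_def)

lemma quot_add: "subspace W \<Longrightarrow> cl W u \<oplus>\<^bsub>quot W A\<^esub> cl W v = cl W (u + v)"
proof -
  assume W: "subspace W"
  have "{x + y | x y. x \<in> cl W u \<and> y \<in> cl W v} = cl W (u + v)"
  proof (intro equalityI subsetI)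
    fix z assume "z \<in> {x + y | x y. x \<in> cl W u \<and> y \<in> cl W v}"
    then obtain x y where xy: "x \<in> W" "y \<in> W" "z = (x + u) + (y + v)" by (auto simp: cl_def)
    then have "z = (x + y) + (u + v)" "x + y \<in> W" using subspace_add[OF W] by (auto simp: add_ac)
    then show "z \<in> cl W (u + v)" unfolding cl_def by blast
  next
    fix z assume "z \<in> cl W (u + v)"
    then obtain w where w: "w \<in> W" "z = w + (u + v)" by (auto simp: cl_def)
    then have "z = (w + u) + (0 + v)" by (simp add: add_ac)
    moreover have "w + u \<in> cl W u" "0 + v \<in> cl W v"
      using w(1) subspace_0[OF W] unfolding cl_def by blast+
    ultimately show "z \<in> {x + y | x y. x \<in> cl W u \<and> y \<in> cl W v}" by blast
  qed
  then show ?thesis by (simp add: quot_def)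
qed

lemma quot_smult: "subspace W \<Longrightarrow> c \<odot>\<^bsub>quot W A\<^esub> cl W v = cl W (sc c v)"
proof -
  assume W: "subspace W"
  have "cl W (sc c x) = cl W (sc c v)" if "x \<in> cl W v" for x
  proof -
    have "x - v \<in> W" using that by (auto simp: cl_def)
    then have "sc c (x - v) \<in> W" using subspace_scale[OF W] by blast
    then show ?thesis using cl_eq_iff[OF W] by (simp add: scale_right_diff_distrib)
  qed
  moreover have "v \<in> cl W v" using subspace_0[OF W] by (auto simp: cl_def intro: image_eqI[of _ _ 0])
  ultimately have "(\<Union>x\<in>cl W v. cl W (sc c x)) = cl W (sc c v)" by blast
  then show ?thesis by (simp add: quot_def)
qed

lemma quot_vectorspace:
  assumes W: "subspace W" and A: "subspace A" and sub: "W \<subseteq> A"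
  shows "vectorspace complex_field (quot W A)"
proof (rule vs_criteria[OF complex_field])
  note [simp] = quot_add[OF W] quot_smult[OF W]
  have W0: "W = cl W 0" using cl_eq_zero_iff[OF W, of 0] subspace_0[OF W] by simp
  have zero: "\<zero>\<^bsub>quot W A\<^esub> = cl W 0" using W0 by simp
  show "\<zero>\<^bsub>quot W A\<^esub> \<in> carrier (quot W A)"
    unfolding zero using subspace_0[OF A] by simp
  show "\<forall>v\<in>carrier (quot W A). \<exists>n\<in>carrier (quot W A). v \<oplus>\<^bsub>quot W A\<^esub> n = \<zero>\<^bsub>quot W A\<^esub>"
  proof
    fix v assume "v \<in> carrier (quot W A)"
    then obtain a where a: "v = cl W a" "a \<in> A" by auto
    then have "cl W (- a) \<in> carrier (quot W A)" "v \<oplus>\<^bsub>quot W A\<^esub> cl W (- a) = \<zero>\<^bsub>quot W A\<^esub>"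
      unfolding zero using subspace_neg[OF A] by auto
    then show "\<exists>n\<in>carrier (quot W A). v \<oplus>\<^bsub>quot W A\<^esub> n = \<zero>\<^bsub>quot W A\<^esub>" by blast
  qed
  show "\<forall>v\<in>carrier (quot W A). v \<oplus>\<^bsub>quot W A\<^esub> \<zero>\<^bsub>quot W A\<^esub> = v"
    unfolding zero by auto
qed (use subspace_add[OF A] subspace_scale[OF A] in
    \<open>auto simp: quot_add[OF W] quot_smult[OF W] add_ac scale_left_distrib scale_right_distrib\<close>)

section \<open>Linear maps, dimensions and exact sequences of quotients\<close>

lemma linear_mapI:
  assumes "vectorspace complex_field V" "vectorspace complex_field U"
    "\<And>v. v \<in> carrier V \<Longrightarrow> T v \<in> carrier U"
    "\<And>v w. v \<in> carrier V \<Longrightarrow> w \<in> carrier V \<Longrightarrow> T (v \<oplus>\<^bsub>V\<^esub> w) = T v \<oplus>\<^bsub>U\<^esub> T w"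
    "\<And>c v. v \<in> carrier V \<Longrightarrow> T (c \<odot>\<^bsub>V\<^esub> v) = c \<odot>\<^bsub>U\<^esub> T v"
  shows "linear_map complex_field V U T"
  using assms unfolding linear_map_def mod_hom_def mod_hom_axioms_def module_hom_def vectorspace_def
  by auto

lemma linear_map_cl:
  assumes W: "subspace W" and A: "subspace A" and sub: "W \<subseteq> A"
  shows "linear_map complex_field (vspace sc A) (quot W A) (cl W)"
  by (rule linear_mapI)
     (use vspace_vectorspace[OF A] quot_vectorspace[OF assms] in \<open>auto simp: quot_add[OF W] quot_smult[OF W]\<close>)

lemma finsum_vspace:
  assumes A: "subspace A" and "finite S" "\<And>x. x \<in> S \<Longrightarrow> h x \<in> A"
  shows "finsum (vspace sc A) h S = sum h S"
  using assms(2,3)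
proof (induction S rule: finite_induct)
  interpret V: vectorspace complex_field "vspace sc A" using vspace_vectorspace[OF A] .
  {
    case empty
    show ?case by simp
  next
    case (insert x S)
    then have "finsum (vspace sc A) h (insert x S) = h x \<oplus>\<^bsub>vspace sc A\<^esub> finsum (vspace sc A) h S"
      by (intro V.M.finsum_insert) auto
    then show ?case using insert by simp
  }
qed

lemma span_vspace:
  assumes A: "subspace A" and S: "finite S" "S \<subseteq> A"
  shows "LinearCombinations.module.span complex_field (vspace sc A) S = span S"
proof -
  interpret V: vectorspace complex_field "vspace sc A" using vspace_vectorspace[OF A] .
  have "V.lincomb a S = (\<Sum>v\<in>S. sc (a v) v)" for a
    unfolding V.lincomb_def
    by (subst finsum_vspace[OF A]) (use S subspace_scale[OF A] in auto)
  then show ?thesis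
    using V.finite_span[of S] S by (auto simp: span_finite)
qed

text \<open>The finite set \<open>T\<close> makes bases finite, where both notions of span agree;
  the dimension of a record is the least size of a finite generating set, and a basis attains
  it.\<close>

lemma dim_vspace:
  assumes A: "subspace A" and T: "finite T" "A \<subseteq> span T"
  shows "vectorspace.fin_dim complex_field (vspace sc A)"
    and "vectorspace.dim complex_field (vspace sc A) = dim A"
proof -
  interpret V: vectorspace complex_field "vspace sc A" using vspace_vectorspace[OF A] .
  obtain B where B: "B \<subseteq> A" "independent B" "A \<subseteq> span B" "card B = dim A"
    using basis_exists .
  have finB: "finite B" using independent_span_bound[OF T(1) B(2)] B(1) T(2) by blast
  have "span B = A" using B(1,3) span_minimal[OF B(1) A] by blast
  then have genB: "V.gen_set B" using span_vspace[OF A finB B(1)] by simp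
  then show "V.fin_dim" unfolding V.fin_dim_def using finB B(1) by auto
  show "V.dim = dim A"
    unfolding V.dim_def
  proof (rule Least_equality)
    show "\<exists>S. finite S \<and> card S = dim A \<and> S \<subseteq> carrier (vspace sc A) \<and> V.gen_set S"
      using finB B genB by auto
    fix n assume "\<exists>S. finite S \<and> card S = n \<and> S \<subseteq> carrier (vspace sc A) \<and> V.gen_set S"
    then obtain S where S: "finite S" "card S = n" "S \<subseteq> A" "V.gen_set S" by auto
    then have "span S = A" using span_vspace[OF A S(1,3)] by simp
    then show "dim A \<le> n" using independent_span_bound[OF S(1) B(2)] B S by auto
  qed
qed

lemma dim_pos:
  assumes A: "subspace A" and T: "finite T" "A \<subseteq> span T" and a: "a \<in> A" "a \<noteq> 0"
  shows "dim A > 0"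
proof (rule ccontr)
  obtain B where B: "B \<subseteq> A" "independent B" "A \<subseteq> span B" "card B = dim A"
    using basis_exists .
  have "finite B" using independent_span_bound[OF T(1) B(2)] B(1) T(2) by blast
  moreover assume "\<not> dim A > 0"
  ultimately have "B = {}" using B(4) by simp
  then show False using B(3) a by auto
qed

text \<open>Rank and nullity for the projection \<open>cl W\<close>, which is onto and has kernel
  \<open>W\<close>.\<close>

lemma dim_quot:
  assumes W: "subspace W" and A: "subspace A" and sub: "W \<subseteq> A" and T: "finite T" "A \<subseteq> span T"
  shows "vectorspace.fin_dim complex_field (quot W A)"
    and "vectorspace.dim complex_field (quot W A) + dim W = dim A"
proof -
  interpret p: linear_map complex_field "vspace sc A" "quot W A" "cl W"
    by (rule linear_map_cl[OF W A sub])
  have fd: "p.V.fin_dim" by (rule dim_vspace(1)[OF A T])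
  show "vectorspace.fin_dim complex_field (quot W A)"
    using p.rank_nullity_main(2)[OF fd] by simp
  have im: "(quot W A)\<lparr>carrier := p.im\<rparr> = quot W A" by (simp add: p.im_def quot_def)
  have "p.ker = W" using sub by (auto simp: p.ker_def cl_eq_zero_iff[OF W])
  then have "vectorspace.dim complex_field (quot W A) + vectorspace.dim complex_field (vspace sc W) =
      vectorspace.dim complex_field (vspace sc A)"
    using p.rank_nullity_main(1)[OF fd] im by simp
  then show "vectorspace.dim complex_field (quot W A) + dim W = dim A"
    using dim_vspace(2)[OF A T] dim_vspace(2)[OF W T(1)] sub T(2) by simp
qed

text \<open>The third isomorphism theorem: \<open>A / W\<close> modulo \<open>J / W\<close> is
  \<open>A / J\<close>.\<close>

lemma short_exact_quot:
  assumes W: "subspace W" and J: "subspace J" and A: "subspace A" and sub: "W \<subseteq> J" "J \<subseteq> A"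
  shows "\<exists>p. short_exact (quot W J) (quot W A) (quot J A) (\<lambda>X. X) p"
proof -
  \<comment> \<open>As \<open>W\<close> lies in \<open>J\<close>, the \<open>J\<close>-cosets of all
    elements of a \<open>W\<close>-coset coincide, so the union is one coset and no representative
    has to be chosen.\<close>
  define p where "p X = (\<Union>x\<in>X. cl J x)" for X
  have p: "p (cl W v) = cl J v" for v
  proof -
    have "cl J x = cl J v" if "x \<in> cl W v" for x
      using that sub(1) cl_eq_iff[OF J] by (auto simp: cl_def)
    moreover have "v \<in> cl W v" using subspace_0[OF W] by (auto simp: cl_def intro: image_eqI[of _ _ 0])
    ultimately show ?thesis unfolding p_def by blast
  qed
  have WA: "W \<subseteq> A" using sub by blast
  have "linear_map complex_field (quot W J) (quot W A) (\<lambda>X. X)"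
    by (rule linear_mapI[OF quot_vectorspace[OF W J sub(1)] quot_vectorspace[OF W A WA]])
       (use sub in \<open>auto simp: quot_add[OF W] quot_smult[OF W]\<close>)
  moreover have "linear_map complex_field (quot W A) (quot J A) p"
    by (rule linear_mapI[OF quot_vectorspace[OF W A WA] quot_vectorspace[OF J A sub(2)]])
       (auto simp: quot_add[OF W] quot_smult[OF W] quot_add[OF J] quot_smult[OF J] p)
  moreover have "p v = J \<longleftrightarrow> v \<in> cl W ` J" if v: "v \<in> cl W ` A" for v
  proof -
    obtain a where a: "v = cl W a" "a \<in> A" using v by blast
    have "a \<in> J" if b: "cl W a = cl W b" "b \<in> J" for b
    proof -
      have "a - b \<in> J" using b(1) cl_eq_iff[OF W] sub(1) by blast
      then have "a - b + b \<in> J" using b(2) subspace_add[OF J] by blast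
      then show ?thesis by simp
    qed
    then show ?thesis using a cl_eq_zero_iff[OF J, of a] by (auto simp: p)
  qed
  then have "cl W ` J = {v \<in> cl W ` A. p v = J}" using sub(2) by blast
  moreover have "p ` cl W ` A = cl J ` A" by (auto simp: p image_image)
  ultimately show ?thesis unfolding short_exact_def by (intro exI[of _ p]) (simp add: inj_on_def)
qed

end

interpretation S: complex_vs smul ..

interpretation S3: complex_vs "\<lambda>c (a :: poly3 ^ 3). \<chi> i. smul c (a $ i)"
  by unfold_locales
     (simp_all add: vec_eq_iff poly3.scale_left_distrib poly3.scale_right_distrib)

subsection \<open>Dimensions\<close>

lemma homog_subset_span: "homog d \<subseteq> poly3.span ((\<lambda>m. sg m 1) ` {m. mdeg m \<le> d})"
proof
  fix g assume g: "g \<in> homog d"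
  have "(\<Sum>m\<in>Poly_Mapping.keys g. smul (lk g m) (sg m 1)) \<in> poly3.span ((\<lambda>m. sg m 1) ` {m. mdeg m \<le> d})"
    using g by (intro poly3.span_sum poly3.span_scale poly3.span_base) (auto simp: homog_def)
  then show "g \<in> poly3.span ((\<lambda>m. sg m 1) ` {m. mdeg m \<le> d})"
    by (simp add: smul_def mult_single sum_singles)
qed

abbreviation "sc3 \<equiv> \<lambda>c (a :: poly3 ^ 3). \<chi> i. smul c (a $ i)"

definition homog3 :: "nat \<Rightarrow> (poly3 ^ 3) set" where "homog3 k = {a. \<forall>i. a $ i \<in> homog k}"

lemma subspace_homog3: "S3.subspace (homog3 k)"
  by (rule S3.subspaceI) (auto simp: homog3_def intro: homog_add homog_smul)

text \<open>The triples with a single monomial entry form a basis. Extraction of coefficients,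
  \<open>lkE\<close>, gives both independence and generation.\<close>

lemma homog3_basis:
  obtains B where "finite B" "S3.independent B" "B \<subseteq> homog3 k" "homog3 k \<subseteq> S3.span B"
    "card B = 3 * card {m :: 3 \<Rightarrow>\<^sub>0 nat. mdeg m = k}"
proof -
  define M where "M = (UNIV :: 3 set) \<times> {m. mdeg m = k}"
  have "finite {m. mdeg m = k}" by (rule finite_subset[OF _ finite_mdeg_le[of k]]) auto
  then have finM: "finite M" and cardM: "card M = 3 * card {m :: 3 \<Rightarrow>\<^sub>0 nat. mdeg m = k}"
    by (simp_all add: M_def card_cartesian_product)
  define E where "E = (\<lambda>p. (\<chi> i. if i = fst p then sg (snd p) 1 else 0) :: poly3 ^ 3)"
  have lkE: "lk ((\<Sum>p\<in>M. sc3 (c p) (E p)) $ i) n = (if mdeg n = k then c (i, n) else 0)" for c i n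
  proof -
    have "lk ((\<Sum>p\<in>M. sc3 (c p) (E p)) $ i) n = (\<Sum>p\<in>M. if p = (i, n) then c (i, n) else 0)"
      unfolding sum_component lookup_sum
      by (intro sum.cong) (auto simp: E_def lookup_single when_def)
    then show ?thesis using finM by (simp add: M_def)
  qed
  have inj: "inj_on E M"
  proof (rule inj_onI)
    fix p p' assume "E p = E p'"
    then have "lk (E p $ fst p) (snd p) = lk (E p' $ fst p) (snd p)" by simp
    then show "p = p'" by (auto simp: E_def lookup_single when_def prod_eq_iff split: if_splits)
  qed
  have ind: "S3.independent (E ` M)"
  proof
    assume "S3.dependent (E ` M)"
    then obtain u p where u: "p \<in> M" "u (E p) \<noteq> 0" "(\<Sum>v\<in>E ` M. sc3 (u v) v) = 0"
      using S3.dependent_finite[of "E ` M"] finM by auto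
    have "(\<Sum>p\<in>M. sc3 (u (E p)) (E p)) = 0" using u(3) by (simp add: sum.reindex[OF inj])
    then have "lk ((\<Sum>p\<in>M. sc3 (u (E p)) (E p)) $ fst p) (snd p) = 0" by simp
    then show False using u(1,2) unfolding lkE by (simp add: M_def mem_Times_iff)
  qed
  have sub: "E ` M \<subseteq> homog3 k"
    by (auto simp: E_def M_def homog3_def intro: homog_single)
  have span: "homog3 k \<subseteq> S3.span (E ` M)"
  proof
    fix a assume a: "a \<in> homog3 k"
    have "a = (\<Sum>p\<in>M. sc3 (lk (a $ fst p) (snd p)) (E p))"
    proof (rule vec_eq_iff[THEN iffD2], intro allI poly_mapping_eqI)
      fix i n
      have "lk (a $ i) n = 0" if "mdeg n \<noteq> k"
        using a homogD[of "a $ i" k n] that by (auto simp: homog3_def)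
      then show "lk (a $ i) n = lk ((\<Sum>p\<in>M. sc3 (lk (a $ fst p) (snd p)) (E p)) $ i) n"
        unfolding lkE by simp
    qed
    also have "\<dots> \<in> S3.span (E ` M)"
      by (intro S3.span_sum S3.span_scale S3.span_base) simp
    finally show "a \<in> S3.span (E ` M)" .
  qed
  show thesis
    by (rule that[OF _ ind sub span]) (simp_all add: finM card_image[OF inj] cardM)
qed

lemma dim_homog3_1: "S3.dim (homog3 1) = 9"
proof -
  obtain B where B: "S3.independent B" "B \<subseteq> homog3 1" "homog3 1 \<subseteq> S3.span B"
    "card B = 3 * card {m :: 3 \<Rightarrow>\<^sub>0 nat. mdeg m = 1}"
    by (rule homog3_basis[of 1]) blast
  have "{m. mdeg m = 1} = range (\<lambda>j. sg j 1)" using mdeg_1 by auto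
  moreover have "inj (\<lambda>j :: 3. sg j (1::nat))"
    by (rule injI) (metis lookup_single_eq lookup_single_not_eq zero_neq_one)
  ultimately have "card {m :: 3 \<Rightarrow>\<^sub>0 nat. mdeg m = 1} = 3" by (simp add: card_image)
  then show ?thesis using S3.dim_unique[OF B(2,3,1)] B(4) by simp
qed

lemma AR_eq: "AR f k = {a \<in> homog3 k. syz_map f a = 0}"
  by (auto simp: AR_def homog3_def syz_map_def)

lemma syz_map_add: "syz_map f (a + a') = syz_map f a + syz_map f a'"
  and syz_map_scale: "syz_map f (sc3 c a) = smul c (syz_map f a)"
  by (simp_all add: syz_map_def distrib_right sum.distrib smul_def sum_distrib_left mult.assoc)

lemma subspace_AR: "S3.subspace (AR f k)"
  by (rule S3.subspaceI)
     (use S3.subspace_add[OF subspace_homog3[of k]] S3.subspace_scale[OF subspace_homog3[of k]]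
        S3.subspace_0[OF subspace_homog3[of k]]
      in \<open>auto simp: AR_eq syz_map_add syz_map_scale\<close>, simp add: syz_map_def)

lemma AR_dim: "ar f k = S3.dim (AR f k)"
proof -
  obtain B where B: "finite B" "homog3 k \<subseteq> S3.span B" by (rule homog3_basis[of k]) blast
  have "AR f k \<subseteq> S3.span B" using B(2) by (auto simp: AR_eq)
  then show ?thesis unfolding ar_def using S3.dim_vspace(2)[OF subspace_AR B(1)] by simp
qed

text \<open>If \<open>f\<close> is constant, all its partial derivatives vanish, so every triple of
  constants is a syzygy and \<open>mdr f = 0\<close>.\<close>

lemma mdr_pos_imp:
  assumes f: "f \<in> homog d" and mdr: "mdr f > 0" shows "d > 0"
proof (rule ccontr)
  assume "\<not> d > 0"
  then have d: "d = 0" by simp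
  have "pd i f = 0" for i
  proof (rule poly_mapping_eqI)
    fix m show "lk (pd i f) m = lk 0 m"
      using homogD[OF f, of "m + sg i 1"] d by (auto simp: lookup_pd)
  qed
  then have AR: "AR f 0 = homog3 0" by (auto simp: AR_eq syz_map_def)
  obtain B where B: "finite B" "homog3 0 \<subseteq> S3.span B" by (rule homog3_basis[of 0]) blast
  have "(\<chi> i. 1) \<in> homog3 0" "(\<chi> i. (1 :: poly3)) \<noteq> (0 :: poly3 ^ 3)"
    by (auto simp: homog3_def vec_eq_iff)
  then have "ar f 0 > 0"
    unfolding AR_dim AR using S3.dim_pos[OF subspace_homog3 B] by blast
  then have "mdr f = 0" unfolding mdr_def by (simp add: Least_eq_0)
  then show False using mdr by simp
qed

lemma subspace_jacobian_degree: "poly3.subspace (jacobian_ideal f \<inter> homog d)"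
  by (intro poly3.subspace_inter subspace_homog poly3.subspaceI)
     (auto intro: jacobian_0 jacobian_add jacobian_smul)

lemma dim_jacobian_degree_d:
  assumes f: "f \<in> homog d" and d: "d > 0"
  shows "poly3.dim (jacobian_ideal f \<inter> homog d) + ar f 1 = 9"
proof -
  let ?J = "jacobian_ideal f \<inter> homog d"
  obtain B where B: "finite B" "homog3 1 \<subseteq> S3.span B" by (rule homog3_basis[of 1]) blast
  have J: "?J = syz_map f ` homog3 1" using jacobian_degree_d(1)[OF f d] by (simp add: homog3_def)
  interpret p: linear_map complex_field "vspace sc3 (homog3 1)" "vspace smul ?J" "syz_map f"
    by (rule S.linear_mapI[OF S3.vspace_vectorspace[OF subspace_homog3]
          S.vspace_vectorspace[OF subspace_jacobian_degree]])
       (unfold J, auto simp: syz_map_add syz_map_scale)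
  have "p.im = ?J" unfolding p.im_def vspace_simps by (rule J[symmetric])
  moreover have "p.ker = AR f 1" unfolding p.ker_def AR_eq by simp
  ultimately have "vectorspace.dim complex_field (vspace smul ?J) +
      vectorspace.dim complex_field (vspace sc3 (AR f 1)) =
      vectorspace.dim complex_field (vspace sc3 (homog3 1))"
    using p.rank_nullity_main(1)[OF S3.dim_vspace(1)[OF subspace_homog3 B]] by simp
  moreover have "vectorspace.dim complex_field (vspace smul ?J) = poly3.dim ?J"
    by (rule S.dim_vspace(2)[OF subspace_jacobian_degree, of "(\<lambda>m. sg m 1) ` {m. mdeg m \<le> d}"])
       (use homog_subset_span[of d] finite_mdeg_le[of d] in auto)
  moreover have "vectorspace.dim complex_field (vspace sc3 (homog3 1)) = 9"
    using S3.dim_vspace(2)[OF subspace_homog3 B] dim_homog3_1 by simp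
  ultimately show ?thesis by (simp add: ar_def)
qed

subsection \<open>The tangent space of the stratum\<close>

lemma holo_axis:
  assumes g: "holo n g" "i < n" "g (\<lambda>_. 0) = 0"
  obtains Q where "holo 1 Q" "near0 1 (\<lambda>z. g ((\<lambda>_. 0)(i := z 0)) = z 0 * Q z)" "Q (\<lambda>_. 0) = partial0 i g"
proof -
  let ?e = "\<lambda>z::cvec. (\<lambda>_. 0)(i := z 0) :: cvec"
  have G: "holo 1 (\<lambda>z. g (?e z))" by (rule holo_compose[OF g(1)]) auto
  have v: "near0 1 (\<lambda>z. g (?e (z(0 := 0))) = 0)" using g(3) by (intro near0_True) (simp add: fun_upd_idem)
  obtain Q where Q: "holo 1 Q" "near0 1 (\<lambda>z. g (?e z) = z 0 * Q z)"
    by (rule holo_divide_vanishing[OF G _ v], simp, rule that)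
  moreover have "partial0 i g = Q (\<lambda>_. 0)"
    by (rule partial0_eqI[OF Q(1)]) (use Q(2) g(3) in simp)
  ultimately show thesis by (intro that) auto
qed

text \<open>Generators vanish at 0, so in the product rule only the values of the coefficients at 0
  survive: differentials of ideal members are combinations of those of the generators.\<close>

lemma partial0_germ_ideal:
  assumes h: "h \<in> germ_ideal n Gs" and Gs: "\<And>g. g \<in> Gs \<Longrightarrow> holo n g \<and> g (\<lambda>_. 0) = 0"
    and v: "\<And>g. g \<in> Gs \<Longrightarrow> (\<Sum>i<n. partial0 i g * v i) = 0"
  shows "(\<Sum>i<n. partial0 i h * v i) = 0"
proof -
  obtain k :: nat and a g where ag: "\<And>l. l < k \<Longrightarrow> holo n (a l) \<and> g l \<in> Gs"
    and hs: "near0 n (\<lambda>s. h s = (\<Sum>l<k. a l s * g l s))"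
    using h unfolding germ_ideal_def by blast
  have "g l (\<lambda>_. 0) = 0" if "l < k" for l using ag[OF that] Gs by blast
  then have h0: "h (\<lambda>_. 0) = 0" using near0_at_0[OF hs, of "\<lambda>_. 0"] by simp
  have "partial0 i h = (\<Sum>l<k. a l (\<lambda>_. 0) * partial0 i (g l))" if i: "i < n" for i
  proof -
    let ?e = "\<lambda>z::cvec. (\<lambda>_. 0)(i := z 0) :: cvec"
    have "\<exists>Q. holo 1 Q \<and> near0 1 (\<lambda>z. g l (?e z) = z 0 * Q z) \<and> Q (\<lambda>_. 0) = partial0 i (g l)"
      if "l < k" for l
    proof (rule holo_axis[of n "g l" i])
      show "holo n (g l)" "g l (\<lambda>_. 0) = 0" using ag[OF that] Gs by auto
    qed (use i in blast)+
    then have "\<forall>l\<in>{..<k}. \<exists>Q. holo 1 Q \<and> near0 1 (\<lambda>z. g l (?e z) = z 0 * Q z) \<and> Q (\<lambda>_. 0) = partial0 i (g l)"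
      by simp
    from bchoice[OF this] obtain Q where "\<forall>l\<in>{..<k}. holo 1 (Q l) \<and>
        near0 1 (\<lambda>z. g l (?e z) = z 0 * Q l z) \<and> Q l (\<lambda>_. 0) = partial0 i (g l)" ..
    then have Q: "\<And>l. l < k \<Longrightarrow> holo 1 (Q l)" "\<And>l. l < k \<Longrightarrow> near0 1 (\<lambda>z. g l (?e z) = z 0 * Q l z)"
      "\<And>l. l < k \<Longrightarrow> Q l (\<lambda>_. 0) = partial0 i (g l)" by simp_all
    define R where "R z = (\<Sum>l<k. a l (?e z) * Q l z)" for z
    have "holo 1 (\<lambda>z. a l (?e z))" if "l < k" for l
      by (rule holo_compose[of n "a l"]) (use ag that in auto)
    then have R: "holo 1 R" unfolding R_def[abs_def] using Q(1) by auto
    have hs': "near0 1 (\<lambda>z. h (?e z) = (\<Sum>l<k. a l (?e z) * g l (?e z)))"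
      by (rule near0_compose[where \<Phi> = ?e, OF hs]) auto
    have gQ: "near0 1 (\<lambda>z. \<forall>l<k. g l (?e z) = z 0 * Q l z)" by (rule near0_all) (rule Q(2))
    have "near0 1 (\<lambda>z. h (?e z) = h (\<lambda>_. 0) + z 0 * R z)"
      using near0_conj[OF hs' gQ]
      by (rule near0_mono) (simp add: h0 R_def sum_distrib_left mult.left_commute)
    then have "partial0 i h = R (\<lambda>_. 0)" by (rule partial0_eqI[OF R])
    then show ?thesis using Q(3) by (simp add: R_def fun_upd_idem)
  qed
  then have "(\<Sum>i<n. partial0 i h * v i) = (\<Sum>i<n. \<Sum>l<k. a l (\<lambda>_. 0) * (partial0 i (g l) * v i))"
    by (simp add: sum_distrib_right mult.assoc)
  also have "\<dots> = (\<Sum>l<k. a l (\<lambda>_. 0) * (\<Sum>i<n. partial0 i (g l) * v i))"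
    by (subst sum.swap) (simp add: sum_distrib_left)
  also have "\<dots> = 0" using v ag by simp
  finally show ?thesis .
qed

lemma germ_ideal_gen: "g \<in> Gs \<Longrightarrow> holo n g \<Longrightarrow> g \<in> germ_ideal n Gs"
  unfolding germ_ideal_def
  by (intro CollectI conjI exI[of _ 1] exI[of _ "\<lambda>_ _. 1"] exI[of _ "\<lambda>_. g"])
     (auto intro: near0_True)

text \<open>Tangency means that the differentials of all \<open>\<phi> j\<close> kill
  \<open>v\<close>. By \<open>kodaira_spencer\<close> this puts the direction into each Tjurina
  ideal; conversely, membership leaves a relation among base derivatives, and
  \<open>miniversal_independent\<close> makes its coefficients vanish.\<close>

lemma zariski_tangent_iff_tjurina_at:
  assumes qs: "\<And>j. j < length qs \<Longrightarrow> miniversal (local_eq (qs ! j) f) (\<tau> j) (F j) \<and>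
      induced_by (dim_PN d) (\<lambda>z. local_eq (qs ! j) (universal_family d f b (param z)) z) (\<tau> j) (F j) (\<phi> j)"
    and I: "I = germ_ideal (dim_PN d) {\<lambda>s. \<phi> j s i | j i. j < length qs \<and> i < \<tau> j}"
    and v: "\<And>i. i \<ge> dim_PN d \<Longrightarrow> v i = 0"
  shows "v \<in> zariski_tangent (dim_PN d) I \<longleftrightarrow>
    (\<forall>q\<in>set qs. tjurina_at q f (\<Sum>i<dim_PN d. smul (v i) (b i)))"
proof -
  define h where "h = (\<Sum>i<dim_PN d. smul (v i) (b i))"
  define d\<phi> where "d\<phi> j l = (\<Sum>i<dim_PN d. v i * partial0 i (\<lambda>s. \<phi> j s l))" for j l
  let ?Gs = "{\<lambda>s. \<phi> j s i | j i. j < length qs \<and> i < \<tau> j}"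
  have \<phi>: "holo (dim_PN d) (\<lambda>s. \<phi> j s l)" "\<phi> j (\<lambda>_. 0) l = 0" if "j < length qs" "l < \<tau> j" for j l
    using qs[OF that(1)] that(2) unfolding induced_by_def by blast+
  have zt: "v \<in> zariski_tangent (dim_PN d) I \<longleftrightarrow> (\<forall>j<length qs. \<forall>l<\<tau> j. d\<phi> j l = 0)"
  proof
    assume "v \<in> zariski_tangent (dim_PN d) I"
    then have "(\<Sum>i<dim_PN d. partial0 i g * v i) = 0" if "g \<in> ?Gs" for g
      using that germ_ideal_gen[of g ?Gs "dim_PN d"] \<phi> unfolding zariski_tangent_def I by blast
    then show "\<forall>j<length qs. \<forall>l<\<tau> j. d\<phi> j l = 0" unfolding d\<phi>_def by (force simp: mult.commute)
  next
    assume *: "\<forall>j<length qs. \<forall>l<\<tau> j. d\<phi> j l = 0"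
    have "(\<Sum>i<dim_PN d. partial0 i h * v i) = 0" if "h \<in> I" for h
      by (rule partial0_germ_ideal[OF that[unfolded I]])
         (use \<phi> * in \<open>auto simp: d\<phi>_def mult.commute\<close>)
    then show "v \<in> zariski_tangent (dim_PN d) I" using v by (simp add: zariski_tangent_def)
  qed
  have "(\<forall>l<\<tau> j. d\<phi> j l = 0) \<longleftrightarrow> tjurina_at (qs ! j) f h" if j: "j < length qs" for j
  proof -
    define q where "q = qs ! j"
    have mini: "miniversal (local_eq q f) (\<tau> j) (F j)" using qs[OF j] by (simp add: q_def)
    have FF: "holo (2 + \<tau> j) (F j)" and F0: "near0 2 (\<lambda>x. F j (join x (\<lambda>_. 0)) = local_eq q f x)"
      using mini[unfolded miniversal_def, THEN conjunct1] unfolding deformation_def by blast+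
    obtain D where D: "first_order (\<tau> j) (F j) D" using first_order_exists[OF FF] by blast
    have D0: "near0 2 (\<lambda>x. local_pd q f 2 x = D 0 x)" and D1: "near0 2 (\<lambda>x. local_pd q f 3 x = D 1 x)"
      using first_order_local_pd[OF D F0, of 0] first_order_local_pd[OF D F0, of 1] by simp_all
    have at_iff: "tjurina_at q f h \<longleftrightarrow> tjurina (local_eq q f) (D 0) (D 1) (local_eq q h)"
      unfolding tjurina_at_def
    proof
      assume "tjurina (local_eq q f) (local_pd q f 2) (local_pd q f 3) (local_eq q h)"
      then show "tjurina (local_eq q f) (D 0) (D 1) (local_eq q h)"
        by (rule tjurina_cong) (use D0 D1 in \<open>auto simp: eq_commute intro: near0_True\<close>)
    next
      assume "tjurina (local_eq q f) (D 0) (D 1) (local_eq q h)"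
      then show "tjurina (local_eq q f) (local_pd q f 2) (local_pd q f 3) (local_eq q h)"
        by (rule tjurina_cong) (use D0 D1 in \<open>auto intro: near0_True\<close>)
    qed
    \<comment> \<open>The universal family is affine in the chart coordinates: along
      \<open>s v\<close> it is exactly \<open>f + s h\<close>.\<close>
    have G: "near0 3 (\<lambda>z. local_eq q (universal_family d f b (param (join z (\<lambda>i. z 2 * v i)))) (join z (\<lambda>i. z 2 * v i))
        = local_eq q f z + z 2 * local_eq q h z)"
      by (rule near0_True)
         (simp add: local_eq_def universal_family_def h_def join_def[of _ "\<lambda>i. _ * v i"] param_def
           sum_distrib_left mult.assoc)
    have ks: "tjurina (local_eq q f) (D 0) (D 1) (\<lambda>x. local_eq q h x - (\<Sum>l<\<tau> j. d\<phi> j l * D (2 + l) x))"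
      unfolding d\<phi>_def
      by (rule kodaira_spencer[OF FF D F0 _ _ _ G])
         (use qs[OF j] in \<open>auto simp: q_def intro: holo_local_eq\<close>)
    show ?thesis
    proof
      assume "\<forall>l<\<tau> j. d\<phi> j l = 0"
      then show "tjurina_at (qs ! j) f h" using ks at_iff by (simp add: q_def)
    next
      assume "tjurina_at (qs ! j) f h"
      then have th: "tjurina (local_eq q f) (D 0) (D 1) (local_eq q h)" using at_iff by (simp add: q_def)
      have "tjurina (local_eq q f) (D 0) (D 1) (\<lambda>x. local_eq q h x +
          (-1) * (local_eq q h x - (\<Sum>l<\<tau> j. d\<phi> j l * D (2 + l) x)))"
        using ks by (intro tjurina_add[OF th] tjurina_mult) auto
      then have "tjurina (local_eq q f) (D 0) (D 1) (\<lambda>x. \<Sum>l<\<tau> j. d\<phi> j l * D (2 + l) x)" by simp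
      then show "\<forall>l<\<tau> j. d\<phi> j l = 0"
        using miniversal_independent[OF mini D] by blast
    qed
  qed
  then show ?thesis unfolding zt h_def[symmetric] by (metis in_set_conv_nth)
qed

subsection \<open>The exact sequence\<close>

lemma PN_chart_spans:
  assumes chart: "PN_chart d f b"
  shows "\<And>i. i < dim_PN d \<Longrightarrow> b i \<in> homog d"
    and "h \<in> homog d \<Longrightarrow> \<exists>c v. (\<forall>i\<ge>dim_PN d. v i = 0) \<and> h = smul c f + (\<Sum>i<dim_PN d. smul (v i) (b i))"
proof -
  let ?B = "insert f (b ` {..<dim_PN d})"
  interpret V: vectorspace complex_field "vspace smul (homog d)"
    by (rule S.vspace_vectorspace[OF subspace_homog])
  have B: "V.gen_set ?B" "?B \<subseteq> homog d" and inj: "inj_on b {..<dim_PN d}" and fb: "f \<notin> b ` {..<dim_PN d}"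
    using chart by (auto simp: PN_chart_def V.basis_def)
  show "\<And>i. i < dim_PN d \<Longrightarrow> b i \<in> homog d" using B(2) by auto
  assume "h \<in> homog d"
  then have "h \<in> poly3.span ?B" using S.span_vspace[OF subspace_homog _ B(2)] B(1) by simp
  then obtain u where "h = (\<Sum>v\<in>?B. smul (u v) v)" by (auto simp: poly3.span_finite)
  then have "h = smul (u f) f + (\<Sum>i<dim_PN d. smul (u (b i)) (b i))"
    using fb by (simp add: sum.reindex[OF inj])
  then show "\<exists>c v. (\<forall>i\<ge>dim_PN d. v i = 0) \<and> h = smul c f + (\<Sum>i<dim_PN d. smul (v i) (b i))"
    by (intro exI[of _ "u f"] exI[of _ "\<lambda>i. if i < dim_PN d then u (b i) else 0"]) simp
qed

lemma tjurina_at_add: "tjurina_at q f h \<Longrightarrow> tjurina_at q f h' \<Longrightarrow> tjurina_at q f (h + h')"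
  unfolding tjurina_at_def local_eq_def[abs_def] eval_add by (rule tjurina_add)

lemma tjurina_at_smul: "tjurina_at q f h \<Longrightarrow> tjurina_at q f (smul c h)"
  unfolding tjurina_at_def local_eq_def[abs_def] eval_smul by (rule tjurina_mult) auto

lemma tjurina_at_0: "tjurina_at q f 0"
  unfolding tjurina_at_def local_eq_def[abs_def] by (simp add: tjurina_0)

theorem theorem3p3:
  fixes d :: nat and f :: poly3 and S :: "(cvec \<Rightarrow> complex) list"
    and b :: "nat \<Rightarrow> poly3" and I :: "(cvec \<Rightarrow> complex) set"
  assumes "f \<in> homog d" and "f \<noteq> 0" and "squarefree f"
    and "mdr f > 0"
    and "f \<in> V_ea d S"
    and "V_ea_germ d S f b I"
  shows "(\<exists>p. short_exact (T_orbit d f) (T_V_ea d f b I) (jacobian_module f d) (\<lambda>X. X) p) \<and>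
    vectorspace.fin_dim complex_field (T_V_ea d f b I) \<and>
    int (vectorspace.dim complex_field (T_V_ea d f b I)) = 8 - int (ar f 1) + int (n_jac f d)"
proof -
  note f = assms(1)
  have d: "d > 0" using mdr_pos_imp[OF f assms(4)] .
  have chart: "PN_chart d f b" using assms(6) by (simp add: V_ea_germ_def)
  obtain qs \<tau> F \<phi> where qs: "singular_frames f qs"
    "\<And>j. j < length qs \<Longrightarrow> miniversal (local_eq (qs ! j) f) (\<tau> j) (F j) \<and>
      induced_by (dim_PN d) (\<lambda>z. local_eq (qs ! j) (universal_family d f b (param z)) z) (\<tau> j) (F j) (\<phi> j)"
    and I: "I = germ_ideal (dim_PN d) {\<lambda>s. \<phi> j s i | j i. j < length qs \<and> i < \<tau> j}"
    using assms(6) unfolding V_ea_germ_def by blast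
  define J where "J = jacobian_ideal f \<inter> homog d"
  define A where "A = saturation (jacobian_ideal f) \<inter> homog d"
  define W where "W = range (\<lambda>c. smul c f)"
  \<comment> \<open>Here the global description of the tangent directions, by saturation, meets the
    local one, by Tjurina ideals.\<close>
  have A_iff: "h \<in> A \<longleftrightarrow> h \<in> homog d \<and> (\<forall>q\<in>set qs. tjurina_at q f h)" for h
  proof -
    have "frame q" if "q \<in> set qs" for q
      using qs(1) that by (auto simp: singular_frames_def frame_def)
    then show ?thesis
      unfolding A_def using frame.tjurina_at_saturation[OF _ f] saturation_if_tjurina_at[OF f d _ qs(1)]
      by blast
  qed
  have subA: "poly3.subspace A"
    by (rule poly3.subspaceI)
       (auto simp: A_iff intro: tjurina_at_0 tjurina_at_add tjurina_at_smul homog_add homog_smul)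
  have subJ: "poly3.subspace J" unfolding J_def by (rule subspace_jacobian_degree)
  have W: "W = poly3.span {f}" by (simp add: W_def poly3.span_singleton)
  then have subW: "poly3.subspace W" by simp
  have JA: "J \<subseteq> A" using jacobian_in_saturation by (auto simp: J_def A_def)
  have "f \<in> J" using self_in_jacobian[OF f d] f by (simp add: J_def)
  then have WJ: "W \<subseteq> J" using poly3.subspace_scale[OF subJ] by (auto simp: W_def)
  have T: "finite ((\<lambda>m. sg m (1::complex)) ` {m :: 3 \<Rightarrow>\<^sub>0 nat. mdeg m \<le> d})"
    "A \<subseteq> poly3.span ((\<lambda>m. sg m 1) ` {m. mdeg m \<le> d})" "J \<subseteq> poly3.span ((\<lambda>m. sg m 1) ` {m. mdeg m \<le> d})"
    using finite_mdeg_le[of d] homog_subset_span[of d] by (auto simp: A_def J_def)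
  have cls: "tangent_class d f h = S.cl W h" for h
    by (simp add: tangent_class_def W_def S.coset_vspace)
  have PN: "T_PN d f = S.quot W (homog d)" by (simp add: T_PN_def W_def S.quotient_space_eq)
  have orbit: "T_orbit d f = S.quot W J"
  proof -
    have "{tangent_class d f h | h B. h \<in> homog d \<and>
       (\<forall>m. ((\<lambda>t. lk (lin_subst (\<chi> i j. (if i = j then 1 else 0) + t * B $ i $ j) f) m)
             has_field_derivative lk h m) (at 0))} = S.cl W ` J"
      unfolding orbit_derivative_iff cls
      using jacobian_degree_d(2)[OF f d] unfolding J_def[symmetric] by (auto simp: J_def)
    then show ?thesis unfolding T_orbit_def PN by (simp add: S.quot_carrier_update)
  qed
  have stratum: "T_V_ea d f b I = S.quot W A"
  proof -
    let ?h = "\<lambda>v. \<Sum>i<dim_PN d. smul (v i) (b i)"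
    have hd: "?h v \<in> homog d" for v
      using PN_chart_spans(1)[OF chart] by (intro homog_sum homog_smul) auto
    have zt: "v \<in> zariski_tangent (dim_PN d) I \<longleftrightarrow> ?h v \<in> A" if "\<forall>i\<ge>dim_PN d. v i = 0" for v
      using zariski_tangent_iff_tjurina_at[OF qs(2) I, of v] that hd A_iff by blast
    have "{S.cl W (?h v) | v. v \<in> zariski_tangent (dim_PN d) I} = S.cl W ` A"
    proof (intro equalityI subsetI)
      fix X assume "X \<in> {S.cl W (?h v) | v. v \<in> zariski_tangent (dim_PN d) I}"
      then obtain v where v: "X = S.cl W (?h v)" "v \<in> zariski_tangent (dim_PN d) I" by blast
      then have "\<forall>i\<ge>dim_PN d. v i = 0" by (simp add: zariski_tangent_def)
      then show "X \<in> S.cl W ` A" using zt v by blast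
    next
      fix X assume "X \<in> S.cl W ` A"
      then obtain h where h: "X = S.cl W h" "h \<in> A" by blast
      then obtain c v where v: "\<forall>i\<ge>dim_PN d. v i = 0" "h = smul c f + ?h v"
        using PN_chart_spans(2)[OF chart, of h] by (auto simp: A_def)
      \<comment> \<open>The chart misses the direction \<open>f\<close>; removing the component
        \<open>c f\<close> does not change the class modulo \<open>W\<close>.\<close>
      have "smul c f \<in> W" unfolding W_def by (rule rangeI)
      then have "?h v \<in> A" using poly3.subspace_diff[OF subA h(2), of "smul c f"] WJ JA v(2) by auto
      moreover have "X = S.cl W (?h v)"
        using h(1) v(2) S.cl_eq_iff[OF subW] \<open>smul c f \<in> W\<close> by simp
      ultimately show "X \<in> {S.cl W (?h v) | v. v \<in> zariski_tangent (dim_PN d) I}"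
        using zt[OF v(1)] by blast
    qed
    then show ?thesis unfolding T_V_ea_def PN cls by (simp add: S.quot_carrier_update)
  qed
  have jac: "jacobian_module f d = S.quot J A"
    by (simp add: jacobian_module_def J_def A_def S.quotient_space_eq)
  have WA: "W \<subseteq> A" using WJ JA by blast
  \<comment> \<open>The count is \<open>dim A - 1\<close>, with
    \<open>dim A = n_jac f d + dim J\<close> and \<open>dim J = 9 - ar f 1\<close>.\<close>
  have "poly3.dim W = 1"
    unfolding W poly3.dim_span using poly3.dim_eq_card_independent[of "{f}"] assms(2) by simp
  then have "vectorspace.dim complex_field (T_V_ea d f b I) + 1 = poly3.dim A"
    using S.dim_quot(2)[OF subW subA WA T(1,2)] stratum by simp
  moreover have "n_jac f d + poly3.dim J = poly3.dim A"
    using S.dim_quot(2)[OF subJ subA JA T(1,2)] by (simp add: n_jac_def jac)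
  moreover have "poly3.dim J + ar f 1 = 9"
    unfolding J_def by (rule dim_jacobian_degree_d[OF f d])
  ultimately have "int (vectorspace.dim complex_field (T_V_ea d f b I)) = 8 - int (ar f 1) + int (n_jac f d)"
    by linarith
  moreover have "vectorspace.fin_dim complex_field (T_V_ea d f b I)"
    using S.dim_quot(1)[OF subW subA WA T(1,2)] stratum by simp
  moreover have "\<exists>p. short_exact (T_orbit d f) (T_V_ea d f b I) (jacobian_module f d) (\<lambda>X. X) p"
    unfolding orbit stratum jac by (rule S.short_exact_quot[OF subW subJ subA WJ JA])
  ultimately show ?thesis by blast
qed

end
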